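(* Let $d\ge 1$ and let $\{s_\alpha\}_{\alpha\in\mathbb{N}_0^d}$ be a positive multisequence with $s_{(0,\ldots,0)}=1$ and such that $L(p\overline{p})>0$ for every nonzero $p\in\mathbb{C}[x]$. Suppose that for every $\alpha=(\alpha_1,\ldots,\alpha_d)\in\mathbb{N}_0^d$, $$s_\alpha=s_{(\alpha_1,0,0,\ldots,0)}\,s_{(0,\alpha_2,0,\ldots,0)}\cdots s_{(0,\ldots,0,\alpha_d)}.$$ Then there is a positive measure $\mu$ on $\mathbb{R}^d$ which represents the multisequence, in the sense that $\int_{\mathbb{R}^d}x^\alpha\,d\mu=s_\alpha$ for all $\alpha\in\mathbb{N}_0^d$. Moreover, the following four conditions are equivalent: (1) $\gamma_1>0$; (2) $\gamma_R>0$ for all $R>0$; (3) $\sum_{\alpha\in\mathbb{N}_0^d}|P_\alpha(z)|^2$ is bounded uniformly on compact subsets of $\mathbb{C}^d$; (4) $\sum_{\alpha\in\mathbb{N}_0^d}|P_\alpha(z)|^2<\infty$ for some $z\in(\mathbb{C}\setminus\mathbb{R})^d$; and each of these conditions implies that $\mu$ is indeterminate.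
   Context: Notation: $\mathbb{N}_0=\{0,1,2,\ldots\}$; for $\alpha\in\mathbb{N}_0^d$, $|\alpha|=\alpha_1+\cdots+\alpha_d$ and $x^\alpha=x_1^{\alpha_1}\cdots x_d^{\alpha_d}$; $\mathbb{C}[x]=\mathbb{C}[x_1,\ldots,x_d]$; for $p\in\mathbb{C}[x]$, $\overline{p}$ is the polynomial obtained by conjugating the coefficients of $p$. Given a multisequence $\{s_\alpha\}_{\alpha\in\mathbb{N}_0^d}$, let $L:\mathbb{C}[x]\to\mathbb{C}$ be the linear functional with $L(x^\alpha)=s_\alpha$. The multisequence is called positive if $L(p\overline{p})\ge 0$ for every $p\in\mathbb{C}[x]$. Put $\langle p,q\rangle=L(p\overline{q})$. For $R>0$ and $N\in\mathbb{N}$, let $$H_{R,N}=\left(\frac{s_{\alpha+\beta}}{R^{|\alpha+\beta|}}\right)_{0\le|\alpha|,|\beta|\le N}$$ (rows and columns indexed by multi-indices $\alpha,\beta\in\mathbb{N}_0^d$ of length at most $N$), let $\lambda_{R,N}$ be the smallest eigenvalue of $H_{R,N}$, and let $\gamma_R=\lim_{N\to\infty}\lambda_{R,N}$ (for each fixed $R$ the numbers $\lambda_{R,N}$ are nonnegative and nonincreasing in $N$, so the limit exists). $\{P_\alpha\}_{\alpha\in\mathbb{N}_0^d}$ denotes the system of polynomials, orthonormal with respect to $\langle\cdot,\cdot\rangle$, obtained by applying Gram–Schmidt to the monomials $\{x^\alpha\}$ in graded lexicographic order; in particular $\deg P_\alpha=|\alpha|$. A positive measure $\mu$ on $\mathbb{R}^d$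 having finite moments of all orders is called determinate if it is the only positive measure on $\mathbb{R}^d$ with the moments $\int x^\alpha\,d\mu$, $\alpha\in\mathbb{N}_0^d$, and indeterminate otherwise. *)

theory Defs
  imports "HOL-Analysis.Analysis" "HOL-Library.Poly_Mapping" "HOL-Library.Complex_Order"
begin

text \<open>
  The dimension \<open>d\<close> is the cardinality of an index type \<open>'d\<close>, whose linear order is the order of
  the variables. Multi-indices and complex polynomials are finitely supported functions;
  multiplication on \<open>'d mpoly\<close> is the convolution product of the library, i.e. the product of
  polynomials.
\<close>

type_synonym 'd mindex = "'d \<Rightarrow>\<^sub>0 nat"
type_synonym 'd mpoly = "('d \<Rightarrow>\<^sub>0 nat) \<Rightarrow>\<^sub>0 complex"

definition mdeg :: "'d::finite mindex \<Rightarrow> nat"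
  where "mdeg \<alpha> = (\<Sum>i\<in>UNIV. Poly_Mapping.lookup \<alpha> i)"

definition mpower :: "'a::comm_monoid_mult ^ 'd::finite \<Rightarrow> 'd mindex \<Rightarrow> 'a"
  where "mpower x \<alpha> = (\<Prod>i\<in>UNIV. (x $ i) ^ Poly_Mapping.lookup \<alpha> i)"

definition mvar_power :: "'d mindex \<Rightarrow> 'd mpoly"
  where "mvar_power \<alpha> = Poly_Mapping.single \<alpha> 1"

definition mconst :: "complex \<Rightarrow> 'd mpoly"
  where "mconst c = Poly_Mapping.single 0 c"

definition mcnj :: "'d mpoly \<Rightarrow> 'd mpoly"
  where "mcnj p = Poly_Mapping.map cnj p"

definition meval :: "'d::finite mpoly \<Rightarrow> complex ^ 'd \<Rightarrow> complex"
  where "meval p z = (\<Sum>\<alpha>\<in>Poly_Mapping.keys p. Poly_Mapping.lookup p \<alpha> * mpower z \<alpha>)"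

definition Lfun :: "('d mindex \<Rightarrow> complex) \<Rightarrow> 'd mpoly \<Rightarrow> complex"
  where "Lfun s p = (\<Sum>\<alpha>\<in>Poly_Mapping.keys p. Poly_Mapping.lookup p \<alpha> * s \<alpha>)"

text \<open>
  The order on \<^typ>\<open>complex\<close> is the partial order of \<^theory>\<open>HOL-Library.Complex_Order\<close>:
  \<open>0 \<le> w\<close> says that \<open>w\<close> is real and nonnegative.
\<close>

definition positive_multisequence :: "('d mindex \<Rightarrow> complex) \<Rightarrow> bool"
  where "positive_multisequence s \<longleftrightarrow> (\<forall>p. 0 \<le> Lfun s (p * mcnj p))"

definition minner :: "('d mindex \<Rightarrow> complex) \<Rightarrow> 'd mpoly \<Rightarrow> 'd mpoly \<Rightarrow> complex"
  where "minner s p q = Lfun s (p * mcnj q)"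


text \<open>
  A square matrix with rows and columns indexed by a finite set \<open>I\<close> is a function of two arguments
  of which only the values on \<open>I \<times> I\<close> matter.
\<close>

definition is_eigenvalue :: "'i set \<Rightarrow> ('i \<Rightarrow> 'i \<Rightarrow> complex) \<Rightarrow> complex \<Rightarrow> bool"
  where "is_eigenvalue I A k \<longleftrightarrow>
    (\<exists>v. (\<exists>i\<in>I. v i \<noteq> 0) \<and> (\<forall>i\<in>I. (\<Sum>j\<in>I. A i j * v j) = k * v i))"

text \<open>Meant for Hermitian matrices, all of whose eigenvalues are real.\<close>

definition smallest_eigenvalue :: "'i set \<Rightarrow> ('i \<Rightarrow> 'i \<Rightarrow> complex) \<Rightarrow> real"
  where "smallest_eigenvalue I A = Min {r. is_eigenvalue I A (complex_of_real r)}"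

definition Hmat :: "('d::finite mindex \<Rightarrow> complex) \<Rightarrow> real \<Rightarrow> 'd mindex \<Rightarrow> 'd mindex \<Rightarrow> complex"
  where "Hmat s R \<alpha> \<beta> = s (\<alpha> + \<beta>) / complex_of_real (R ^ mdeg (\<alpha> + \<beta>))"

definition lambda_RN :: "('d::finite mindex \<Rightarrow> complex) \<Rightarrow> real \<Rightarrow> nat \<Rightarrow> real"
  where "lambda_RN s R N = smallest_eigenvalue {\<alpha>. mdeg \<alpha> \<le> N} (Hmat s R)"

definition gamma_R :: "('d::finite mindex \<Rightarrow> complex) \<Rightarrow> real \<Rightarrow> real"
  where "gamma_R s R = lim (\<lambda>N. lambda_RN s R N)"


text \<open>
  The order \<open><\<close> on \<open>'d mindex\<close> is lexicographic: at the first index where the two arguments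
  differ, the smaller one has the smaller entry.
\<close>

definition grlex_less :: "'d::{finite,linorder} mindex \<Rightarrow> 'd mindex \<Rightarrow> bool"
  where "grlex_less \<alpha> \<beta> \<longleftrightarrow> mdeg \<alpha> < mdeg \<beta> \<or> (mdeg \<alpha> = mdeg \<beta> \<and> \<alpha> < \<beta>)"

lemma finite_mdeg_le: "finite {\<alpha> :: 'd::finite mindex. mdeg \<alpha> \<le> N}"
proof -
  have "Poly_Mapping.lookup ` {\<alpha> :: 'd mindex. mdeg \<alpha> \<le> N} \<subseteq> (UNIV \<rightarrow>\<^sub>E {..N})"
  proof (clarsimp simp: PiE_UNIV_domain)
    fix \<alpha> :: "'d mindex" and i :: 'd
    assume "mdeg \<alpha> \<le> N"
    moreover have "Poly_Mapping.lookup \<alpha> i \<le> mdeg \<alpha>"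
      unfolding mdeg_def by (rule member_le_sum) auto
    ultimately show "Poly_Mapping.lookup \<alpha> i \<le> N" by simp
  qed
  moreover have "finite ((UNIV :: 'd set) \<rightarrow>\<^sub>E {..N})"
    by (rule finite_PiE) auto
  ultimately have "finite (Poly_Mapping.lookup ` {\<alpha> :: 'd mindex. mdeg \<alpha> \<le> N})"
    by (rule finite_subset)
  then show ?thesis
    by (rule finite_imageD) (auto intro!: inj_onI poly_mapping_eqI)
qed

lemma grlex_less_trans: "grlex_less \<alpha> \<beta> \<Longrightarrow> grlex_less \<beta> \<gamma> \<Longrightarrow> grlex_less \<alpha> \<gamma>"
  unfolding grlex_less_def by (metis less_trans)

lemma grlex_less_irrefl: "\<not> grlex_less \<alpha> \<alpha>"
  by (simp add: grlex_less_def)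

lemma finite_grlex_less: "finite {\<beta>. grlex_less \<beta> \<alpha>}"
  by (rule finite_subset[OF _ finite_mdeg_le[of "mdeg \<alpha>"]]) (auto simp: grlex_less_def)

lemma card_grlex_less:
  assumes "grlex_less \<beta> \<alpha>"
  shows "card {\<gamma>. grlex_less \<gamma> \<beta>} < card {\<gamma>. grlex_less \<gamma> \<alpha>}"
  using assms grlex_less_trans grlex_less_irrefl
  by (intro psubset_card_mono finite_grlex_less) blast

definition mnormalize :: "('d mindex \<Rightarrow> complex) \<Rightarrow> 'd mpoly \<Rightarrow> 'd mpoly"
  where "mnormalize s q = mconst (1 / complex_of_real (sqrt (Re (minner s q q)))) * q"

text \<open>The Gram--Schmidt recursion applied to the monomials in graded lexicographic order.\<close>

function orthoP :: "('d::{finite,linorder} mindex \<Rightarrow> complex) \<Rightarrow> 'd mindex \<Rightarrow> 'd mpoly" where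
  "orthoP s \<alpha> = mnormalize s (mvar_power \<alpha> -
     (\<Sum>\<beta> | grlex_less \<beta> \<alpha>. mconst (minner s (mvar_power \<alpha>) (orthoP s \<beta>)) * orthoP s \<beta>))"
  by pat_completeness auto
termination
  by (relation "Wellfounded.measure (\<lambda>(s, \<alpha>). card {\<gamma>. grlex_less \<gamma> \<alpha>})") (auto intro: card_grlex_less)

declare orthoP.simps [simp del]


definition Pseries_bounded_on_compacts :: "('d::{finite,linorder} mindex \<Rightarrow> complex) \<Rightarrow> bool"
  where "Pseries_bounded_on_compacts s \<longleftrightarrow>
    (\<forall>K. compact K \<longrightarrow>
      (\<exists>M. \<forall>z\<in>K. (\<lambda>\<alpha>. (cmod (meval (orthoP s \<alpha>) z))\<^sup>2) summable_on UNIV \<and>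
                (\<Sum>\<^sub>\<infinity>\<alpha>. (cmod (meval (orthoP s \<alpha>) z))\<^sup>2) \<le> M))"

definition Pseries_finite_at_some_nonreal :: "('d::{finite,linorder} mindex \<Rightarrow> complex) \<Rightarrow> bool"
  where "Pseries_finite_at_some_nonreal s \<longleftrightarrow>
    (\<exists>z. (\<forall>i. z $ i \<notin> \<real>) \<and> (\<lambda>\<alpha>. (cmod (meval (orthoP s \<alpha>) z))\<^sup>2) summable_on UNIV)"


text \<open>
  Positive measures on \<open>real ^ 'd\<close> are Borel measures; \<open>represents\<close> and \<open>determinate\<close> require
  integrability explicitly, since \<open>integral\<^sup>L\<close> of a non-integrable function is \<open>0\<close>.
\<close>

definition finite_moments :: "(real ^ 'd::finite) measure \<Rightarrow> bool"
  where "finite_moments \<mu> \<longleftrightarrow> sets \<mu> = sets borel \<and> (\<forall>\<alpha>. integrable \<mu> (\<lambda>x. mpower x \<alpha>))"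

definition represents :: "(real ^ 'd::finite) measure \<Rightarrow> ('d mindex \<Rightarrow> complex) \<Rightarrow> bool"
  where "represents \<mu> s \<longleftrightarrow>
    finite_moments \<mu> \<and> (\<forall>\<alpha>. complex_of_real (\<integral>x. mpower x \<alpha> \<partial>\<mu>) = s \<alpha>)"

definition determinate :: "(real ^ 'd::finite) measure \<Rightarrow> bool"
  where "determinate \<mu> \<longleftrightarrow>
    (\<forall>\<nu>. finite_moments \<nu> \<and> (\<forall>\<alpha>. (\<integral>x. mpower x \<alpha> \<partial>\<nu>) = (\<integral>x. mpower x \<alpha> \<partial>\<mu>)) \<longrightarrow> \<nu> = \<mu>)"

abbreviation indeterminate :: "(real ^ 'd::finite) measure \<Rightarrow> bool"
  where "indeterminate \<mu> \<equiv> \<not> determinate \<mu>"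

end

theory Submission
  imports Defs "HOL-Probability.Probability" "HOL-Computational_Algebra.Fundamental_Theorem_Algebra"
begin

text \<open>
  Every condition is a positive semidefiniteness statement about kernels on multi-indices:
  \<open>\<Sum> \<bar>P\<^sub>\<alpha>(z)\<bar>\<^sup>2 \<le> C\<close> says that \<open>C s\<^sub>\<alpha>\<^sub>+\<^sub>\<beta> - z\<^sup>\<alpha> cnj(z\<^sup>\<beta>)\<close> is positive semidefinite, and \<open>\<gamma>\<^sub>R > 0\<close> says the
  same of \<open>s\<^sub>\<alpha>\<^sub>+\<^sub>\<beta> - c R\<^sup>2\<^sup>|\<^sup>\<alpha>\<^sup>| \<delta>\<^sub>\<alpha>\<^sub>\<beta>\<close> for some \<open>c > 0\<close>. Restricting to powers of one variable passes from
  the multisequence to its marginals, and the Schur product theorem passes back, because \<open>s\<close> is a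
  product. So all four conditions are equivalent to local boundedness of the evaluations of the
  marginals, which is a matter of one variable: boundedness at one nonreal point suffices, by a
  quasinilpotency argument.

  Hamburger's theorem in one variable (Gauss quadrature and Helly's theorem) and product measures
  give the representing measure. If the evaluations at all real points are bounded, every real
  number is an atom of some representing measure of a marginal; hence a single measure cannot
  account for all of them.
\<close>

section \<open>Positive semidefinite kernels\<close>

text \<open>Kernels replace polynomials because the entrywise product, which matches the
  factorisation of \<open>s\<close>, is not visible on polynomials. The comparison kernels
  z^\<alpha> cnj(z^\<beta>) and R^(2|\<alpha>|) \<delta> also factor over the variables and are
  positive semidefinite, so inequalities between the factors multiply, and so do the constants. One
  point, or one radius, is enough because of the one-variable step. Condition (4) gives every
  marginal a nonreal point; \<gamma>_1 > 0 bounds coefficients, hence evaluations inside the unit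
  disc, for instance at i/2. Multiplication by x - w is bounded below by |Im w|, so the difference
  quotient at w is a bounded operator once evaluation at w is bounded. Below the diagonal its matrix
  is a sum of two products of square-summable sequences, and a discrete Gronwall inequality then
  bounds the sums of |p_n(z)|^2 at every z. Averaging over a circle of radius R turns these bounds
  into weighted coefficient bounds, which is what \<gamma>_R > 0 needs.\<close>

lemma of_real_cmod_square: "(complex_of_real (cmod z))\<^sup>2 = z * cnj z"
  using complex_norm_square[of z] by simp

lemma complex_nonneg_of_real_square [simp]: "0 \<le> (complex_of_real x)\<^sup>2"
  by (simp add: less_eq_complex_def)

lemma complex_pos_E:
  fixes z :: complex
  assumes "0 \<le> z" "z \<noteq> 0"
  obtains r where "z = complex_of_real r" "r > 0"
  using assms by (intro that[of "Re z"]) (auto simp: less_eq_complex_def complex_eq_iff)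

text \<open>The conjugate sits on the second index, so that for the moment kernel and the
  coefficients of p the form is L(p cnj p).\<close>

definition qform :: "('i \<Rightarrow> 'i \<Rightarrow> complex) \<Rightarrow> 'i set \<Rightarrow> ('i \<Rightarrow> complex) \<Rightarrow> complex" where
  "qform K S v = (\<Sum>i\<in>S. \<Sum>j\<in>S. v i * cnj (v j) * K i j)"

text \<open>\<open>0 \<le>\<close> in the order on complex numbers includes being real, so Hermitian
  symmetry is a consequence and not a further requirement.\<close>

definition psd_on :: "'i set \<Rightarrow> ('i \<Rightarrow> 'i \<Rightarrow> complex) \<Rightarrow> bool" where
  "psd_on S K \<longleftrightarrow> (\<forall>v. 0 \<le> qform K S v)"

definition psd :: "('i \<Rightarrow> 'i \<Rightarrow> complex) \<Rightarrow> bool" where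
  "psd K \<longleftrightarrow> (\<forall>S. finite S \<longrightarrow> psd_on S K)"

lemma qform_cong:
  assumes "\<And>i j. i \<in> S \<Longrightarrow> j \<in> S \<Longrightarrow> K i j = K' i j"
    and "\<And>i. i \<in> S \<Longrightarrow> v i = w i"
  shows "qform K S v = qform K' S w"
  using assms unfolding qform_def by (intro sum.cong) auto

lemma qform_add: "qform (\<lambda>i j. K i j + K' i j) S v = qform K S v + qform K' S v"
  by (simp add: qform_def sum.distrib algebra_simps)

lemma qform_diff: "qform (\<lambda>i j. K i j - K' i j) S v = qform K S v - qform K' S v"
  by (simp add: qform_def sum_subtractf algebra_simps)

lemma qform_cmult: "qform (\<lambda>i j. c * K i j) S v = c * qform K S v"
  by (simp add: qform_def sum_distrib_left algebra_simps)

lemma qform_sum: "qform (\<lambda>i j. \<Sum>k\<in>A. K k i j) S v = (\<Sum>k\<in>A. qform (K k) S v)"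
  by (induction A rule: infinite_finite_induct) (simp_all add: qform_add, simp_all add: qform_def)

lemma qform_outer:
  "qform (\<lambda>i j. f i * cnj (f j)) S v = complex_of_real ((cmod (\<Sum>i\<in>S. v i * f i))\<^sup>2)"
proof -
  have "qform (\<lambda>i j. f i * cnj (f j)) S v = (\<Sum>i\<in>S. v i * f i) * cnj (\<Sum>i\<in>S. v i * f i)"
    by (simp add: qform_def sum_product mult_ac)
  then show ?thesis
    by (simp only: complex_norm_square)
qed

lemma qform_diag:
  assumes "finite S"
  shows "qform (\<lambda>i j. if i = j then d i else 0) S v = (\<Sum>i\<in>S. complex_of_real ((cmod (v i))\<^sup>2) * d i)"
proof -
  have "qform (\<lambda>i j. if i = j then d i else 0) S v
      = (\<Sum>i\<in>S. \<Sum>j\<in>S. if i = j then v i * cnj (v j) * d i else 0)"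
    unfolding qform_def by (intro sum.cong) auto
  also have "\<dots> = (\<Sum>i\<in>S. complex_of_real ((cmod (v i))\<^sup>2) * d i)"
    using assms by (simp add: of_real_cmod_square)
  finally show ?thesis .
qed

lemma qform_mono_support:
  assumes "finite T" "S \<subseteq> T" "\<And>i. i \<in> T - S \<Longrightarrow> v i = 0"
  shows "qform K S v = qform K T v"
proof -
  have "qform K S v = (\<Sum>i\<in>S. \<Sum>j\<in>T. v i * cnj (v j) * K i j)"
    unfolding qform_def using assms by (intro sum.cong refl sum.mono_neutral_left) auto
  also have "\<dots> = qform K T v"
    unfolding qform_def using assms by (intro sum.mono_neutral_left) auto
  finally show ?thesis .
qed

lemma psd_onD: "psd_on S K \<Longrightarrow> 0 \<le> qform K S v"
  by (simp add: psd_on_def)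

lemma psdD: "psd K \<Longrightarrow> finite S \<Longrightarrow> 0 \<le> qform K S v"
  by (simp add: psd_def psd_on_def)

lemma psdI: "(\<And>S v. finite S \<Longrightarrow> 0 \<le> qform K S v) \<Longrightarrow> psd K"
  by (simp add: psd_def psd_on_def)

lemma psd_on_subset:
  assumes "psd_on T K" "finite T" "S \<subseteq> T"
  shows "psd_on S K"
  unfolding psd_on_def
proof
  fix v
  have "qform K S v = qform K S (\<lambda>i. if i \<in> S then v i else 0)"
    by (rule qform_cong) auto
  also have "\<dots> = qform K T (\<lambda>i. if i \<in> S then v i else 0)"
    by (rule qform_mono_support) (use assms in auto)
  also have "0 \<le> \<dots>"
    by (rule psd_onD[OF assms(1)])
  finally show "0 \<le> qform K S v" .
qed

lemma psd_on_diag: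
  assumes "psd_on S K" "finite S" "i \<in> S"
  shows "0 \<le> K i i"
proof -
  have "psd_on {i} K"
    by (rule psd_on_subset[OF assms(1,2)]) (use assms in auto)
  from psd_onD[OF this, of "\<lambda>_. 1"] show ?thesis
    by (simp add: qform_def)
qed

text \<open>Only the reality of the form counts: the vector (1, 1) makes the imaginary parts of
  \<open>K i j\<close> and \<open>K j i\<close> cancel, and (1, i) makes their real parts
  agree.\<close>

lemma psd_on_hermitian:
  assumes "psd_on S K" "finite S" "i \<in> S" "j \<in> S"
  shows "K j i = cnj (K i j)"
proof (cases "i = j")
  case True
  with psd_on_diag[OF assms(1-3)] show ?thesis
    by (auto simp: less_eq_complex_def complex_eq_iff)
next
  case False
  have psd: "psd_on {i, j} K"
    by (rule psd_on_subset[OF assms(1,2)]) (use assms in auto)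
  have d: "0 \<le> K i i" "0 \<le> K j j"
    using psd_on_diag[OF assms(1,2)] assms(3,4) by auto
  have "0 \<le> K i i + K j j + K i j + K j i"
    using psd_onD[OF psd, of "\<lambda>_. 1"] False by (simp add: qform_def algebra_simps)
  moreover have "0 \<le> K i i + K j j - \<i> * K i j + \<i> * K j i"
    using psd_onD[OF psd, of "\<lambda>k. if k = i then 1 else \<i>"] False
    by (simp add: qform_def algebra_simps)
  ultimately show ?thesis
    using d by (simp add: less_eq_complex_def complex_eq_iff)
qed

text \<open>The first-order condition at a minimum. It removes the column of a vanishing pivot in
  \<open>psd_on_gram\<close> and shows that a minimizer of the Rayleigh quotient is an
  eigenvector.\<close>

lemma quadratic_nonneg_imp_linear_zero:
  fixes b c :: real
  assumes "\<And>t. 0 \<le> 2 * t * b + t\<^sup>2 * c"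
  shows "b = 0"
proof (rule ccontr)
  assume b: "b \<noteq> 0"
  \<comment> \<open>Here b = -t (|c| + 1), so the linear term contributes -2 t^2 (|c| + 1) and
    outweighs t^2 c.\<close>
  define t where "t = - b / (\<bar>c\<bar> + 1)"
  have pos: "\<bar>c\<bar> + 1 > 0" by simp
  have "b = - t * (\<bar>c\<bar> + 1)"
    using pos by (simp add: t_def)
  then have "2 * t * b + t\<^sup>2 * c = t\<^sup>2 * (c - 2 * (\<bar>c\<bar> + 1))"
    by (simp add: power2_eq_square left_diff_distrib right_diff_distrib)
  moreover have "t \<noteq> 0"
    using b pos by (simp add: t_def)
  then have "t\<^sup>2 * (c - 2 * (\<bar>c\<bar> + 1)) < 0"
    using b by (intro mult_pos_neg) auto
  ultimately show False
    using assms[of t] by linarith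
qed

lemma qform_insert:
  assumes "finite S" "a \<notin> S" "\<And>j. j \<in> S \<Longrightarrow> K a j = cnj (K j a)"
  shows "qform K (insert a S) v = qform K S v + v a * cnj (\<Sum>j\<in>S. v j * K j a)
    + cnj (v a) * (\<Sum>j\<in>S. v j * K j a) + complex_of_real ((cmod (v a))\<^sup>2) * K a a"
  using assms by (simp add: qform_def sum.distrib sum_distrib_left of_real_cmod_square algebra_simps)

text \<open>
  The Schur complement gives the minimum of the form over the value of the vector at \<open>a\<close>.
\<close>
lemma psd_on_schur_complement:
  assumes "psd_on (insert a S) K" "finite S" "a \<notin> S" "K a a \<noteq> 0"
  shows "psd_on S (\<lambda>i j. K i j - K i a * cnj (K j a) / K a a)"
  unfolding psd_on_def
proof
  fix v
  have "0 \<le> K a a"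
    by (rule psd_on_diag[OF assms(1)]) (use assms in auto)
  then obtain r where r: "K a a = complex_of_real r" "r > 0"
    using assms(4) by (rule complex_pos_E)
  define c where "c = (\<Sum>j\<in>S. v j * K j a)"
  define w where "w = v(a := - c / K a a)"
  have h: "K a j = cnj (K j a)" if "j \<in> S" for j
    by (rule psd_on_hermitian[OF assms(1)]) (use assms that in auto)
  have "qform K S w = qform K S v"
    using assms(3) by (intro qform_cong) (auto simp: w_def)
  moreover have "(\<Sum>j\<in>S. w j * K j a) = c"
    unfolding c_def using assms(3) by (intro sum.cong) (auto simp: w_def)
  moreover have "w a = - c / of_real r"
    by (simp add: w_def r)
  ultimately have "qform K (insert a S) w = qform K S v + (- c / of_real r) * cnj c
      + cnj (- c / of_real r) * c + (of_real ((cmod (- c / of_real r))\<^sup>2)) * of_real r"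
    using qform_insert[OF assms(2,3), of K w] h r by simp
  also have "\<dots> = qform K S v - c * cnj c / of_real r"
    unfolding complex_norm_square using r(2) by (simp add: field_simps)
  also have "c * cnj c / of_real r = qform (\<lambda>i j. K i a * cnj (K j a) / K a a) S v"
    using qform_outer[of "\<lambda>i. K i a" S v] qform_cmult[of "1 / of_real r" "\<lambda>i j. K i a * cnj (K j a)" S v]
    by (simp add: c_def r of_real_cmod_square del: cnj_sum)
  also have "qform K S v - \<dots> = qform (\<lambda>i j. K i j - K i a * cnj (K j a) / K a a) S v"
    by (simp add: qform_diff)
  finally show "0 \<le> qform (\<lambda>i j. K i j - K i a * cnj (K j a) / K a a) S v"
    using psd_onD[OF assms(1), of w] by simp
qed

text \<open>Cholesky factorisation, one Schur complement per element. The factors are indexed by S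
  itself: each pivot contributes the vector with its own index.\<close>

lemma psd_on_gram:
  assumes "finite S" "psd_on S K"
  obtains u :: "'i \<Rightarrow> 'i \<Rightarrow> complex"
    where "\<And>i j. i \<in> S \<Longrightarrow> j \<in> S \<Longrightarrow> K i j = (\<Sum>k\<in>S. u k i * cnj (u k j))"
proof -
  have "\<exists>u. \<forall>i\<in>S. \<forall>j\<in>S. K i j = (\<Sum>k\<in>S. u k i * cnj (u k j))"
    using assms
  proof (induction S arbitrary: K rule: finite_induct)
    case empty
    then show ?case by simp
  next
    case (insert a S)
    have h: "K a j = cnj (K j a)" if "j \<in> insert a S" for j
      by (rule psd_on_hermitian[OF insert.prems]) (use insert that in auto)
    show ?case
    proof (cases "K a a = 0")
      case True
      \<comment> \<open>A zero pivot allows no Schur complement, but positivity on {j, a} then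
        forces the column of \<open>a\<close> to vanish.\<close>
      have z: "K j a = 0" if "j \<in> S" for j
      proof -
        have "psd_on {j, a} K"
          by (rule psd_on_subset[OF insert.prems]) (use insert that in auto)
        moreover have "j \<noteq> a" using that insert by auto
        ultimately have q: "0 \<le> of_real ((cmod c)\<^sup>2) * K j j + c * cnj d * K j a + d * cnj c * K a j" for c d
          using psd_onD[of "{j, a}" K "\<lambda>k. if k = j then c else d"] True
          by (simp add: qform_def algebra_simps of_real_cmod_square)
        \<comment> \<open>The vector has entries t cnj(K j a) at j and -1 at a; the form becomes a
          quadratic polynomial in t without constant term, with linear coefficient -2 |K j
          a|^2.\<close>
        have "0 \<le> 2 * t * (- (cmod (K j a))\<^sup>2) + t\<^sup>2 * (cmod (K j a))\<^sup>2 * Re (K j j)" for t :: real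
        proof -
          have e: "of_real ((cmod (of_real t * cnj (K j a)))\<^sup>2) * K j j
              + of_real t * cnj (K j a) * cnj (-1) * K j a + (-1) * cnj (of_real t * cnj (K j a)) * K a j
            = of_real (t\<^sup>2 * (cmod (K j a))\<^sup>2) * K j j - of_real (2 * t * (cmod (K j a))\<^sup>2)"
            using h[of j] that unfolding norm_mult power_mult_distrib of_real_mult complex_norm_square
            by (simp add: algebra_simps power2_eq_square)
          have "0 \<le> Re (of_real (t\<^sup>2 * (cmod (K j a))\<^sup>2) * K j j - of_real (2 * t * (cmod (K j a))\<^sup>2))"
            using q[of "of_real t * cnj (K j a)" "-1"] unfolding e less_eq_complex_def by simp
          also have "\<dots> = t\<^sup>2 * (cmod (K j a))\<^sup>2 * Re (K j j) - 2 * t * (cmod (K j a))\<^sup>2"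
            by simp
          finally show ?thesis
            by linarith
        qed
        then have "- (cmod (K j a))\<^sup>2 = 0"
          by (intro quadratic_nonneg_imp_linear_zero[where c = "(cmod (K j a))\<^sup>2 * Re (K j j)"]) (simp add: mult.assoc)
        then show ?thesis by simp
      qed
      have "psd_on S K"
        by (rule psd_on_subset[OF insert.prems]) (use insert.hyps in auto)
      from insert.IH[OF this]
      obtain u where u: "\<And>i j. i \<in> S \<Longrightarrow> j \<in> S \<Longrightarrow> K i j = (\<Sum>k\<in>S. u k i * cnj (u k j))"
        by blast
      define w where "w = (\<lambda>k i. if k = a \<or> i = a then 0 else u k i)"
      have "K i j = (\<Sum>k\<in>insert a S. w k i * cnj (w k j))" if "i \<in> insert a S" "j \<in> insert a S" for i j
      proof (cases "i = a \<or> j = a")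
        case True
        then show ?thesis
          using that z h[of i] h[of j] \<open>K a a = 0\<close> insert.hyps by (auto simp: w_def)
      next
        case False
        then have "(\<Sum>k\<in>S. w k i * cnj (w k j)) = (\<Sum>k\<in>S. u k i * cnj (u k j))"
          using insert.hyps by (intro sum.cong) (auto simp: w_def)
        with False show ?thesis
          using that u insert.hyps by (simp add: w_def)
      qed
      then show ?thesis by blast
    next
      case False
      obtain u where u: "\<And>i j. i \<in> S \<Longrightarrow> j \<in> S \<Longrightarrow>
          K i j - K i a * cnj (K j a) / K a a = (\<Sum>k\<in>S. u k i * cnj (u k j))"
        using insert.IH[OF psd_on_schur_complement[OF insert.prems]] insert.hyps False by blast
      have "0 \<le> K a a"
        by (rule psd_on_diag[OF insert.prems]) (use insert in auto)
      then obtain r where r: "K a a = complex_of_real r" "r > 0"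
        using False by (rule complex_pos_E)
      \<comment> \<open>Row \<open>a\<close> reproduces the term subtracted in the Schur complement;
        the other rows vanish at \<open>a\<close>, where the complement is zero.\<close>
      define w where "w = (\<lambda>k i. if k = a then K i a / of_real (sqrt r) else if i = a then 0 else u k i)"
      have sq: "complex_of_real (sqrt r) * of_real (sqrt r) = of_real r"
        using r(2) by (simp flip: of_real_mult)
      have wa: "w a i * cnj (w a j) = K i a * cnj (K j a) / K a a" for i j
        using sq by (simp add: w_def r)
      have "K i j = (\<Sum>k\<in>insert a S. w k i * cnj (w k j))" if "i \<in> insert a S" "j \<in> insert a S" for i j
      proof -
        have split: "(\<Sum>k\<in>insert a S. w k i * cnj (w k j))
            = K i a * cnj (K j a) / K a a + (\<Sum>k\<in>S. w k i * cnj (w k j))"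
          using insert.hyps wa by simp
        show ?thesis
        proof (cases "i = a \<or> j = a")
          case True
          then have "(\<Sum>k\<in>S. w k i * cnj (w k j)) = 0"
            using insert.hyps by (intro sum.neutral) (auto simp: w_def)
          with True show ?thesis
            using split h[of j] h[of a] that False by auto
        next
          case False
          then have "(\<Sum>k\<in>S. w k i * cnj (w k j)) = (\<Sum>k\<in>S. u k i * cnj (u k j))"
            using insert.hyps by (intro sum.cong) (auto simp: w_def)
          with False show ?thesis
            using split u[of i j] that by (simp add: algebra_simps)
        qed
      qed
      then show ?thesis by blast
    qed
  qed
  with that show ?thesis by blast
qed

section \<open>Closure properties: sums, pullbacks and entrywise products\<close>

lemma psd_add: "psd K \<Longrightarrow> psd K' \<Longrightarrow> psd (\<lambda>i j. K i j + K' i j)"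
  by (intro psdI) (auto simp: qform_add intro: add_nonneg_nonneg dest: psdD)

lemma psd_cmult: "psd K \<Longrightarrow> 0 \<le> c \<Longrightarrow> psd (\<lambda>i j. c * K i j)"
  by (intro psdI) (auto simp: qform_cmult intro: mult_nonneg_nonneg dest: psdD)

lemma psd_outer: "psd (\<lambda>i j. f i * cnj (f j))"
  by (intro psdI) (simp add: qform_outer)

lemma psd_diag: "(\<And>i. 0 \<le> d i) \<Longrightarrow> psd (\<lambda>i j. if i = j then d i else 0)"
  by (intro psdI) (auto simp: qform_diag intro!: sum_nonneg mult_nonneg_nonneg)

text \<open>\<open>f\<close> need not be injective, so the vector cannot simply be moved to the
  image; a Gram factorisation on the image makes the pulled-back form a sum of squared
  moduli.\<close>

lemma psd_pullback:
  fixes f :: "'a \<Rightarrow> 'i"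
  assumes "psd K"
  shows "psd (\<lambda>i j. K (f i) (f j))"
proof (rule psdI)
  fix S :: "'a set" and v assume fin: "finite S"
  then have "psd_on (f ` S) K"
    using assms by (simp add: psd_def)
  then obtain u where u: "\<And>i j. i \<in> f ` S \<Longrightarrow> j \<in> f ` S \<Longrightarrow> K i j = (\<Sum>k\<in>f ` S. u k i * cnj (u k j))"
    using psd_on_gram[OF finite_imageI[OF fin]] by blast
  have "qform (\<lambda>i j. K (f i) (f j)) S v
      = qform (\<lambda>i j. \<Sum>k\<in>f ` S. u k (f i) * cnj (u k (f j))) S v"
    by (rule qform_cong) (use u in auto)
  also have "\<dots> = (\<Sum>k\<in>f ` S. qform (\<lambda>i j. u k (f i) * cnj (u k (f j))) S v)"
    by (rule qform_sum)
  also have "0 \<le> \<dots>"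
    by (intro sum_nonneg) (simp add: qform_outer)
  finally show "0 \<le> qform (\<lambda>i j. K (f i) (f j)) S v" .
qed

text \<open>Schur product theorem: with K written as a sum of outer products of vectors u_k, the
  form of the product at v is the sum of the forms of K' at the vectors v u_k.\<close>

lemma psd_mult:
  fixes K K' :: "'i \<Rightarrow> 'i \<Rightarrow> complex"
  assumes "psd K" "psd K'"
  shows "psd (\<lambda>i j. K i j * K' i j)"
proof (rule psdI)
  fix S :: "'i set" and v assume fin: "finite S"
  then have "psd_on S K"
    using assms by (simp add: psd_def)
  then obtain u where u: "\<And>i j. i \<in> S \<Longrightarrow> j \<in> S \<Longrightarrow> K i j = (\<Sum>k\<in>S. u k i * cnj (u k j))"
    using psd_on_gram[OF fin] by blast
  have "qform (\<lambda>i j. K i j * K' i j) S v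
      = qform (\<lambda>i j. \<Sum>k\<in>S. u k i * cnj (u k j) * K' i j) S v"
    by (rule qform_cong) (simp_all add: u sum_distrib_right)
  also have "\<dots> = (\<Sum>k\<in>S. qform (\<lambda>i j. u k i * cnj (u k j) * K' i j) S v)"
    by (rule qform_sum)
  also have "\<dots> = (\<Sum>k\<in>S. qform K' S (\<lambda>i. v i * u k i))"
    by (simp add: qform_def mult_ac)
  also have "0 \<le> \<dots>"
    using assms(2) fin by (intro sum_nonneg) (auto dest: psdD)
  finally show "0 \<le> qform (\<lambda>i j. K i j * K' i j) S v" .
qed

lemma psd_prod:
  assumes "finite I" "\<And>i. i \<in> I \<Longrightarrow> psd (K i)"
  shows "psd (\<lambda>a b. \<Prod>i\<in>I. K i a b)"
  using assms
proof (induction I rule: finite_induct)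
  case empty
  show ?case using psd_outer[of "\<lambda>_. 1"] by simp
next
  case (insert x I)
  then have "psd (\<lambda>a b. K x a b * (\<Prod>i\<in>I. K i a b))"
    by (intro psd_mult) auto
  with insert show ?case by simp
qed

text \<open>Telescoping: G G' - F F' = (G - F) G' + F (G' - F'), where each G is positive
  semidefinite as F + (G - F).\<close>

lemma psd_prod_mono:
  assumes "finite I" "\<And>i. i \<in> I \<Longrightarrow> psd (F i)" "\<And>i. i \<in> I \<Longrightarrow> psd (\<lambda>a b. G i a b - F i a b)"
  shows "psd (\<lambda>a b. (\<Prod>i\<in>I. G i a b) - (\<Prod>i\<in>I. F i a b))"
  using assms
proof (induction I rule: finite_induct)
  case empty
  show ?case by (intro psdI) (simp add: qform_def)
next
  case (insert x I)
  have G: "psd (G i)" if "i \<in> insert x I" for i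
    using psd_add[OF insert.prems(1)[OF that] insert.prems(2)[OF that]] by simp
  have "psd (\<lambda>a b. (G x a b - F x a b) * (\<Prod>i\<in>I. G i a b)
      + F x a b * ((\<Prod>i\<in>I. G i a b) - (\<Prod>i\<in>I. F i a b)))"
    using insert G by (intro psd_add psd_mult psd_prod) auto
  moreover have "(G x a b - F x a b) * (\<Prod>i\<in>I. G i a b)
      + F x a b * ((\<Prod>i\<in>I. G i a b) - (\<Prod>i\<in>I. F i a b))
      = (\<Prod>i\<in>insert x I. G i a b) - (\<Prod>i\<in>insert x I. F i a b)" for a b
    using insert.hyps by (simp add: algebra_simps)
  ultimately show ?case by simp
qed

section \<open>Orthogonality for positive Hermitian forms\<close>

text \<open>One setting for polynomials in one and in several variables. The form is only required
  to be semidefinite, and scaling is a parameter, instantiated by \<open>smult\<close> and by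
  multiplication with constants.\<close>

locale hermitian_space = vector_space scale
  for scale :: "complex \<Rightarrow> 'v::ab_group_add \<Rightarrow> 'v" +
  fixes ip :: "'v \<Rightarrow> 'v \<Rightarrow> complex"
  assumes ip_add_left: "ip (x + y) z = ip x z + ip y z"
    and ip_scale_left: "ip (scale c x) z = c * ip x z"
    and ip_commute: "ip y x = cnj (ip x y)"
    and ip_nonneg: "0 \<le> Re (ip x x)"
begin

lemma ip_add_right: "ip z (x + y) = ip z x + ip z y"
  by (metis complex_cnj_add ip_add_left ip_commute)

lemma ip_scale_right: "ip z (scale c x) = cnj c * ip z x"
  by (metis complex_cnj_mult ip_commute ip_scale_left)

lemma ip_zero_left [simp]: "ip 0 z = 0"
  using ip_scale_left[of 0 0 z] by simp

lemma ip_zero_right [simp]: "ip z 0 = 0"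
  using ip_scale_right[of z 0 0] by simp

lemma ip_minus_left: "ip (- x) z = - ip x z"
  using ip_add_left[of x "- x" z] by (simp add: eq_neg_iff_add_eq_0 add.commute)

lemma ip_diff_left: "ip (x - y) z = ip x z - ip y z"
  using ip_add_left[of x "- y" z] by (simp add: ip_minus_left)

lemma ip_diff_right: "ip z (x - y) = ip z x - ip z y"
  by (metis complex_cnj_diff ip_commute ip_diff_left)

lemma ip_sum_left: "ip (\<Sum>i\<in>S. f i) z = (\<Sum>i\<in>S. ip (f i) z)"
  by (induction S rule: infinite_finite_induct) (simp_all add: ip_add_left)

lemma ip_sum_right: "ip z (\<Sum>i\<in>S. f i) = (\<Sum>i\<in>S. ip z (f i))"
  by (induction S rule: infinite_finite_induct) (simp_all add: ip_add_right)

lemma ip_self: "ip x x = complex_of_real (Re (ip x x))"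
  using ip_commute[of x x] by (simp add: complex_eq_iff)

lemma ip_diff_self_le: "Re (ip (x - y) (x - y)) \<le> 2 * Re (ip x x) + 2 * Re (ip y y)"
proof -
  have "Re (ip (x - y) (x - y)) + Re (ip (x + y) (x + y)) = 2 * Re (ip x x) + 2 * Re (ip y y)"
    by (simp add: ip_diff_left ip_diff_right ip_add_left ip_add_right)
  with ip_nonneg[of "x + y"] show ?thesis by linarith
qed

lemma Cauchy_Schwarz:
  assumes "Re (ip y y) = 1"
  shows "(cmod (ip x y))\<^sup>2 \<le> Re (ip x x)"
proof -
  define c where "c = ip x y"
  have "ip (x - scale c y) (x - scale c y) = ip x x - c * cnj c"
    using assms ip_self[of y] ip_commute[of y x]
    by (simp add: ip_diff_left ip_diff_right ip_scale_left ip_scale_right c_def algebra_simps)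
  then have "Re (ip (x - scale c y) (x - scale c y)) = Re (ip x x) - (cmod c)\<^sup>2"
    by (simp add: complex_mult_cnj cmod_power2)
  with ip_nonneg[of "x - scale c y"] show ?thesis
    by (simp add: c_def)
qed

definition orthonormal :: "('i \<Rightarrow> 'v) \<Rightarrow> 'i set \<Rightarrow> bool" where
  "orthonormal u S \<longleftrightarrow> (\<forall>i\<in>S. \<forall>j\<in>S. ip (u i) (u j) = (if i = j then 1 else 0))"

lemma orthonormal_coeff:
  assumes "orthonormal u S" "finite S" "k \<in> S"
  shows "ip (\<Sum>i\<in>S. scale (c i) (u i)) (u k) = c k"
proof -
  have "ip (\<Sum>i\<in>S. scale (c i) (u i)) (u k) = (\<Sum>i\<in>S. if k = i then c i else 0)"
    unfolding ip_sum_left ip_scale_left using assms by (intro sum.cong) (auto simp: orthonormal_def)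
  with assms show ?thesis by simp
qed

lemma orthonormal_norm:
  assumes "orthonormal u S" "finite S"
  shows "Re (ip (\<Sum>i\<in>S. scale (c i) (u i)) (\<Sum>i\<in>S. scale (c i) (u i))) = (\<Sum>i\<in>S. (cmod (c i))\<^sup>2)"
proof -
  have "ip (\<Sum>i\<in>S. scale (c i) (u i)) (\<Sum>i\<in>S. scale (c i) (u i))
      = (\<Sum>k\<in>S. cnj (c k) * c k)"
    by (subst ip_sum_right) (simp add: ip_scale_right orthonormal_coeff[OF assms])
  then show ?thesis
    by (simp only: cmod_power2 power2_eq_square Re_sum) (simp add: cmod_def flip: power2_eq_square)
qed

lemma span_image_finite:
  assumes "finite S" "x \<in> span (u ` S)"
  obtains c where "x = (\<Sum>i\<in>S. scale (c i) (u i))"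
proof -
  from assms(2) have "\<exists>c. x = (\<Sum>i\<in>S. scale (c i) (u i))"
  proof (induction rule: span_induct_alt)
    case base
    show ?case by (rule exI[of _ "\<lambda>_. 0"]) simp
  next
    case (step a y z)
    then obtain k c where k: "k \<in> S" "y = u k" and c: "z = (\<Sum>i\<in>S. scale (c i) (u i))"
      by auto
    have "(\<Sum>i\<in>S. scale ((if i = k then a else 0) + c i) (u i))
        = (\<Sum>i\<in>S. if i = k then scale a (u i) else 0) + z"
      unfolding c sum.distrib[symmetric] by (intro sum.cong) (auto simp: scale_left_distrib)
    also have "\<dots> = scale a y + z"
      using k assms(1) by simp
    finally show ?case by metis
  qed
  with that show ?thesis by blast
qed

lemma orthonormal_expansion:
  assumes "orthonormal u S" "finite S" "x \<in> span (u ` S)"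
  shows "x = (\<Sum>i\<in>S. scale (ip x (u i)) (u i))"
proof -
  obtain c where c: "x = (\<Sum>i\<in>S. scale (c i) (u i))"
    using span_image_finite[OF assms(2,3)] .
  have "ip x (u i) = c i" if "i \<in> S" for i
    unfolding c by (rule orthonormal_coeff[OF assms(1,2) that])
  then have "(\<Sum>i\<in>S. scale (ip x (u i)) (u i)) = (\<Sum>i\<in>S. scale (c i) (u i))"
    by (intro sum.cong) simp_all
  with c show ?thesis by simp
qed

section \<open>The norm of a linear functional through an orthonormal system\<close>

context
  fixes \<phi> :: "'v \<Rightarrow> complex"
  assumes \<phi>_add: "\<And>x y. \<phi> (x + y) = \<phi> x + \<phi> y"
    and \<phi>_scale: "\<And>c x. \<phi> (scale c x) = c * \<phi> x"
begin

lemma functional_sum: "\<phi> (\<Sum>i\<in>S. scale (c i) (u i)) = (\<Sum>i\<in>S. c i * \<phi> (u i))"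
proof -
  have "\<phi> 0 = 0"
    using \<phi>_scale[of 0 0] by simp
  then show ?thesis
    by (induction S rule: infinite_finite_induct) (simp_all add: \<phi>_add \<phi>_scale)
qed

text \<open>The test vector is the Riesz representer of \<phi> on the span: its squared norm and its
  image under \<phi> are both T, so T^2 \<le> C T. Together with the next lemma this identifies the
  sum with the squared norm of \<phi> on the span.\<close>

lemma bounded_functional_imp_sum_le:
  assumes "orthonormal u S" "finite S" "0 \<le> C"
    and bd: "\<And>x. (cmod (\<phi> x))\<^sup>2 \<le> C * Re (ip x x)"
  shows "(\<Sum>i\<in>S. (cmod (\<phi> (u i)))\<^sup>2) \<le> C"
proof -
  define T where "T = (\<Sum>i\<in>S. (cmod (\<phi> (u i)))\<^sup>2)"
  define x where "x = (\<Sum>i\<in>S. scale (cnj (\<phi> (u i))) (u i))"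
  have "Re (ip x x) = T"
    unfolding x_def T_def by (subst orthonormal_norm[OF assms(1,2)]) simp
  moreover have "\<phi> x = complex_of_real T"
    unfolding x_def T_def functional_sum by (simp add: of_real_cmod_square mult.commute)
  moreover have "0 \<le> T"
    unfolding T_def by (simp add: sum_nonneg)
  ultimately have "T * T \<le> C * T"
    using bd[of x] by (simp add: power2_eq_square)
  then have "T \<le> C"
    using \<open>0 \<le> T\<close> \<open>0 \<le> C\<close> by (cases "T = 0") (auto simp: mult_le_cancel_right)
  then show ?thesis
    by (simp add: T_def)
qed

lemma sum_le_imp_bounded_functional:
  assumes "orthonormal u S" "finite S" "x \<in> span (u ` S)"
    and bd: "(\<Sum>i\<in>S. (cmod (\<phi> (u i)))\<^sup>2) \<le> C"
  shows "(cmod (\<phi> x))\<^sup>2 \<le> C * Re (ip x x)"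
proof -
  obtain c where c: "x = (\<Sum>i\<in>S. scale (c i) (u i))"
    using span_image_finite[OF assms(2,3)] .
  have "cmod (\<phi> x) \<le> (\<Sum>i\<in>S. cmod (c i) * cmod (\<phi> (u i)))"
    unfolding c functional_sum by (rule order.trans[OF norm_sum]) (simp add: norm_mult)
  then have "(cmod (\<phi> x))\<^sup>2 \<le> (\<Sum>i\<in>S. cmod (c i) * cmod (\<phi> (u i)))\<^sup>2"
    by (intro power_mono) auto
  also have "\<dots> \<le> (\<Sum>i\<in>S. (cmod (c i))\<^sup>2) * (\<Sum>i\<in>S. (cmod (\<phi> (u i)))\<^sup>2)"
    by (rule Cauchy_Schwarz_ineq_sum)
  also have "\<dots> \<le> (\<Sum>i\<in>S. (cmod (c i))\<^sup>2) * C"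
    by (intro mult_left_mono bd sum_nonneg) auto
  also have "(\<Sum>i\<in>S. (cmod (c i))\<^sup>2) = Re (ip x x)"
    unfolding c by (rule orthonormal_norm[OF assms(1,2), symmetric])
  finally show ?thesis by (simp add: mult.commute)
qed

end

lemma orthogonal_projection_exists:
  assumes "finite S" "\<And>x. ip x x = 0 \<Longrightarrow> x = 0"
  shows "\<exists>y\<in>span S. \<forall>z\<in>span S. ip (x - y) z = 0"
  using assms(1)
proof (induction S arbitrary: x rule: finite_induct)
  case empty
  show ?case by simp
next
  case (insert a S)
  obtain b where b: "b \<in> span S" "\<And>z. z \<in> span S \<Longrightarrow> ip (a - b) z = 0"
    using insert.IH[of a] by blast
  obtain y where y: "y \<in> span S" "\<And>z. z \<in> span S \<Longrightarrow> ip (x - y) z = 0"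
    using insert.IH[of x] by blast
  define e where "e = a - b"
  \<comment> \<open>The coefficient along the new direction \<open>e\<close>. If \<open>e\<close> is
    null, it is 0 by definiteness, the quotient is 0 by convention, and nothing is added.\<close>
  define k where "k = ip (x - y) e / ip e e"
  have e0: "ip (scale c e) z = 0" if "z \<in> span S" for z c
    using b(2)[OF that] by (simp add: e_def ip_scale_left)
  have "span S \<subseteq> span (insert a S)"
    by (rule span_mono) auto
  then have mem: "y + scale k e \<in> span (insert a S)"
    using b(1) y(1) by (auto simp: e_def intro!: span_add span_scale span_diff span_base[of a])
  have "ip (x - (y + scale k e)) z = 0" if zin: "z \<in> span (insert a S)" for z
  proof -
    obtain c where c: "z - scale c a \<in> span S"
      using zin by (auto simp: span_insert)
    have "z = (z - scale c a + scale c b) + scale c e"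
      by (simp add: e_def scale_right_diff_distrib)
    moreover define w where "w = z - scale c a + scale c b"
    ultimately have z: "z = w + scale c e" by simp
    have w: "w \<in> span S"
      unfolding w_def using c b(1) by (intro span_add span_scale)
    have "ip (x - y) e - k * ip e e = 0"
      using assms(2)[of e] by (auto simp: k_def)
    then have "ip (x - y - scale k e) (scale c e) = 0"
      by (simp add: ip_diff_left ip_scale_left ip_scale_right)
    moreover have "ip (x - y - scale k e) w = 0"
      using y(2)[OF w] e0[OF w] by (simp add: ip_diff_left)
    ultimately show ?thesis
      by (simp add: z ip_add_right diff_diff_eq)
  qed
  with mem show ?case by blast
qed

end

section \<open>Positive definite sequences in one variable\<close>

definition mom :: "(nat \<Rightarrow> real) \<Rightarrow> complex poly \<Rightarrow> complex" where
  "mom t p = (\<Sum>n\<le>degree p. poly.coeff p n * complex_of_real (t n))"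

definition uip :: "(nat \<Rightarrow> real) \<Rightarrow> complex poly \<Rightarrow> complex poly \<Rightarrow> complex" where
  "uip t p q = mom t (p * map_poly cnj q)"

lemma mom_eq: "degree p \<le> N \<Longrightarrow> mom t p = (\<Sum>n\<le>N. poly.coeff p n * complex_of_real (t n))"
  unfolding mom_def by (intro sum.mono_neutral_left) (auto simp: coeff_eq_0)

lemma mom_add: "mom t (p + q) = mom t p + mom t q"
proof -
  let ?N = "max (degree p) (degree q)"
  have "degree (p + q) \<le> ?N" "degree p \<le> ?N" "degree q \<le> ?N"
    by (auto intro: degree_add_le)
  then show ?thesis
    by (simp add: mom_eq[of _ ?N] sum.distrib algebra_simps)
qed

lemma mom_smult: "mom t (smult c p) = c * mom t p"
  by (simp add: mom_eq[of _ "degree p"] degree_smult_le sum_distrib_left mult_ac)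

lemma mom_minus: "mom t (- p) = - mom t p"
  using mom_smult[of t "-1" p] by simp

lemma mom_diff: "mom t (p - q) = mom t p - mom t q"
  using mom_add[of t p "- q"] by (simp add: mom_minus)

lemma mom_0 [simp]: "mom t 0 = 0"
  by (simp add: mom_def)

lemma mom_sum: "mom t (\<Sum>i\<in>S. f i) = (\<Sum>i\<in>S. mom t (f i))"
  by (induction S rule: infinite_finite_induct) (simp_all add: mom_add)

lemma mom_monom: "mom t (monom c n) = c * complex_of_real (t n)"
proof -
  have "mom t (monom c n) = (\<Sum>k\<le>n. if n = k then c * complex_of_real (t k) else 0)"
    unfolding mom_eq[OF degree_monom_le] by (rule sum.cong) auto
  then show ?thesis by simp
qed

lemma map_poly_cnj_mult: "map_poly cnj (p * q) = map_poly cnj p * map_poly cnj q"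
  by (intro poly_eqI) (simp add: coeff_map_poly coeff_mult)

lemma map_poly_cnj_cnj [simp]: "map_poly cnj (map_poly cnj p) = p"
  by (intro poly_eqI) (simp add: coeff_map_poly)

lemma degree_map_poly_cnj [simp]: "degree (map_poly cnj p) = degree p"
  by (rule degree_map_poly) simp

lemma mom_cnj: "mom t (map_poly cnj p) = cnj (mom t p)"
  by (simp add: mom_def coeff_map_poly)

lemma uip_commute: "uip t q p = cnj (uip t p q)"
  by (simp add: uip_def map_poly_cnj_mult mult.commute flip: mom_cnj)

lemma uip_cnj: "uip t (map_poly cnj p) (map_poly cnj q) = cnj (uip t p q)"
  by (simp add: uip_def map_poly_cnj_mult flip: mom_cnj)

lemma qform_moments: "qform (\<lambda>a b. complex_of_real (t (a + b))) {..degree p} (poly.coeff p) = uip t p p"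
proof -
  let ?m = "\<lambda>i. monom (poly.coeff p i) i"
  have "uip t p p = mom t ((\<Sum>i\<le>degree p. ?m i) * (\<Sum>j\<le>degree p. map_poly cnj (?m j)))"
  proof -
    have "map_poly cnj p = (\<Sum>j\<le>degree p. monom (cnj (poly.coeff p j)) j)"
      using poly_as_sum_of_monoms[of "map_poly cnj p"] by (simp add: coeff_map_poly)
    then show ?thesis
      by (simp add: uip_def poly_as_sum_of_monoms map_poly_monom)
  qed
  also have "\<dots> = qform (\<lambda>a b. complex_of_real (t (a + b))) {..degree p} (poly.coeff p)"
    by (simp add: qform_def sum_product mom_sum map_poly_monom mult_monom mom_monom)
  finally show ?thesis ..
qed

lemma qform_eval:
  "qform (\<lambda>a b. z ^ a * cnj (z ^ b)) {..degree p} (poly.coeff p) = complex_of_real ((cmod (poly p z))\<^sup>2)"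
  by (subst qform_outer) (simp add: poly_altdef)

lemma psd_nat_iff: "psd K \<longleftrightarrow> (\<forall>p. 0 \<le> qform K {..degree p} (poly.coeff p))"
proof safe
  fix p :: "complex poly"
  assume "psd K"
  then show "0 \<le> qform K {..degree p} (poly.coeff p)"
    by (rule psdD) simp
next
  assume *: "\<forall>p. 0 \<le> qform K {..degree p} (poly.coeff p)"
  show "psd K"
  proof (rule psdI)
    fix S :: "nat set" and v :: "nat \<Rightarrow> complex"
    assume fin: "finite S"
    define p where "p = (\<Sum>i\<in>S. monom (v i) i)"
    have c: "poly.coeff p i = (if i \<in> S then v i else 0)" for i
      using fin by (simp add: p_def coeff_sum)
    have "qform K S v = qform K S (poly.coeff p)"
      by (rule qform_cong) (auto simp: c)
    also have "\<dots> = qform K (S \<union> {..degree p}) (poly.coeff p)"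
      by (rule qform_mono_support) (use fin in \<open>auto simp: c\<close>)
    also have "\<dots> = qform K {..degree p} (poly.coeff p)"
      by (rule qform_mono_support[symmetric]) (use fin in \<open>auto intro: coeff_eq_0\<close>)
    finally show "0 \<le> qform K S v"
      using * by simp
  qed
qed

text \<open>The squared norm of evaluation at z is at most C. For positive definite \<open>t\<close>
  the least such C is the sum of |p_n(z)|^2 over the orthonormal polynomials, the reciprocal of the
  Christoffel function.\<close>

definition eval_bounded :: "(nat \<Rightarrow> real) \<Rightarrow> complex \<Rightarrow> real \<Rightarrow> bool" where
  "eval_bounded t z C \<longleftrightarrow> (\<forall>q. (cmod (poly q z))\<^sup>2 \<le> C * Re (uip t q q))"

lemma eval_boundedD: "eval_bounded t z C \<Longrightarrow> (cmod (poly q z))\<^sup>2 \<le> C * Re (uip t q q)"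
  by (simp add: eval_bounded_def)

text \<open>Discrete Gronwall inequality, run on 1 + S n so that the inhomogeneous term is absorbed
  into the factor 1 + e n + d n.\<close>

lemma gronwall_bounded:
  fixes S e d :: "nat \<Rightarrow> real"
  assumes "S 0 = 0" "\<And>n. 0 \<le> S n" "\<And>n. 0 \<le> e n" "\<And>n. 0 \<le> d n"
    and step: "\<And>n. S (Suc n) \<le> S n * (1 + e n) + d n"
    and bd: "\<And>n. (\<Sum>k<n. e k + d k) \<le> E"
  shows "S n \<le> exp E"
proof -
  have "1 + S n \<le> exp (\<Sum>k<n. e k + d k)"
  proof (induction n)
    case 0
    then show ?case using assms(1) by simp
  next
    case (Suc n)
    have "1 + S (Suc n) \<le> (1 + S n) * (1 + (e n + d n))"
      using step[of n] mult_nonneg_nonneg[OF assms(2,4), of n n] assms(3)[of n]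
      by (simp add: algebra_simps)
    also have "\<dots> \<le> exp (\<Sum>k<n. e k + d k) * exp (e n + d n)"
      by (intro mult_mono Suc.IH exp_ge_add_one_self) (use assms(3,4)[of n] in auto)
    finally show ?case
      by (simp add: exp_add)
  qed
  also have "\<dots> \<le> exp E"
    using bd by simp
  finally show ?thesis by simp
qed

lemma poly_vector_space: "vector_space (smult :: complex \<Rightarrow> _)"
  by unfold_locales (simp_all add: smult_add_right smult_add_left)

locale pd_moments =
  fixes t :: "nat \<Rightarrow> real"
  assumes pd: "p \<noteq> 0 \<Longrightarrow> 0 < Re (uip t p p)"
    and t0: "t 0 = 1"
begin

sublocale H: hermitian_space smult "uip t"
proof -
  interpret vector_space "smult :: complex \<Rightarrow> _"
    by (rule poly_vector_space)
  show "hermitian_space smult (uip t)"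
  proof unfold_locales
    show "uip t (x + y) z = uip t x z + uip t y z" for x y z
      by (simp add: uip_def distrib_right mom_add)
    show "uip t (smult c x) z = c * uip t x z" for c x z
      by (simp add: uip_def mom_smult)
    show "uip t y x = cnj (uip t x y)" for x y
      by (rule uip_commute)
    show "0 \<le> Re (uip t x x)" for x
      using pd[of x] by (cases "x = 0") (auto simp: uip_def)
  qed
qed

lemma uip_one [simp]: "uip t 1 1 = 1"
  using t0 by (simp add: uip_def mom_def)

lemma eval_bounded_iff_psd:
  "eval_bounded t z C \<longleftrightarrow> psd (\<lambda>a b. complex_of_real C * complex_of_real (t (a + b)) - z ^ a * cnj (z ^ b))"
proof -
  have *: "qform (\<lambda>a b. complex_of_real C * complex_of_real (t (a + b)) - z ^ a * cnj (z ^ b)) {..degree q} (poly.coeff q)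
      = complex_of_real (C * Re (uip t q q) - (cmod (poly q z))\<^sup>2)" for q
    by (subst qform_diff, subst qform_cmult, subst qform_moments, subst qform_eval, subst H.ip_self) simp
  have nn: "0 \<le> complex_of_real r \<longleftrightarrow> 0 \<le> r" for r
    by (simp add: less_eq_complex_def)
  show ?thesis
    unfolding psd_nat_iff eval_bounded_def * nn by simp
qed

lemma eval_bounded_ge_1: "eval_bounded t z C \<Longrightarrow> 1 \<le> C"
  using eval_boundedD[of t z C 1] by simp

text \<open>Degree below n, stated by coefficients: since \<open>degree 0 = 0\<close>, the condition
  \<open>degree q < n\<close> would exclude the zero polynomial for n = 0.\<close>

definition low :: "nat \<Rightarrow> complex poly set" where
  "low n = {q. \<forall>i\<ge>n. poly.coeff q i = 0}"

lemma low_subspace: "H.subspace (low n)"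
  by (auto simp: low_def H.subspace_def)

lemma low_degree: "degree q < n \<Longrightarrow> q \<in> low n"
  by (auto simp: low_def intro: coeff_eq_0)

lemma low_span_monom: "low n = H.span ((\<lambda>i. monom 1 i) ` {..<n})"
proof
  show "H.span ((\<lambda>i. monom 1 i) ` {..<n}) \<subseteq> low n"
    by (intro H.span_minimal low_subspace) (auto simp: low_def)
  show "low n \<subseteq> H.span ((\<lambda>i. monom 1 i) ` {..<n})"
  proof
    fix q assume q: "q \<in> low n"
    have "q = (\<Sum>i<n. smult (poly.coeff q i) (monom 1 i))"
      using q by (intro poly_eqI) (simp add: coeff_sum low_def if_distrib cong: if_cong)
    also have "\<dots> \<in> H.span ((\<lambda>i. monom 1 i) ` {..<n})"
      by (intro H.span_sum H.span_scale H.span_base) auto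
    finally show "q \<in> H.span ((\<lambda>i. monom 1 i) ` {..<n})" .
  qed
qed

text \<open>The witness is x^n minus its projection to the lower degrees; definiteness of the form
  supplies the projection.\<close>

lemma monic_orthogonal_exists:
  "\<exists>q. degree q = n \<and> poly.coeff q n = 1 \<and> (\<forall>r\<in>low n. uip t q r = 0)"
proof -
  have "x = 0" if "uip t x x = 0" for x
    using pd[of x] that by auto
  then obtain y where y: "y \<in> low n" "\<And>z. z \<in> low n \<Longrightarrow> uip t (monom 1 n - y) z = 0"
    unfolding low_span_monom
    using H.orthogonal_projection_exists[of "(\<lambda>i. monom 1 i) ` {..<n}" "monom 1 n"] by auto
  define q where "q = monom 1 n - y"
  have c: "poly.coeff q n = 1" "\<And>i. i > n \<Longrightarrow> poly.coeff q i = 0"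
    using y(1) by (auto simp: q_def low_def)
  then have "degree q = n"
    by (metis degree_le le_antisym le_degree zero_neq_one)
  with c y(2) show ?thesis
    by (auto simp: q_def)
qed

lemma orthonormal_polys_exist:
  obtains p where "\<And>n. degree (p n) = n" "H.orthonormal p UNIV"
    "\<And>n r. r \<in> low n \<Longrightarrow> uip t (p n) r = 0" "\<And>n. low n = H.span (p ` {..<n})"
proof -
  from monic_orthogonal_exists obtain q where q: "\<And>n. degree (q n) = n" "\<And>n. poly.coeff (q n) n = 1"
      "\<And>n r. r \<in> low n \<Longrightarrow> uip t (q n) r = 0"
    by metis
  have pos: "Re (uip t (q n) (q n)) > 0" for n
    using q(2)[of n] by (intro pd) auto
  define k where "k n = sqrt (Re (uip t (q n) (q n)))" for n
  have k: "k n > 0" for n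
    using pos by (simp add: k_def)
  define p where "p n = smult (1 / complex_of_real (k n)) (q n)" for n
  have deg: "degree (p n) = n" for n
    using k[of n] q(1)[of n] by (simp add: p_def)
  have perp: "uip t (p n) r = 0" if "r \<in> low n" for n r
    using q(3)[OF that] by (simp add: p_def H.ip_scale_left)
  have one: "uip t (p n) (p n) = 1" for n
  proof -
    have "complex_of_real (k n) * complex_of_real (k n) = uip t (q n) (q n)"
      using pos[of n] by (subst H.ip_self) (simp add: k_def flip: of_real_mult)
    then show ?thesis
      using k[of n] pos[of n] by (auto simp: p_def H.ip_scale_left H.ip_scale_right field_simps)
  qed
  have orth: "H.orthonormal p UNIV"
    unfolding H.orthonormal_def
  proof safe
    fix i j :: nat
    show "uip t (p i) (p j) = (if i = j then 1 else 0)"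
    proof (cases i j rule: linorder_cases)
      case less
      then have "uip t (p j) (p i) = 0"
        by (intro perp low_degree) (simp add: deg)
      with less show ?thesis
        using uip_commute[of t "p i" "p j"] by simp
    next
      case greater
      then show ?thesis
        by (auto intro!: perp low_degree simp: deg)
    qed (simp add: one)
  qed
  have "low n \<subseteq> H.span (p ` {..<n})" for n
  proof (induction n)
    case 0
    then show ?case by (auto simp: low_def poly_eq_iff H.span_zero)
  next
    case (Suc n)
    show ?case
    proof
      fix r assume r: "r \<in> low (Suc n)"
      define c where "c = poly.coeff r n / poly.coeff (p n) n"
      have "poly.coeff (p n) n \<noteq> 0"
        using k[of n] q(2)[of n] by (simp add: p_def)
      moreover have "poly.coeff (r - smult c (p n)) i = 0" if "i > n" for i
        using r deg[of n] that by (simp add: low_def coeff_eq_0)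
      ultimately have "r - smult c (p n) \<in> low n"
        by (auto simp: low_def c_def le_eq_less_or_eq)
      moreover have "H.span (p ` {..<n}) \<subseteq> H.span (p ` {..<Suc n})"
        by (intro H.span_mono image_mono) auto
      ultimately have "r - smult c (p n) \<in> H.span (p ` {..<Suc n})"
        using Suc.IH by blast
      then have "(r - smult c (p n)) + smult c (p n) \<in> H.span (p ` {..<Suc n})"
        by (rule H.span_add[OF _ H.span_scale[OF H.span_base]]) auto
      then show "r \<in> H.span (p ` {..<Suc n})" by simp
    qed
  qed
  moreover have "H.span (p ` {..<n}) \<subseteq> low n" for n
    by (intro H.span_minimal low_subspace) (auto intro!: low_degree simp: deg)
  ultimately have "low n = H.span (p ` {..<n})" for n
    by (intro subset_antisym)
  from that[OF deg orth perp this] show ?thesis .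
qed

text \<open>On the real line |x - z|^2 = (x - Re z)^2 + (Im z)^2, and the functional of (x - Re z)^2
  |r|^2 is nonnegative. So multiplication by x - z is bounded below when z is not real.\<close>

lemma uip_mult_linear_ge:
  "(Im z)\<^sup>2 * Re (uip t r r) \<le> Re (uip t ([:- z, 1:] * r) ([:- z, 1:] * r))"
proof -
  define l where "l = [:- complex_of_real (Re z), 1:]"
  have l: "map_poly cnj l = l"
    by (simp add: l_def map_poly_pCons)
  define m where "m = [:- z, 1:]"
  have e: "m * map_poly cnj m = l * l + [:complex_of_real ((Im z)\<^sup>2):]"
    by (simp add: m_def l_def map_poly_pCons complex_eq_iff power2_eq_square)
  have "(m * r) * map_poly cnj (m * r) = (m * map_poly cnj m) * (r * map_poly cnj r)"
    unfolding map_poly_cnj_mult by (simp only: mult_ac)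
  also have "\<dots> = (l * r) * map_poly cnj (l * r) + smult (complex_of_real ((Im z)\<^sup>2)) (r * map_poly cnj r)"
    unfolding e map_poly_cnj_mult l by (simp add: algebra_simps)
  finally have "([:- z, 1:] * r) * map_poly cnj ([:- z, 1:] * r)
      = (l * r) * map_poly cnj (l * r) + smult (complex_of_real ((Im z)\<^sup>2)) (r * map_poly cnj r)"
    unfolding m_def .
  then have "uip t ([:- z, 1:] * r) ([:- z, 1:] * r)
      = uip t (l * r) (l * r) + complex_of_real ((Im z)\<^sup>2) * uip t r r"
    unfolding uip_def by (simp only: mom_add mom_smult)
  then show ?thesis
    using H.ip_nonneg[of "l * r"] by simp
qed

lemma synthetic_div_add: "synthetic_div (p + q) c = synthetic_div p c + synthetic_div (q :: complex poly) c"
proof -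
  have "(p + q) + smult c (synthetic_div p c + synthetic_div q c)
      = (p + smult c (synthetic_div p c)) + (q + smult c (synthetic_div q c))"
    by (simp add: smult_add_right)
  also have "\<dots> = pCons (poly p c + poly q c) (synthetic_div p c + synthetic_div q c)"
    unfolding synthetic_div_correct by simp
  finally show ?thesis
    using synthetic_div_unique by metis
qed

lemma synthetic_div_smult: "synthetic_div (smult a p) c = smult a (synthetic_div (p :: complex poly) c)"
proof -
  have "smult a (p + smult c (synthetic_div p c)) = smult a (pCons (poly p c) (synthetic_div p c))"
    by (simp add: synthetic_div_correct)
  then show ?thesis
    by (intro sym[OF conjunct2[OF synthetic_div_unique[of "smult a p" c _ "a * poly p c"]]])
       (simp add: smult_add_right mult.commute)
qed

text \<open>The quotient times x - z is q - q(z), whose squared norm is at most 2 |q|^2 + 2 |q(z)|^2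
  \<le> (2 + 2C) |q|^2; then \<open>uip_mult_linear_ge\<close> removes the factor x - z.\<close>

lemma synthetic_div_bounded:
  assumes "eval_bounded t z C" "Im z \<noteq> 0"
  shows "Re (uip t (synthetic_div q z) (synthetic_div q z)) \<le> (2 + 2 * C) / (Im z)\<^sup>2 * Re (uip t q q)"
proof -
  let ?r = "synthetic_div q z"
  have e: "[:- z, 1:] * ?r = q - smult (poly q z) 1"
    using synthetic_div_correct'[of z q] by (simp add: algebra_simps)
  have "(Im z)\<^sup>2 * Re (uip t ?r ?r) \<le> Re (uip t (q - smult (poly q z) 1) (q - smult (poly q z) 1))"
    using uip_mult_linear_ge[of z ?r] by (simp only: e)
  also have "\<dots> \<le> 2 * Re (uip t q q) + 2 * Re (uip t (smult (poly q z) 1) (smult (poly q z) 1))"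
    by (rule H.ip_diff_self_le)
  also have "uip t (smult (poly q z) 1) (smult (poly q z) 1) = complex_of_real ((cmod (poly q z))\<^sup>2)"
    unfolding H.ip_scale_left H.ip_scale_right by (simp add: of_real_cmod_square)
  also have "2 * Re (uip t q q) + 2 * Re (complex_of_real ((cmod (poly q z))\<^sup>2)) \<le> (2 + 2 * C) * Re (uip t q q)"
    using eval_boundedD[OF assms(1), of q] by (simp add: algebra_simps)
  finally show ?thesis
    using assms(2) by (simp add: field_simps)
qed

text \<open>
  In an orthonormal basis of polynomials, \<open>q \<mapsto> (q - q(w)) / (x - w)\<close> is a strictly triangular
  Hilbert--Schmidt matrix as soon as the evaluation at \<open>w\<close> is bounded; so it is quasinilpotent,
  which makes all evaluations bounded.
\<close>

theorem eval_bounded_locally_uniform: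
  assumes "eval_bounded t w C" "Im w \<noteq> 0"
  shows "\<exists>M. \<forall>z. cmod z \<le> R \<longrightarrow> eval_bounded t z M"
proof -
  obtain p where deg: "\<And>n. degree (p n) = n" and orth: "H.orthonormal p UNIV"
    and perp: "\<And>n r. r \<in> low n \<Longrightarrow> uip t (p n) r = 0" and low: "\<And>n. low n = H.span (p ` {..<n})"
    by (rule orthonormal_polys_exist) blast
  have orthS: "H.orthonormal p S" for S
    using orth by (auto simp: H.orthonormal_def)
  \<comment> \<open>The coefficients of \<open>p n\<close> are not known to be real, so the
    conjugate system, which is orthonormal too, is carried along for the second argument of the
    form.\<close>
  define p' where "p' n = map_poly cnj (p n)" for n
  have orth': "H.orthonormal p' S" for S
    using orth by (auto simp: H.orthonormal_def p'_def uip_cnj)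
  define D where "D q = synthetic_div q w" for q
  \<comment> \<open>At q = p_n this is the value at w of the polynomial of the second kind.\<close>
  define f where "f q = mom t (D q)" for q
  define A where "A = (2 + 2 * C) / (Im w)\<^sup>2"
  have C: "0 \<le> C"
    using eval_bounded_ge_1[OF assms(1)] by simp
  have A: "0 \<le> A"
    using C by (simp add: A_def)
  have f_eq: "f q = uip t (D q) 1" for q
    by (simp add: f_def uip_def)
  have f_bd: "(cmod (f q))\<^sup>2 \<le> A * Re (uip t q q)" for q
    using H.Cauchy_Schwarz[of 1 "D q"] synthetic_div_bounded[OF assms, of q]
    unfolding f_eq A_def D_def by simp
  have f_lin: "f (x + y) = f x + f y" "f (smult c x) = c * f x" for x y c
    by (simp_all add: f_def D_def synthetic_div_add synthetic_div_smult mom_add mom_smult)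
  have e_lin: "poly (x + y) w = poly x w + poly y w" "poly (smult c x) w = c * poly x w" for x y :: "complex poly" and c
    by simp_all
  have e_bd: "(cmod (poly q w))\<^sup>2 \<le> C * Re (uip t q q)" for q
    by (rule eval_boundedD[OF assms(1)])
  define g h g' h' where "g n = cmod (poly (p n) w)" and "h n = cmod (f (p n))"
    and "g' n = cmod (poly (p' n) w)" and "h' n = cmod (f (p' n))" for n
  have sums: "(\<Sum>k<n. (g k)\<^sup>2) \<le> C" "(\<Sum>k<n. (h k)\<^sup>2) \<le> A"
      "(\<Sum>k<n. (g' k)\<^sup>2) \<le> C" "(\<Sum>k<n. (h' k)\<^sup>2) \<le> A" for n
    unfolding g_def h_def g'_def h'_def
    using H.bounded_functional_imp_sum_le[OF e_lin orthS finite_lessThan C e_bd]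
      H.bounded_functional_imp_sum_le[OF f_lin orthS finite_lessThan A f_bd]
      H.bounded_functional_imp_sum_le[OF e_lin orth' finite_lessThan C e_bd]
      H.bounded_functional_imp_sum_le[OF f_lin orth' finite_lessThan A f_bd] by auto
  have D_split: "[:- w, 1:] * D q = q - [:poly q w:]" for q
    using synthetic_div_correct'[of w q] by (simp add: D_def algebra_simps)
  \<comment> \<open>Writing p'_k = (x - w) D p'_k + p'_k(w) moves the factor x - w onto D p_n. The
    term L(p_n D p'_k) vanishes by orthogonality, which leaves two products of a function of n with
    a function of k.\<close>
  have D_coeff: "uip t (D (p n)) (p k) = poly (p' k) w * f (p n) - poly (p n) w * f (p' k)"
    if "k < n" for n k
  proof -
    have "D (p n) * p' k = D (p n) * ([:- w, 1:] * D (p' k) + [:poly (p' k) w:])"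
      by (simp only: D_split) simp
    also have "\<dots> = ([:- w, 1:] * D (p n)) * D (p' k) + smult (poly (p' k) w) (D (p n))"
      by (simp add: algebra_simps)
    also have "\<dots> = p n * D (p' k) - smult (poly (p n) w) (D (p' k)) + smult (poly (p' k) w) (D (p n))"
      unfolding D_split by (simp add: algebra_simps)
    finally have "uip t (D (p n)) (p k)
        = mom t (p n * D (p' k)) - poly (p n) w * f (p' k) + poly (p' k) w * f (p n)"
      by (simp add: uip_def p'_def[symmetric] mom_add mom_diff mom_smult f_def)
    also have "mom t (p n * D (p' k)) = uip t (p n) (map_poly cnj (D (p' k)))"
      by (simp add: uip_def)
    also have "\<dots> = 0"
      using that by (intro perp low_degree) (simp add: D_def degree_synthetic_div p'_def deg)
    finally show ?thesis by simp
  qed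
  have D_low: "D (p n) \<in> low n" for n
  proof (cases n)
    case 0
    then have "D (p n) = 0"
      using deg[of 0] by (simp add: D_def synthetic_div_eq_0_iff)
    then show ?thesis by (simp add: low_def)
  next
    case (Suc m)
    then show ?thesis
      by (intro low_degree) (simp add: D_def degree_synthetic_div deg)
  qed
  \<comment> \<open>The total of the Gronwall coefficients below: \<open>e\<close> sums to at most 8
    \<rho>^2 A C with \<rho> = |z - w| \<le> R + |w|, and \<open>d\<close> to at most 2 C.\<close>
  define E where "E = 8 * (R + cmod w)\<^sup>2 * A * C + 2 * C"
  have "eval_bounded t z (exp E)" if z: "cmod z \<le> R" for z
  proof -
    define \<rho> where "\<rho> = cmod (z - w)"
    have \<rho>: "0 \<le> \<rho>" "\<rho> \<le> R + cmod w"
      using z norm_triangle_ineq4[of z w] by (auto simp: \<rho>_def)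
    define u where "u n = cmod (poly (p n) z)" for n
    define S where "S n = (\<Sum>k<n. (u k)\<^sup>2)" for n
    have S_nonneg: "0 \<le> S n" for n
      by (simp add: S_def sum_nonneg)
    \<comment> \<open>A discrete Volterra inequality: p_n(z) = p_n(w) + (z - w) (D p_n)(z), and D
      p_n involves only the p_k with k < n.\<close>
    have u_le: "u n \<le> g n + \<rho> * (\<Sum>k<n. (h n * g' k + g n * h' k) * u k)" for n
    proof -
      have "D (p n) = (\<Sum>k<n. smult (uip t (D (p n)) (p k)) (p k))"
        using D_low[of n] by (intro H.orthonormal_expansion orthS) (auto simp: low)
      then have "poly (D (p n)) z = poly (\<Sum>k<n. smult (uip t (D (p n)) (p k)) (p k)) z"
        by (rule arg_cong)
      then have "poly (D (p n)) z = (\<Sum>k<n. uip t (D (p n)) (p k) * poly (p k) z)"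
        by (simp only: poly_sum poly_smult)
      then have "cmod (poly (D (p n)) z) \<le> (\<Sum>k<n. cmod (uip t (D (p n)) (p k)) * u k)"
        by (simp add: u_def norm_mult sum_norm_le)
      also have "\<dots> \<le> (\<Sum>k<n. (h n * g' k + g n * h' k) * u k)"
      proof (intro sum_mono mult_right_mono)
        fix k assume "k \<in> {..<n}"
        then have "cmod (uip t (D (p n)) (p k)) \<le> cmod (poly (p' k) w * f (p n)) + cmod (poly (p n) w * f (p' k))"
          by (simp add: D_coeff norm_triangle_ineq4)
        then show "cmod (uip t (D (p n)) (p k)) \<le> h n * g' k + g n * h' k"
          by (simp add: norm_mult g_def h_def g'_def h'_def mult.commute)
      qed (simp add: u_def)
      finally have le: "cmod (poly (D (p n)) z) \<le> (\<Sum>k<n. (h n * g' k + g n * h' k) * u k)" .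
      have "poly ([:- w, 1:] * D (p n) + [:c:]) z = c + (z - w) * poly (D (p n)) z" for c
        by (simp add: algebra_simps)
      moreover have "[:- w, 1:] * D (p n) + [:poly (p n) w:] = p n"
        unfolding D_def by (rule synthetic_div_correct')
      ultimately have "poly (p n) z = poly (p n) w + (z - w) * poly (D (p n)) z"
        by metis
      then have "u n \<le> g n + \<rho> * cmod (poly (D (p n)) z)"
        unfolding u_def g_def \<rho>_def by (metis norm_mult norm_triangle_ineq)
      also have "\<dots> \<le> g n + \<rho> * (\<Sum>k<n. (h n * g' k + g n * h' k) * u k)"
        using le \<rho>(1) by (simp add: mult_left_mono)
      finally show ?thesis .
    qed
    have two: "(a + b)\<^sup>2 \<le> 2 * a\<^sup>2 + 2 * b\<^sup>2" for a b :: real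
      using sum_squares_bound[of a b] by (simp add: power2_sum)
    \<comment> \<open>Cauchy-Schwarz on the Volterra sum and two uses of (a + b)^2 \<le> 2 a^2 + 2
      b^2 produce these coefficients; both are summable because \<open>g\<close> and
      \<open>h\<close> are square summable.\<close>
    define e d where "e n = 4 * \<rho>\<^sup>2 * (C * (h n)\<^sup>2 + A * (g n)\<^sup>2)" and "d n = 2 * (g n)\<^sup>2" for n
    have "S (Suc n) \<le> S n * (1 + e n) + d n" for n
    proof -
      have "(\<Sum>k<n. (h n * g' k + g n * h' k) * u k)\<^sup>2 \<le> (\<Sum>k<n. (h n * g' k + g n * h' k)\<^sup>2) * S n"
        unfolding S_def by (rule Cauchy_Schwarz_ineq_sum)
      also have "(\<Sum>k<n. (h n * g' k + g n * h' k)\<^sup>2) \<le> (\<Sum>k<n. 2 * (h n * g' k)\<^sup>2 + 2 * (g n * h' k)\<^sup>2)"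
        by (intro sum_mono two)
      also have "\<dots> = 2 * (h n)\<^sup>2 * (\<Sum>k<n. (g' k)\<^sup>2) + 2 * (g n)\<^sup>2 * (\<Sum>k<n. (h' k)\<^sup>2)"
        by (simp add: sum.distrib sum_distrib_left power_mult_distrib mult_ac)
      also have "\<dots> \<le> 2 * (h n)\<^sup>2 * C + 2 * (g n)\<^sup>2 * A"
        by (intro add_mono mult_left_mono sums) auto
      finally have cs: "(\<Sum>k<n. (h n * g' k + g n * h' k) * u k)\<^sup>2 \<le> (2 * (h n)\<^sup>2 * C + 2 * (g n)\<^sup>2 * A) * S n"
        using S_nonneg by (simp add: mult_right_mono)
      have "(u n)\<^sup>2 \<le> (g n + \<rho> * (\<Sum>k<n. (h n * g' k + g n * h' k) * u k))\<^sup>2"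
        using u_le by (intro power_mono) (auto simp: u_def)
      also have "\<dots> \<le> 2 * (g n)\<^sup>2 + 2 * (\<rho>\<^sup>2 * (\<Sum>k<n. (h n * g' k + g n * h' k) * u k)\<^sup>2)"
        using two by (simp flip: power_mult_distrib)
      also have "\<dots> \<le> 2 * (g n)\<^sup>2 + 2 * (\<rho>\<^sup>2 * ((2 * (h n)\<^sup>2 * C + 2 * (g n)\<^sup>2 * A) * S n))"
        using cs by (intro add_left_mono mult_left_mono) auto
      finally show ?thesis
        by (simp add: S_def e_def d_def algebra_simps)
    qed
    moreover have "(\<Sum>k<n. e k + d k) \<le> E" for n
    proof -
      have "(\<Sum>k<n. e k + d k) = 4 * \<rho>\<^sup>2 * (C * (\<Sum>k<n. (h k)\<^sup>2) + A * (\<Sum>k<n. (g k)\<^sup>2)) + 2 * (\<Sum>k<n. (g k)\<^sup>2)"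
        by (simp add: e_def d_def sum.distrib sum_distrib_left algebra_simps)
      also have "\<dots> \<le> 4 * \<rho>\<^sup>2 * (C * A + A * C) + 2 * C"
        using A C by (intro add_mono mult_left_mono sums) auto
      also have "\<dots> \<le> 4 * (R + cmod w)\<^sup>2 * (C * A + A * C) + 2 * C"
        using \<rho> A C by (intro add_mono mult_right_mono mult_left_mono power_mono) auto
      finally show ?thesis by (simp add: E_def algebra_simps)
    qed
    moreover have "0 \<le> e n" "0 \<le> d n" for n
      using A C by (auto simp: e_def d_def)
    ultimately have S_le: "S n \<le> exp E" for n
      using S_nonneg by (intro gronwall_bounded[of S e d]) (auto simp: S_def)
    show ?thesis
      unfolding eval_bounded_def
    proof
      fix q :: "complex poly"
      let ?n = "Suc (degree q)"
      have "q \<in> H.span (p ` {..<?n})"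
        using low_degree[of q ?n] by (simp add: low)
      moreover have "(\<Sum>i<?n. (cmod (poly (p i) z))\<^sup>2) \<le> exp E"
        using S_le[of ?n] by (simp add: S_def u_def)
      ultimately show "(cmod (poly q z))\<^sup>2 \<le> exp E * Re (uip t q q)"
        by (intro H.sum_le_imp_bounded_functional[of "\<lambda>q. poly q z" p "{..<?n}"] orthS) auto
    qed
  qed
  then show ?thesis by blast
qed

text \<open>
  Averaging over the vertices of a regular polygon on the circle of radius \<open>R\<close> removes the
  off-diagonal terms of \<open>\<bar>q(z)\<bar>\<^sup>2\<close>.
\<close>

lemma eval_bounded_circle_imp_coeffs_bounded:
  assumes bd: "\<And>z. cmod z \<le> R \<Longrightarrow> eval_bounded t z M" and "0 \<le> R"
  shows "(\<Sum>i\<le>degree q. (cmod (poly.coeff q i))\<^sup>2 * R ^ (2 * i)) \<le> M * Re (uip t q q)"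
proof -
  \<comment> \<open>More vertices than the degree: distinct exponents up to \<open>degree q\<close>
    stay distinct modulo N, so their mixed terms average to zero.\<close>
  define N where "N = Suc (degree q)"
  have N: "N > 0" by (simp add: N_def)
  define \<zeta> where "\<zeta> a = exp (2 * complex_of_real pi * \<i> * of_nat a / of_nat N)" for a
  have cm: "cmod (\<zeta> a) = 1" for a
    by (simp add: \<zeta>_def norm_exp_eq_Re)
  have pw: "\<zeta> a ^ b = \<zeta> (a * b)" for a b
    by (simp add: \<zeta>_def flip: exp_of_nat_mult) (simp add: algebra_simps)
  have pN: "\<zeta> a ^ N = 1" for a
  proof -
    have "\<zeta> a ^ N = exp (2 * complex_of_real pi * \<i> * of_nat a)"
      using N by (simp add: \<zeta>_def flip: exp_of_nat_mult)
    also have "\<dots> = 1"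
      by (auto simp: exp_eq_1 intro!: exI[of _ "int a"])
    finally show ?thesis .
  qed
  have orth: "(\<Sum>j<N. (R * \<zeta> j) ^ a * cnj ((R * \<zeta> j) ^ b)) = (if a = b then complex_of_real (real N * R ^ (2 * a)) else 0)"
    if "a < N" "b < N" for a b
  proof -
    define x where "x = \<zeta> a * cnj (\<zeta> b)"
    have xj: "x ^ j = \<zeta> (j * a) * cnj (\<zeta> (j * b))" for j
      by (simp add: x_def power_mult_distrib pw mult.commute flip: complex_cnj_power)
    have "(R * \<zeta> j) ^ a * cnj ((R * \<zeta> j) ^ b) = R ^ a * R ^ b * x ^ j" for j
      by (simp only: power_mult_distrib pw xj complex_cnj_mult) simp
    then have "(\<Sum>j<N. (R * \<zeta> j) ^ a * cnj ((R * \<zeta> j) ^ b)) = R ^ a * R ^ b * (\<Sum>j<N. x ^ j)"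
      by (simp only: sum_distrib_left)
    also have "(\<Sum>j<N. x ^ j) = (if a = b then of_nat N else 0)"
    proof (cases "a = b")
      case True
      then have "x = 1"
        using cm[of b] by (simp add: x_def flip: of_real_cmod_square)
      with True show ?thesis by simp
    next
      case False
      have "x \<noteq> 1"
      proof
        assume "x = 1"
        have "cnj (\<zeta> b) * \<zeta> b = 1"
          using cm[of b] of_real_cmod_square[of "\<zeta> b"] by (simp add: mult.commute)
        moreover have "\<zeta> a * (cnj (\<zeta> b) * \<zeta> b) = x * \<zeta> b"
          by (simp only: x_def mult.assoc)
        ultimately have "\<zeta> a = \<zeta> b"
          using \<open>x = 1\<close> by simp
        then show False
          using complex_root_unity_eq[of N a b] False that N by (simp add: \<zeta>_def)
      qed
      moreover have "x ^ N = 1"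
        using pN[of a] pN[of b] by (simp add: x_def power_mult_distrib flip: complex_cnj_power)
      ultimately show ?thesis
        using False by (simp add: geometric_sum)
    qed
    finally show ?thesis
      by (simp add: power_add mult_2)
  qed
  have "complex_of_real (\<Sum>j<N. (cmod (poly q (R * \<zeta> j)))\<^sup>2)
      = (\<Sum>j<N. qform (\<lambda>a b. (R * \<zeta> j) ^ a * cnj ((R * \<zeta> j) ^ b)) {..degree q} (poly.coeff q))"
    by (simp only: qform_eval of_real_sum)
  also have "\<dots> = qform (\<lambda>a b. \<Sum>j<N. (R * \<zeta> j) ^ a * cnj ((R * \<zeta> j) ^ b)) {..degree q} (poly.coeff q)"
    by (rule qform_sum[symmetric])
  also have "\<dots> = qform (\<lambda>a b. if a = b then complex_of_real (real N * R ^ (2 * a)) else 0) {..degree q} (poly.coeff q)"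
    by (intro qform_cong orth) (auto simp: N_def)
  also have "\<dots> = (\<Sum>i\<le>degree q. complex_of_real ((cmod (poly.coeff q i))\<^sup>2) * complex_of_real (real N * R ^ (2 * i)))"
    by (rule qform_diag) simp
  also have "\<dots> = complex_of_real (real N * (\<Sum>i\<le>degree q. (cmod (poly.coeff q i))\<^sup>2 * R ^ (2 * i)))"
    unfolding of_real_mult of_real_sum sum_distrib_left by (intro sum.cong refl mult.left_commute)
  finally have "(\<Sum>j<N. (cmod (poly q (R * \<zeta> j)))\<^sup>2)
      = real N * (\<Sum>i\<le>degree q. (cmod (poly.coeff q i))\<^sup>2 * R ^ (2 * i))"
    by (simp only: of_real_eq_iff)
  moreover have "(\<Sum>j<N. (cmod (poly q (R * \<zeta> j)))\<^sup>2) \<le> (\<Sum>j<N. M * Re (uip t q q))"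
    using cm \<open>0 \<le> R\<close> by (intro sum_mono eval_boundedD bd) (simp add: norm_mult)
  ultimately have "real N * (\<Sum>i\<le>degree q. (cmod (poly.coeff q i))\<^sup>2 * R ^ (2 * i)) \<le> real N * (M * Re (uip t q q))"
    by simp
  with N show ?thesis
    by (simp add: mult_le_cancel_left_pos)
qed

text \<open>Cauchy-Schwarz against the geometric series of |z|^(2i), hence only inside the unit
  disc. This is how the coefficient bound behind \<gamma>_1 > 0 reaches a nonreal point.\<close>

lemma coeffs_bounded_imp_eval_bounded:
  assumes c: "0 < c" "\<And>q. c * (\<Sum>i\<le>degree q. (cmod (poly.coeff q i))\<^sup>2) \<le> Re (uip t q q)" and "cmod z < 1"
  shows "eval_bounded t z (1 / (c * (1 - (cmod z)\<^sup>2)))"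
  unfolding eval_bounded_def
proof
  fix q :: "complex poly"
  let ?x = "(cmod z)\<^sup>2"
  have x: "?x < 1"
    using assms(3) by (simp add: power_less_one_iff)
  have "cmod (poly q z) \<le> (\<Sum>i\<le>degree q. cmod (poly.coeff q i) * cmod z ^ i)"
    unfolding poly_altdef by (rule order.trans[OF norm_sum]) (simp add: norm_mult norm_power)
  then have "(cmod (poly q z))\<^sup>2 \<le> (\<Sum>i\<le>degree q. cmod (poly.coeff q i) * cmod z ^ i)\<^sup>2"
    by (intro power_mono) auto
  also have "\<dots> \<le> (\<Sum>i\<le>degree q. (cmod (poly.coeff q i))\<^sup>2) * (\<Sum>i\<le>degree q. (cmod z ^ i)\<^sup>2)"
    by (rule Cauchy_Schwarz_ineq_sum)
  also have "\<dots> \<le> (Re (uip t q q) / c) * (1 / (1 - ?x))"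
  proof (intro mult_mono)
    show "(\<Sum>i\<le>degree q. (cmod (poly.coeff q i))\<^sup>2) \<le> Re (uip t q q) / c"
      using c by (simp add: field_simps)
    have "(\<Sum>i\<le>degree q. (cmod z ^ i)\<^sup>2) = (\<Sum>i<Suc (degree q). ?x ^ i)"
      by (simp add: lessThan_Suc_atMost power_commutes flip: power_mult) (simp add: mult.commute)
    also have "\<dots> = (1 - ?x ^ Suc (degree q)) / (1 - ?x)"
      using x by (subst sum_gp_strict) auto
    also have "\<dots> \<le> 1 / (1 - ?x)"
      using x by (intro divide_right_mono) auto
    finally show "(\<Sum>i\<le>degree q. (cmod z ^ i)\<^sup>2) \<le> 1 / (1 - ?x)" .
  qed (use c H.ip_nonneg in \<open>auto intro: sum_nonneg\<close>)
  finally show "(cmod (poly q z))\<^sup>2 \<le> 1 / (c * (1 - ?x)) * Re (uip t q q)"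
    by (simp add: mult_ac)
qed

end

section \<open>Hamburger's theorem\<close>

context pd_moments
begin

text \<open>With q = (x - z) r, orthogonality to r gives L(x |r|^2) = z L(|r|^2); both values of L
  are real and the second is positive.\<close>

lemma orthogonal_poly_roots_real:
  assumes q: "degree q = n" "\<And>r. r \<in> low n \<Longrightarrow> uip t q r = 0" and "poly q z = 0" "q \<noteq> 0"
  shows "z \<in> \<real>"
proof -
  define r where "r = synthetic_div q z"
  have qr: "q = [:- z, 1:] * r"
    using synthetic_div_correct'[of z q] \<open>poly q z = 0\<close> by (simp add: r_def)
  have "r \<noteq> 0"
    using qr \<open>q \<noteq> 0\<close> by auto
  then have "degree q = Suc (degree r)"
    unfolding qr by (subst degree_mult_eq) auto
  then have "uip t q r = 0"
    using q by (auto intro: low_degree)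
  moreover have "q * map_poly cnj r = [:0, 1:] * (r * map_poly cnj r) - smult z (r * map_poly cnj r)"
    unfolding qr by (simp add: algebra_simps)
  ultimately have e: "mom t ([:0, 1:] * (r * map_poly cnj r)) = z * uip t r r"
    unfolding uip_def by (simp add: mom_diff mom_smult)
  have "map_poly cnj ([:0, 1:] * (r * map_poly cnj r)) = [:0, 1:] * (r * map_poly cnj r)"
    unfolding map_poly_cnj_mult by (simp add: map_poly_pCons mult.commute)
  then have "mom t ([:0, 1:] * (r * map_poly cnj r)) \<in> \<real>"
    by (metis Reals_cnj_iff mom_cnj)
  moreover have "uip t r r \<in> \<real>" "uip t r r \<noteq> 0"
    using pd[OF \<open>r \<noteq> 0\<close>] H.ip_self[of r] by (metis Reals_of_real, auto)
  ultimately show ?thesis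
    using e by (metis Reals_divide nonzero_mult_div_cancel_right)
qed

text \<open>A double root z is real, so q = (x - z)^2 r and the product of q with r is the squared
  norm of (x - z) r, which would be zero and positive at once.\<close>

lemma orthogonal_poly_roots_simple:
  assumes q: "degree q = n" "\<And>r. r \<in> low n \<Longrightarrow> uip t q r = 0" and "q \<noteq> 0"
  shows "rsquarefree q"
  unfolding rsquarefree_roots
proof (intro allI notI)
  fix z assume z: "poly q z = 0 \<and> poly (pderiv q) z = 0"
  then have zr: "z \<in> \<real>"
    using orthogonal_poly_roots_real[OF q _ \<open>q \<noteq> 0\<close>] by auto
  define m where "m = synthetic_div q z"
  have qm: "q = [:- z, 1:] * m"
    using synthetic_div_correct'[of z q] z by (simp add: m_def)
  have "pderiv q = [:- z, 1:] * pderiv m + m"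
    by (subst qm, simp only: pderiv_mult) (simp add: pderiv_pCons)
  then have "poly m z = 0"
    using z by simp
  define r where "r = synthetic_div m z"
  have mr: "m = [:- z, 1:] * r"
    using synthetic_div_correct'[of z m] \<open>poly m z = 0\<close> by (simp add: r_def)
  have "m \<noteq> 0" "r \<noteq> 0"
    using qm mr \<open>q \<noteq> 0\<close> by auto
  have "degree m = Suc (degree r)"
    unfolding mr by (subst degree_mult_eq) (use \<open>r \<noteq> 0\<close> in auto)
  moreover have "degree q = Suc (degree m)"
    unfolding qm by (subst degree_mult_eq) (use \<open>m \<noteq> 0\<close> in auto)
  ultimately have "uip t q r = 0"
    using q(1) by (intro q(2) low_degree) simp
  moreover have "map_poly cnj [:- z, 1:] = [:- z, 1:]"
    using zr by (simp add: map_poly_pCons Reals_cnj_iff)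
  then have "m * map_poly cnj m = m * ([:- z, 1:] * map_poly cnj r)"
    by (subst (2) mr) (simp only: map_poly_cnj_mult)
  then have "q * map_poly cnj r = m * map_poly cnj m"
    by (subst qm) (simp only: mult_ac)
  then have "uip t q r = uip t m m"
    by (simp add: uip_def)
  ultimately show False
    using pd[OF \<open>m \<noteq> 0\<close>] by simp
qed

text \<open>The nodes are the n zeros of the orthogonal polynomial q of degree n. In f = q a + b the
  remainder b interpolates f at the nodes, and L(q a) = 0 as long as a has degree below n; hence
  exactness up to degree 2n - 1.\<close>

lemma gauss_quadrature:
  assumes "n > 0"
  obtains X :: "real set" and w where "finite X" "\<And>x. x \<in> X \<Longrightarrow> 0 < w x"
    "\<And>k. k < 2 * n \<Longrightarrow> (\<Sum>x\<in>X. w x * x ^ k) = t k"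
proof -
  obtain q where q: "degree q = n" "poly.coeff q n = 1" "\<And>r. r \<in> low n \<Longrightarrow> uip t q r = 0"
    using monic_orthogonal_exists[of n] by auto
  have "q \<noteq> 0"
    using q(2) by auto
  define Z where "Z = {z. poly q z = 0}"
  have finZ: "finite Z"
    unfolding Z_def by (rule poly_roots_finite[OF \<open>q \<noteq> 0\<close>])
  have Zreal: "Z \<subseteq> \<real>"
    using orthogonal_poly_roots_real[OF q(1,3) _ \<open>q \<noteq> 0\<close>] by (auto simp: Z_def)
  have "q = (\<Prod>z\<in>Z. [:- z, 1:])"
    using complex_poly_decompose_rsquarefree[OF orthogonal_poly_roots_simple[OF q(1,3) \<open>q \<noteq> 0\<close>]] q(1,2)
    by (simp add: Z_def)
  then have "degree q = card Z"
    by (simp add: degree_prod_eq_sum_degree)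
  then have cardZ: "card Z = n"
    using q(1) by simp
  define l where "l z = smult (1 / (\<Prod>y\<in>Z - {z}. z - y)) (\<Prod>y\<in>Z - {z}. [:- y, 1:])" for z
  have l_deg: "degree (l z) < n" if "z \<in> Z" for z
  proof -
    have "degree (\<Prod>y\<in>Z - {z}. [:- y, 1:]) = card (Z - {z})"
      by (simp add: degree_prod_eq_sum_degree)
    also have "\<dots> < n"
      using that finZ cardZ \<open>n > 0\<close> by simp
    finally show ?thesis
      unfolding l_def by (rule le_less_trans[OF degree_smult_le])
  qed
  have l_val: "poly (l z) y = (if y = z then 1 else 0)" if "z \<in> Z" "y \<in> Z" for y z
  proof (cases "y = z")
    case True
    have "(\<Prod>y\<in>Z - {z}. z - y) \<noteq> 0"
      using finZ by auto
    with True show ?thesis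
      by (simp add: l_def poly_prod)
  next
    case False
    then have "(\<Prod>x\<in>Z - {z}. y - x) = 0"
      using finZ that by (intro prod_zero) auto
    with False show ?thesis
      by (simp add: l_def poly_prod)
  qed
  define w where "w z = mom t (l z)" for z
  have exact: "mom t f = (\<Sum>z\<in>Z. w z * poly f z)" if f: "degree f < 2 * n" for f
  proof -
    define a b where "a = f div q" and "b = f mod q"
    have fab: "f = q * a + b"
      by (simp add: a_def b_def)
    have b: "b = 0 \<or> degree b < n"
      unfolding b_def using degree_mod_less[OF \<open>q \<noteq> 0\<close>, of f] q(1) by simp
    then have bn: "degree b < n"
      using \<open>n > 0\<close> by auto
    have "a \<in> low n"
    proof (cases "a = 0")
      case False
      then have "degree (q * a) = n + degree a"
        using \<open>q \<noteq> 0\<close> q(1) by (simp add: degree_mult_eq)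
      then have "degree f = n + degree a"
        unfolding fab using bn by (subst degree_add_eq_left) auto
      then show ?thesis
        using f by (intro low_degree) simp
    qed (simp add: low_def)
    then have "map_poly cnj a \<in> low n"
      by (simp add: low_def coeff_map_poly)
    from q(3)[OF this] have "mom t (q * a) = 0"
      by (simp add: uip_def)
    moreover have "b = (\<Sum>z\<in>Z. smult (poly f z) (l z))"
    proof (rule poly_eqI_degree[where A = Z])
      fix y assume y: "y \<in> Z"
      have "poly b y = poly f y"
        unfolding fab using y by (simp add: Z_def)
      also have "\<dots> = (\<Sum>z\<in>Z. if z = y then poly f z else 0)"
        using y finZ by simp
      also have "\<dots> = (\<Sum>z\<in>Z. poly (smult (poly f z) (l z)) y)"
        using y by (intro sum.cong) (auto simp: l_val)
      finally show "poly b y = poly (\<Sum>z\<in>Z. smult (poly f z) (l z)) y"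
        by (simp add: poly_sum)
    next
      show "degree b < card Z"
        using bn cardZ by simp
      show "card Z > degree (\<Sum>z\<in>Z. smult (poly f z) (l z))"
        unfolding cardZ using l_deg \<open>n > 0\<close>
        by (intro degree_sum_less) (auto intro: le_less_trans[OF degree_smult_le])
    qed
    then have "mom t b = (\<Sum>z\<in>Z. w z * poly f z)"
      by (simp add: mom_sum mom_smult w_def mult.commute)
    ultimately show ?thesis
      by (subst fab) (simp only: mom_add, simp)
  qed
  \<comment> \<open>Exactness applies to |l_z|^2, of degree at most 2n - 2, which on the real nodes
    is 1 at z and 0 elsewhere; so the weight is L(|l_z|^2) > 0.\<close>
  have w_pos: "w z = complex_of_real (Re (w z)) \<and> 0 < Re (w z)" if z: "z \<in> Z" for z
  proof -
    have "degree (l z * map_poly cnj (l z)) \<le> degree (l z) + degree (l z)"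
      using degree_mult_le[of "l z" "map_poly cnj (l z)"] by simp
    then have "uip t (l z) (l z) = (\<Sum>y\<in>Z. w y * poly (l z * map_poly cnj (l z)) y)"
      unfolding uip_def using l_deg[OF z] by (intro exact) simp
    also have "\<dots> = (\<Sum>y\<in>Z. if y = z then w y else 0)"
      using Zreal z by (intro sum.cong) (auto simp: l_val subset_iff Reals_cnj_iff)
    also have "\<dots> = w z"
      using z finZ by simp
    finally have "uip t (l z) (l z) = w z" .
    moreover have "l z \<noteq> 0"
      using l_val[OF z z] by auto
    ultimately show ?thesis
      using pd[of "l z"] H.ip_self[of "l z"] by simp
  qed
  define X where "X = Re ` Z"
  have ZX: "Z = complex_of_real ` X"
    using Zreal by (force simp: X_def image_image image_iff subset_iff Reals_def)
  show ?thesis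
  proof (rule that[of X "\<lambda>x. Re (w (complex_of_real x))"])
    show "finite X"
      using finZ by (simp add: X_def)
    show "0 < Re (w (complex_of_real x))" if "x \<in> X" for x
      using that ZX w_pos by auto
    fix k assume k: "k < 2 * n"
    have "complex_of_real (t k) = mom t (monom 1 k)"
      by (simp add: mom_monom)
    also have "\<dots> = (\<Sum>z\<in>Z. w z * z ^ k)"
      using k by (subst exact) (simp_all add: degree_monom_eq poly_monom)
    also have "\<dots> = (\<Sum>x\<in>X. w (complex_of_real x) * complex_of_real x ^ k)"
      unfolding ZX by (subst sum.reindex) (auto simp: inj_on_def)
    also have "\<dots> = (\<Sum>x\<in>X. complex_of_real (Re (w (complex_of_real x)) * x ^ k))"
      using w_pos ZX by (intro sum.cong) auto
    finally have "complex_of_real (t k) = complex_of_real (\<Sum>x\<in>X. Re (w (complex_of_real x)) * x ^ k)"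
      by (simp only: of_real_sum)
    then show "(\<Sum>x\<in>X. Re (w (complex_of_real x)) * x ^ k) = t k"
      by (simp only: of_real_eq_iff)
  qed
qed

end

section \<open>Quadrature measures and moments of weak limits\<close>

lemma discrete_distribution:
  assumes "finite X" "\<And>x. x \<in> X \<Longrightarrow> 0 < w x" "(\<Sum>x\<in>X. w x) = (1::real)"
  shows "\<exists>\<mu>. real_distribution \<mu> \<and> (\<forall>f\<in>borel_measurable borel.
    integrable \<mu> f \<and> integral\<^sup>L \<mu> f = (\<Sum>x\<in>X. w x * f x :: real))"
proof -
  define P where "P = point_measure X (\<lambda>x. ennreal (w x))"
  have "emeasure P (space P) = (\<Sum>x\<in>X. ennreal (w x))"
    using assms(1) by (simp add: P_def space_point_measure emeasure_point_measure_finite)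
  also have "\<dots> = 1"
    using assms by (subst sum_ennreal) (auto intro: less_imp_le)
  finally interpret P: prob_space P
    by (rule prob_spaceI)
  have m [measurable]: "(\<lambda>x. x) \<in> borel_measurable P"
    by (simp add: P_def)
  show ?thesis
  proof (intro exI[of _ "distr P borel (\<lambda>x. x)"] conjI ballI)
    show "real_distribution (distr P borel (\<lambda>x. x))"
      by (rule P.real_distribution_distr) (rule m)
    fix f :: "real \<Rightarrow> real" assume f [measurable]: "f \<in> borel_measurable borel"
    have "integrable P f"
      using assms by (simp add: P_def integrable_point_measure_finite)
    then show "integrable (distr P borel (\<lambda>x. x)) f"
      by (subst integrable_distr_eq) (use m f in auto)
    have "integral\<^sup>L (distr P borel (\<lambda>x. x)) f = integral\<^sup>L P f"
      by (subst integral_distr) (use m f in auto)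
    also have "\<dots> = (\<Sum>x\<in>X. w x * f x)"
      unfolding P_def using assms by (subst lebesgue_integral_point_measure_finite) (auto intro: less_imp_le)
    finally show "integral\<^sup>L (distr P borel (\<lambda>x. x)) f = (\<Sum>x\<in>X. w x * f x)" .
  qed
qed

text \<open>A bounded continuous replacement for x, since weak convergence only tests bounded
  continuous integrands.\<close>

definition real_clamp :: "real \<Rightarrow> real \<Rightarrow> real" where
  "real_clamp c x = max (- c) (min c x)"

text \<open>Outside [-c, c] the difference is at most 2 |x|^k, and |x|^k \<ge> c turns this into 2
  x^(2k) / c. So the moment of order 2k bounds the truncation error uniformly over a family of
  measures.\<close>

lemma power_clamp_diff_le:
  fixes x c :: real
  assumes "1 \<le> c"
  shows "\<bar>x ^ k - real_clamp c x ^ k\<bar> \<le> 2 * x ^ (2 * k) / c"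
proof (cases "\<bar>x\<bar> \<le> c \<or> k = 0")
  case True
  then have "\<bar>x ^ k - real_clamp c x ^ k\<bar> = 0"
    by (auto simp: real_clamp_def)
  also have "0 \<le> 2 * x ^ (2 * k) / c"
    using assms by simp
  finally show ?thesis .
next
  case False
  have "\<bar>real_clamp c x ^ k\<bar> \<le> \<bar>x\<bar> ^ k"
    unfolding power_abs using assms by (intro power_mono) (auto simp: real_clamp_def)
  then have "\<bar>x ^ k - real_clamp c x ^ k\<bar> \<le> 2 * \<bar>x\<bar> ^ k"
    using abs_triangle_ineq4[of "x ^ k" "real_clamp c x ^ k"] by (simp add: power_abs)
  moreover have "\<bar>x\<bar> ^ k \<le> x ^ (2 * k) / c"
  proof -
  have "c \<le> \<bar>x\<bar> ^ k"
    using False assms self_le_power[of "\<bar>x\<bar>" k] by linarith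
  then have "\<bar>x\<bar> ^ k * c \<le> \<bar>x\<bar> ^ k * \<bar>x\<bar> ^ k"
    by (intro mult_left_mono) auto
  also have "\<dots> = x ^ (2 * k)"
    by (metis mult_2 power_add power_even_abs even_mult_iff even_numeral)
  finally show ?thesis
    using assms by (simp add: pos_le_divide_eq)
  qed
  ultimately show ?thesis
    by simp
qed

text \<open>Moments do not pass to weak limits in general; here the eventually constant moment of
  order 2k controls the tails of x^k.\<close>

lemma weak_limit_moments:
  fixes t :: "nat \<Rightarrow> real"
  assumes \<nu>: "\<And>j. real_distribution (\<nu> j)" and M: "real_distribution M" and conv: "weak_conv_m \<nu> M"
    and int: "\<And>j k. integrable (\<nu> j) (\<lambda>x. x ^ k)"
    and mom: "\<And>k. eventually (\<lambda>j. (\<integral>x. x ^ k \<partial>\<nu> j) = t k) sequentially"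
  shows "integrable M (\<lambda>x. x ^ k)" and "(\<integral>x. x ^ k \<partial>M) = t k"
proof -
  interpret M: real_distribution M by (rule M)
  interpret \<nu>: real_distribution "\<nu> j" for j by (rule \<nu>)
  have lim: "(\<lambda>j. integral\<^sup>L (\<nu> j) f) \<longlonglongrightarrow> integral\<^sup>L M f"
    if "continuous_on UNIV f" "\<And>x. norm (f x) \<le> B" for f :: "real \<Rightarrow> real" and B
    using that by (intro weak_conv_imp_integral_bdd_continuous_conv[OF \<nu> M conv])
      (auto simp: continuous_on_eq_continuous_at)
  have intb: "integrable \<kappa> f" if "real_distribution \<kappa>" "continuous_on UNIV f" "\<And>x. norm (f x) \<le> B"
    for f :: "real \<Rightarrow> real" and B \<kappa>
  proof -
    interpret \<kappa>: real_distribution \<kappa> by (rule that)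
    have "f \<in> borel_measurable borel"
      using that(2) by (rule borel_measurable_continuous_onI)
    then have "f \<in> borel_measurable \<kappa>"
      by (simp cong: measurable_cong_sets)
    then show ?thesis
      using that(3) by (intro \<kappa>.integrable_const_bound[of _ B]) auto
  qed
  \<comment> \<open>For even powers an inequality comes first: the truncations at height c have
    limit integrals at most t(2k), and monotone convergence removes the truncation.\<close>
  have even: "integrable M (\<lambda>x. x ^ (2 * k)) \<and> (\<integral>x. x ^ (2 * k) \<partial>M) \<le> t (2 * k)" for k
  proof -
    define f where "f c x = min (x ^ (2 * k)) (real c)" for c :: nat and x :: real
    have f0: "0 \<le> f c x" "f c x \<le> real c" for c x
      by (auto simp: f_def)
    have fc: "continuous_on UNIV (f c)" for c
      unfolding f_def by (intro continuous_intros)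
    have fi: "integrable \<kappa> (f c)" if "real_distribution \<kappa>" for \<kappa> c
      using that fc by (rule intb[of _ _ "real c"]) (use f0 in auto)
    have le: "integral\<^sup>L M (f c) \<le> t (2 * k)" for c
    proof (rule tendsto_upperbound)
      show "(\<lambda>j. integral\<^sup>L (\<nu> j) (f c)) \<longlonglongrightarrow> integral\<^sup>L M (f c)"
        by (rule lim[OF fc, of _ "real c"]) (use f0 in auto)
      show "eventually (\<lambda>j. integral\<^sup>L (\<nu> j) (f c) \<le> t (2 * k)) sequentially"
        using mom[of "2 * k"]
      proof eventually_elim
        case (elim j)
        have "integral\<^sup>L (\<nu> j) (f c) \<le> (\<integral>x. x ^ (2 * k) \<partial>\<nu> j)"
          by (intro integral_mono fi \<nu> int) (auto simp: f_def)
        with elim show ?case by simp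
      qed
    qed simp
    have inc: "incseq (\<lambda>c. integral\<^sup>L M (f c))"
      by (intro monoI integral_mono fi M) (auto simp: f_def)
    obtain L where L: "(\<lambda>c. integral\<^sup>L M (f c)) \<longlonglongrightarrow> L"
      using incseq_convergent[OF inc] le by blast
    have "L \<le> t (2 * k)"
      by (rule LIMSEQ_le_const2[OF L]) (use le in auto)
    have "(\<lambda>c. f c x) \<longlonglongrightarrow> x ^ (2 * k)" for x
    proof (rule tendsto_eventually)
      obtain N :: nat where "x ^ (2 * k) \<le> real N"
        using real_arch_simple by blast
      then show "eventually (\<lambda>c. f c x = x ^ (2 * k)) sequentially"
        unfolding f_def by (intro eventually_sequentiallyI[of N]) (auto simp: min_def)
    qed
    then have "integrable M (\<lambda>x. x ^ (2 * k))" "(\<integral>x. x ^ (2 * k) \<partial>M) = L"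
      by (intro integrable_monotone_convergence[of M f, OF fi[OF M] _ _ L]
            integral_monotone_convergence[of M f, OF fi[OF M] _ _ L];
          auto simp: f_def mono_def)+
    with \<open>L \<le> t (2 * k)\<close> show ?thesis by simp
  qed
  have intM: "integrable M (\<lambda>x. x ^ k)" for k
  proof (rule Bochner_Integration.integrable_bound[of _ "\<lambda>x. 1 + x ^ (2 * k)"])
    show "integrable M (\<lambda>x. 1 + x ^ (2 * k))"
      using even[of k] by auto
    have "\<bar>x\<bar> ^ k \<le> 1 + x ^ (2 * k)" for x :: real
    proof -
      have "2 * \<bar>x\<bar> ^ k \<le> 1 + x ^ (2 * k)"
        using sum_squares_bound[of 1 "\<bar>x\<bar> ^ k"]
        by (simp add: power_even_abs mult.commute flip: power_mult)
      moreover have "0 \<le> \<bar>x\<bar> ^ k" by simp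
      ultimately show ?thesis by linarith
    qed
    then show "AE x in M. norm (x ^ k) \<le> norm (1 + x ^ (2 * k))"
      by (simp add: power_abs)
  qed auto
  show "integrable M (\<lambda>x. x ^ k)" by (rule intM)
  \<comment> \<open>Two truncation errors of 2 t(2k) / c, one for the measures
    \<open>\<nu> j\<close> and one for \<open>M\<close>.\<close>
  have approx: "\<bar>(\<integral>x. x ^ k \<partial>M) - t k\<bar> \<le> 4 * t (2 * k) / c" if c: "1 \<le> c" for c
  proof -
    define g where "g x = real_clamp c x ^ k" for x
    have gc: "continuous_on UNIV g"
      unfolding g_def real_clamp_def by (intro continuous_intros)
    have gb: "norm (g x) \<le> c ^ k" for x
      unfolding g_def real_norm_def power_abs using c by (intro power_mono) (auto simp: real_clamp_def)
    have gi: "integrable \<kappa> g" if "real_distribution \<kappa>" for \<kappa>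
      by (rule intb[OF that gc gb])
    have key: "\<bar>(\<integral>x. x ^ k \<partial>\<kappa>) - integral\<^sup>L \<kappa> g\<bar> \<le> 2 * b / c"
      if \<kappa>: "real_distribution \<kappa>" "\<And>k. integrable \<kappa> (\<lambda>x. x ^ k)" "(\<integral>x. x ^ (2 * k) \<partial>\<kappa>) \<le> b" for \<kappa> b
    proof -
      have "\<bar>(\<integral>x. x ^ k \<partial>\<kappa>) - integral\<^sup>L \<kappa> g\<bar> = \<bar>\<integral>x. x ^ k - g x \<partial>\<kappa>\<bar>"
        by (subst Bochner_Integration.integral_diff) (use \<kappa> gi in auto)
      also have "\<dots> \<le> (\<integral>x. \<bar>x ^ k - g x\<bar> \<partial>\<kappa>)"
        by (rule integral_abs_bound)
      also have "\<dots> \<le> (\<integral>x. 2 * x ^ (2 * k) / c \<partial>\<kappa>)"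
      proof (rule integral_mono)
        show "integrable \<kappa> (\<lambda>x. \<bar>x ^ k - g x\<bar>)"
          using \<kappa>(2) gi[OF \<kappa>(1)] by simp
        show "integrable \<kappa> (\<lambda>x. 2 * x ^ (2 * k) / c)"
          using \<kappa>(2) by simp
      qed (use c in \<open>auto simp: g_def intro: power_clamp_diff_le\<close>)
      also have "\<dots> = 2 * (\<integral>x. x ^ (2 * k) \<partial>\<kappa>) / c"
        by simp
      also have "\<dots> \<le> 2 * b / c"
        using \<kappa>(3) c by (intro divide_right_mono) auto
      finally show ?thesis .
    qed
    have "\<bar>t k - integral\<^sup>L M g\<bar> \<le> 2 * t (2 * k) / c"
    proof (rule tendsto_upperbound)
      show "(\<lambda>j. \<bar>t k - integral\<^sup>L (\<nu> j) g\<bar>) \<longlonglongrightarrow> \<bar>t k - integral\<^sup>L M g\<bar>"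
        by (intro tendsto_intros lim[OF gc gb])
      show "eventually (\<lambda>j. \<bar>t k - integral\<^sup>L (\<nu> j) g\<bar> \<le> 2 * t (2 * k) / c) sequentially"
        using mom[of k] mom[of "2 * k"]
      proof eventually_elim
        case (elim j)
        then show ?case
          using key[OF \<nu> int, of j "t (2 * k)"] by simp
      qed
    qed simp
    moreover have "\<bar>(\<integral>x. x ^ k \<partial>M) - integral\<^sup>L M g\<bar> \<le> 2 * t (2 * k) / c"
      using even[of k] by (intro key M intM) auto
    ultimately show ?thesis by linarith
  qed
  have "(\<integral>x. x ^ k \<partial>M) - t k = 0"
  proof (rule ccontr)
    assume *: "(\<integral>x. x ^ k \<partial>M) - t k \<noteq> 0"
    define e where "e = \<bar>(\<integral>x. x ^ k \<partial>M) - t k\<bar>"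
    have e: "e > 0" using * by (simp add: e_def)
    \<comment> \<open>Chosen to make the error at most e / 2; the maximum with 1 keeps c
      admissible.\<close>
    define c where "c = max 1 (8 * t (2 * k) / e)"
    have "e \<le> 4 * t (2 * k) / c"
      unfolding e_def by (rule approx) (simp add: c_def)
    moreover have "1 \<le> c" "8 * t (2 * k) / e \<le> c"
      by (auto simp: c_def)
    then have "8 * t (2 * k) \<le> e * c" "0 < c"
      using e by (auto simp: field_simps)
    then have "4 * t (2 * k) / c \<le> e / 2"
      by (simp add: field_simps)
    ultimately show False
      using e by linarith
  qed
  then show "(\<integral>x. x ^ k \<partial>M) = t k" by simp
qed

theorem (in pd_moments) hamburger:
  obtains M where "real_distribution M" "\<And>k. integrable M (\<lambda>x. x ^ k)" "\<And>k. (\<integral>x. x ^ k \<partial>M) = t k"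
proof -
  have "\<exists>\<mu>. real_distribution \<mu> \<and> (\<forall>k. integrable \<mu> (\<lambda>x. x ^ k)) \<and>
      (\<forall>k < 2 * (n + 2). (\<integral>x. x ^ k \<partial>\<mu>) = t k)" for n :: nat
  proof -
    \<comment> \<open>With n + 2 in place of n, every measure, including the first, has the right
      second moment, which tightness needs.\<close>
    obtain X w where Xw: "finite X" "\<And>x. x \<in> X \<Longrightarrow> 0 < w x"
      "\<And>k. k < 2 * (n + 2) \<Longrightarrow> (\<Sum>x\<in>X. w x * x ^ k) = t k"
      using gauss_quadrature[of "n + 2"] by (metis add_gr_0 zero_less_numeral)
    have sum1: "(\<Sum>x\<in>X. w x) = 1"
      using Xw(3)[of 0] t0 by simp
    from discrete_distribution[OF Xw(1) Xw(2) sum1] obtain \<mu> where \<mu>: "real_distribution \<mu>"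
      "\<forall>f\<in>borel_measurable borel. integrable \<mu> f \<and> integral\<^sup>L \<mu> f = (\<Sum>x\<in>X. w x * f x)"
      by blast
    then show ?thesis
      using Xw(3) by (intro exI[of _ \<mu>]) auto
  qed
  then obtain \<mu> where \<mu>: "\<And>n. real_distribution (\<mu> n)" "\<And>n k. integrable (\<mu> n) (\<lambda>x. x ^ k)"
    "\<And>n k. k < 2 * (n + 2) \<Longrightarrow> (\<integral>x. x ^ k \<partial>\<mu> n) = t k"
    by metis
  have "tight \<mu>"
    unfolding tight_def
  proof safe
    fix e :: real assume e: "e > 0"
    \<comment> \<open>Chebyshev's inequality bounds the mass outside by t(2) / a^2; adding 1 makes a
      positive and this bound strictly less than e.\<close>
    define a where "a = sqrt (\<bar>t 2\<bar> / e) + 1"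
    have a: "a > 0" "\<bar>t 2\<bar> / e < a\<^sup>2"
    proof -
      have "sqrt (\<bar>t 2\<bar> / e) \<ge> 0" using e by simp
      then show "a > 0" unfolding a_def by linarith
      have "(sqrt (\<bar>t 2\<bar> / e))\<^sup>2 < a\<^sup>2"
        using e unfolding a_def by (intro power_strict_mono) auto
      then show "\<bar>t 2\<bar> / e < a\<^sup>2" using e by simp
    qed
    have "measure (\<mu> n) {- a<..a} > 1 - e" for n
    proof -
      interpret \<mu>: real_distribution "\<mu> n" by (rule \<mu>)
      have "measure (\<mu> n) {x \<in> space (\<mu> n). a \<le> \<bar>x\<bar>} \<le> (\<integral>x. x ^ 2 \<partial>\<mu> n) / a\<^sup>2"
        using a \<mu>(2) by (intro \<mu>.second_moment_method) auto
      also have "\<dots> = t 2 / a\<^sup>2"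
        by (subst \<mu>(3)) auto
      also have "\<dots> < e"
        using a e by (simp add: field_simps)
      finally have lt: "measure (\<mu> n) {x. a \<le> \<bar>x\<bar>} < e" by simp
      have "measure (\<mu> n) (UNIV - {- a<..a}) \<le> measure (\<mu> n) {x. a \<le> \<bar>x\<bar>}"
        by (rule \<mu>.finite_measure_mono) auto
      moreover have "measure (\<mu> n) (space (\<mu> n) - {- a<..a}) = 1 - measure (\<mu> n) {- a<..a}"
        by (rule \<mu>.prob_compl) simp
      ultimately show ?thesis
        using lt by simp
    qed
    then show "\<exists>a b. a < b \<and> (\<forall>n. 1 - e < measure (\<mu> n) {a<..b})"
      using a(1) by (intro exI[of _ "- a"] exI[of _ a]) auto
  qed (rule \<mu>)
  from tight_imp_convergent_subsubsequence[OF this strict_mono_id]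
  obtain r M where rM: "strict_mono r" "real_distribution M" "weak_conv_m (\<mu> \<circ> id \<circ> r) M"
    by (auto simp: id_def)
  have "eventually (\<lambda>j. (\<integral>x. x ^ k \<partial>(\<mu> \<circ> id \<circ> r) j) = t k) sequentially" for k
  proof (rule eventually_sequentiallyI[of k])
    fix j assume "k \<le> j"
    also have "j \<le> r j"
      by (rule seq_suble[OF rM(1)])
    finally show "(\<integral>x. x ^ k \<partial>(\<mu> \<circ> id \<circ> r) j) = t k"
      using \<mu>(3)[of k "r j"] by simp
  qed
  from weak_limit_moments[OF _ rM(2,3) _ this] \<mu> rM(2) show ?thesis
    by (intro that) auto
qed

text \<open>
  Removing from the functional a multiple of the evaluation at \<open>x\<close> that is less than the inverse
  of its squared norm leaves a positive definite functional; the removed part becomes an atom.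
\<close>

theorem (in pd_moments) hamburger_with_atom:
  fixes x :: real
  assumes "eval_bounded t (complex_of_real x) C"
  obtains M where "real_distribution M" "\<And>k. integrable M (\<lambda>y. y ^ k)" "\<And>k. (\<integral>y. y ^ k \<partial>M) = t k"
    "0 < measure M {x}"
proof -
  \<comment> \<open>Half of 1 / C: subtracting a |p(x)|^2 costs at most half of the squared norm of
    p, so the rest stays strictly positive.\<close>
  define a where "a = 1 / (2 * C)"
  have C: "1 \<le> C"
    by (rule eval_bounded_ge_1[OF assms])
  have a: "0 < a" "a < 1"
    using C by (auto simp: a_def)
  define t' where "t' n = (t n - a * x ^ n) / (1 - a)" for n
  have uip': "uip t' p p = (uip t p p - complex_of_real (a * (cmod (poly p (complex_of_real x)))\<^sup>2)) / complex_of_real (1 - a)" for p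
  proof -
    have "uip t' p p = qform (\<lambda>i j. complex_of_real (1 / (1 - a)) * (complex_of_real (t (i + j))
        - complex_of_real a * (complex_of_real x ^ i * cnj (complex_of_real x ^ j)))) {..degree p} (poly.coeff p)"
      unfolding qform_moments[symmetric] by (intro qform_cong) (auto simp: t'_def power_add)
    also have "\<dots> = complex_of_real (1 / (1 - a)) * (uip t p p - complex_of_real a * complex_of_real ((cmod (poly p (complex_of_real x)))\<^sup>2))"
      by (simp only: qform_cmult qform_diff qform_moments qform_eval)
    finally show ?thesis by simp
  qed
  have "pd_moments t'"
  proof
    fix p :: "complex poly" assume "p \<noteq> 0"
    then have pos: "0 < Re (uip t p p)" by (rule pd)
    have "a * (cmod (poly p (complex_of_real x)))\<^sup>2 \<le> a * (C * Re (uip t p p))"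
      using a by (intro mult_left_mono eval_boundedD[OF assms]) auto
    also have "\<dots> = Re (uip t p p) / 2"
      using C by (simp add: a_def)
    finally have "0 < Re (uip t p p) - a * (cmod (poly p (complex_of_real x)))\<^sup>2"
      using pos by linarith
    then show "0 < Re (uip t' p p)"
      unfolding uip' Re_divide_of_real using a by simp
  qed (use a t0 in \<open>simp add: t'_def\<close>)
  then interpret T': pd_moments t' .
  obtain M' where M': "real_distribution M'" "\<And>k. integrable M' (\<lambda>y. y ^ k)" "\<And>k. (\<integral>y. y ^ k \<partial>M') = t' k"
    by (rule T'.hamburger) blast
  interpret M': real_distribution M' by (rule M'(1))
  \<comment> \<open>The mixture of the point mass at x with weight a and of M' with weight 1 - a,
    realised as a law: a coin of bias a decides between x and an independent draw from M'.\<close>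
  let ?B = "measure_pmf (bernoulli_pmf a)"
  interpret P: pair_prob_space ?B M' ..
  define F where "F = (\<lambda>p :: bool \<times> real. if fst p then x else snd p)"
  have F [measurable]: "F \<in> borel_measurable (?B \<Otimes>\<^sub>M M')"
    unfolding F_def by measurable
  have int: "integrable (?B \<Otimes>\<^sub>M M') (\<lambda>p. F p ^ k)" for k
  proof (rule P.Fubini_integrable)
    show "integrable ?B (\<lambda>b. \<integral>y. norm (F (b, y) ^ k) \<partial>M')"
      by (rule integrable_measure_pmf_finite) simp
    have "integrable M' (\<lambda>y. F (b, y) ^ k)" for b
      using M'(2)[of k] by (cases b) (simp_all add: F_def)
    then show "AE b in ?B. integrable M' (\<lambda>y. F (b, y) ^ k)"
      by simp
  qed measurable
  show ?thesis
  proof (rule that[of "distr (?B \<Otimes>\<^sub>M M') borel F"])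
    show "real_distribution (distr (?B \<Otimes>\<^sub>M M') borel F)"
      by (rule P.real_distribution_distr) (rule F)
    show "integrable (distr (?B \<Otimes>\<^sub>M M') borel F) (\<lambda>y. y ^ k)" for k
      by (subst integrable_distr_eq) (use int in auto)
    show "(\<integral>y. y ^ k \<partial>distr (?B \<Otimes>\<^sub>M M') borel F) = t k" for k
    proof -
      have "(\<integral>y. y ^ k \<partial>distr (?B \<Otimes>\<^sub>M M') borel F) = (\<integral>p. F p ^ k \<partial>(?B \<Otimes>\<^sub>M M'))"
        by (subst integral_distr) auto
      also have "\<dots> = (\<integral>b. (\<integral>y. F (b, y) ^ k \<partial>M') \<partial>?B)"
        by (rule P.integral_fst'[OF int, symmetric])
      also have "\<dots> = x ^ k * a + t' k * (1 - a)"
        using a M'.prob_space by (simp add: F_def M'(3))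
      also have "\<dots> = t k"
        using a by (simp add: t'_def)
      finally show ?thesis .
    qed
    have "a = measure ?B {True} * measure M' UNIV"
      using a M'.prob_space by (simp add: measure_pmf_single)
    also have "\<dots> = measure (?B \<Otimes>\<^sub>M M') ({True} \<times> UNIV)"
      by (simp add: measure_def M'.emeasure_pair_measure_Times enn2real_mult)
    also have "\<dots> \<le> measure (?B \<Otimes>\<^sub>M M') (F -` {x} \<inter> space (?B \<Otimes>\<^sub>M M'))"
    proof (rule P.finite_measure_mono)
      show "F -` {x} \<inter> space (?B \<Otimes>\<^sub>M M') \<in> sets (?B \<Otimes>\<^sub>M M')"
        by (rule measurable_sets[OF F]) simp
    qed (auto simp: F_def space_pair_measure)
    also have "\<dots> = measure (distr (?B \<Otimes>\<^sub>M M') borel F) {x}"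
      by (subst measure_distr) auto
    finally show "0 < measure (distr (?B \<Otimes>\<^sub>M M') borel F) {x}"
      using a by simp
  qed
qed

section \<open>Positive definite multisequences\<close>

lemma Lfun_eq:
  assumes "finite S" "Poly_Mapping.keys p \<subseteq> S"
  shows "Lfun s p = (\<Sum>\<alpha>\<in>S. Poly_Mapping.lookup p \<alpha> * s \<alpha>)"
  unfolding Lfun_def using assms by (intro sum.mono_neutral_left) (auto simp: in_keys_iff)

lemma meval_eq:
  assumes "finite S" "Poly_Mapping.keys p \<subseteq> S"
  shows "meval p z = (\<Sum>\<alpha>\<in>S. Poly_Mapping.lookup p \<alpha> * mpower z \<alpha>)"
  unfolding meval_def using assms by (intro sum.mono_neutral_left) (auto simp: in_keys_iff)

lemma Lfun_add: "Lfun s (p + q) = Lfun s p + Lfun s q"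
proof -
  let ?S = "Poly_Mapping.keys p \<union> Poly_Mapping.keys q"
  have "Poly_Mapping.keys (p + q) \<subseteq> ?S"
    by (rule keys_add)
  then show ?thesis
    by (simp add: Lfun_eq[of ?S] lookup_add sum.distrib algebra_simps)
qed

lemma Lfun_zero [simp]: "Lfun s 0 = 0"
  by (simp add: Lfun_def)

lemma Lfun_sum: "Lfun s (\<Sum>i\<in>S. f i) = (\<Sum>i\<in>S. Lfun s (f i))"
  by (induction S rule: infinite_finite_induct) (simp_all add: Lfun_add)

lemma Lfun_single: "Lfun s (Poly_Mapping.single \<alpha> c) = c * s \<alpha>"
  by (simp add: Lfun_def)

lemma lookup_mconst_mult: "Poly_Mapping.lookup (mconst c * p) \<alpha> = c * Poly_Mapping.lookup p \<alpha>"
  unfolding mconst_def mult_map_scale_conv_mult[symmetric] by (simp add: Poly_Mapping.map.rep_eq when_def)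

lemma keys_mconst_mult: "Poly_Mapping.keys (mconst c * p) \<subseteq> Poly_Mapping.keys p"
  by (auto simp: in_keys_iff lookup_mconst_mult)

lemma lookup_mcnj: "Poly_Mapping.lookup (mcnj p) \<alpha> = cnj (Poly_Mapping.lookup p \<alpha>)"
  by (simp add: mcnj_def Poly_Mapping.map.rep_eq when_def)

lemma Lfun_mconst_mult: "Lfun s (mconst c * p) = c * Lfun s p"
  unfolding Lfun_eq[OF finite_keys keys_mconst_mult] by (simp add: Lfun_def lookup_mconst_mult sum_distrib_left mult.assoc)

lemma meval_add: "meval (p + q) z = meval p z + meval q z"
proof -
  let ?S = "Poly_Mapping.keys p \<union> Poly_Mapping.keys q"
  have "Poly_Mapping.keys (p + q) \<subseteq> ?S"
    by (rule keys_add)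
  then show ?thesis
    by (simp add: meval_eq[of ?S] lookup_add sum.distrib algebra_simps)
qed

lemma meval_mconst_mult: "meval (mconst c * p) z = c * meval p z"
  unfolding meval_eq[OF finite_keys keys_mconst_mult] by (simp add: meval_def lookup_mconst_mult sum_distrib_left mult.assoc)

lemma mpoly_as_sum:
  fixes p :: "'d mpoly"
  assumes "finite S" "Poly_Mapping.keys p \<subseteq> S"
  shows "p = (\<Sum>\<alpha>\<in>S. Poly_Mapping.single \<alpha> (Poly_Mapping.lookup p \<alpha>))"
proof (rule poly_mapping_eqI)
  fix k
  show "Poly_Mapping.lookup p k = Poly_Mapping.lookup (\<Sum>\<alpha>\<in>S. Poly_Mapping.single \<alpha> (Poly_Mapping.lookup p \<alpha>)) k"
    using assms by (auto simp: lookup_sum lookup_single when_def in_keys_iff)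
qed

lemma minner_expand:
  assumes "finite S" "Poly_Mapping.keys p \<subseteq> S" "Poly_Mapping.keys q \<subseteq> S"
  shows "minner s p q = (\<Sum>\<alpha>\<in>S. \<Sum>\<beta>\<in>S. Poly_Mapping.lookup p \<alpha> * cnj (Poly_Mapping.lookup q \<beta>) * s (\<alpha> + \<beta>))"
proof -
  have "Poly_Mapping.keys (mcnj q) \<subseteq> S"
    using assms(3) by (auto simp: in_keys_iff lookup_mcnj)
  then have "p * mcnj q = (\<Sum>\<alpha>\<in>S. Poly_Mapping.single \<alpha> (Poly_Mapping.lookup p \<alpha>)) *
      (\<Sum>\<beta>\<in>S. Poly_Mapping.single \<beta> (cnj (Poly_Mapping.lookup q \<beta>)))"
    using mpoly_as_sum[OF assms(1,2)] mpoly_as_sum[OF assms(1), of "mcnj q"] by (simp add: lookup_mcnj)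
  then show ?thesis
    by (simp add: minner_def sum_product mult_single Lfun_sum Lfun_single)
qed

abbreviation moment_kernel :: "('d mindex \<Rightarrow> complex) \<Rightarrow> 'd mindex \<Rightarrow> 'd mindex \<Rightarrow> complex" where
  "moment_kernel s \<equiv> \<lambda>\<alpha> \<beta>. s (\<alpha> + \<beta>)"

lemma qform_moment_kernel:
  assumes "finite S" "Poly_Mapping.keys p \<subseteq> S"
  shows "qform (moment_kernel s) S (Poly_Mapping.lookup p) = minner s p p"
  by (simp add: qform_def minner_expand[OF assms assms(2)])

lemma qform_mpower:
  assumes "finite S" "Poly_Mapping.keys p \<subseteq> S"
  shows "qform (\<lambda>\<alpha> \<beta>. mpower z \<alpha> * cnj (mpower z \<beta>)) S (Poly_Mapping.lookup p)
    = complex_of_real ((cmod (meval p z))\<^sup>2)"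
  by (simp add: qform_outer meval_eq[OF assms])

lemma psd_mindex_iff:
  fixes K :: "'d mindex \<Rightarrow> 'd mindex \<Rightarrow> complex"
  shows "psd K \<longleftrightarrow> (\<forall>p. 0 \<le> qform K (Poly_Mapping.keys p) (Poly_Mapping.lookup p))"
proof safe
  fix p :: "'d mpoly"
  assume "psd K"
  then show "0 \<le> qform K (Poly_Mapping.keys p) (Poly_Mapping.lookup p)"
    by (rule psdD) simp
next
  assume *: "\<forall>p. 0 \<le> qform K (Poly_Mapping.keys p) (Poly_Mapping.lookup p)"
  show "psd K"
  proof (rule psdI)
    fix S :: "'d mindex set" and v :: "'d mindex \<Rightarrow> complex"
    assume fin: "finite S"
    define p where "p = (\<Sum>\<alpha>\<in>S. Poly_Mapping.single \<alpha> (v \<alpha>))"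
    have c: "Poly_Mapping.lookup p \<alpha> = (if \<alpha> \<in> S then v \<alpha> else 0)" for \<alpha>
      using fin by (simp add: p_def lookup_sum lookup_single when_def)
    have "qform K S v = qform K S (Poly_Mapping.lookup p)"
      by (rule qform_cong) (auto simp: c)
    also have "\<dots> = qform K (Poly_Mapping.keys p) (Poly_Mapping.lookup p)"
      by (rule qform_mono_support[symmetric]) (use fin in \<open>auto simp: c in_keys_iff split: if_splits\<close>)
    finally show "0 \<le> qform K S v"
      using * by simp
  qed
qed

lemma mpoly_vector_space: "vector_space (\<lambda>c p :: 'd mpoly. mconst c * p)"
proof
  show "mconst (a + b) * x = mconst a * x + mconst b * (x :: 'd mpoly)" for a b x
    by (simp add: mconst_def single_add distrib_right)
  show "mconst a * (mconst b * x) = mconst (a * b) * (x :: 'd mpoly)" for a b x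
    by (simp add: mconst_def mult_single flip: mult.assoc)
qed (simp_all add: mconst_def distrib_left)

locale pd_multisequence =
  fixes s :: "'d::{finite,linorder} mindex \<Rightarrow> complex"
  assumes pd: "p \<noteq> 0 \<Longrightarrow> 0 < Lfun s (p * mcnj p)"
    and s0: "s 0 = 1"
begin

lemma minner_self_nonneg: "0 \<le> minner s p p"
  using pd[of p] by (cases "p = 0") (auto simp: minner_def)

lemma psd_moment_kernel: "psd (moment_kernel s)"
  unfolding psd_mindex_iff using minner_self_nonneg by (simp add: qform_moment_kernel)

text \<open>The entries (0, \<alpha>) and (\<alpha>, 0) of the moment kernel coincide, and Hermitian
  symmetry makes them conjugate.\<close>

lemma s_real: "s \<alpha> = complex_of_real (Re (s \<alpha>))"
proof -
  have "psd_on {0, \<alpha>} (moment_kernel s)"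
    using psd_moment_kernel by (simp add: psd_def)
  from psd_on_hermitian[OF this, of 0 \<alpha>] show ?thesis
    by (simp add: complex_eq_iff)
qed

lemma minner_commute: "minner s q p = cnj (minner s p q)"
proof -
  let ?S = "Poly_Mapping.keys p \<union> Poly_Mapping.keys q"
  have cs: "cnj (s \<alpha>) = s \<alpha>" for \<alpha>
    by (subst (1 2) s_real) simp
  have "minner s q p = (\<Sum>\<alpha>\<in>?S. \<Sum>\<beta>\<in>?S. Poly_Mapping.lookup q \<alpha> * cnj (Poly_Mapping.lookup p \<beta>) * s (\<alpha> + \<beta>))"
    by (rule minner_expand) auto
  also have "\<dots> = (\<Sum>\<alpha>\<in>?S. \<Sum>\<beta>\<in>?S. Poly_Mapping.lookup q \<beta> * cnj (Poly_Mapping.lookup p \<alpha>) * s (\<alpha> + \<beta>))"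
    by (subst sum.swap) (simp add: add.commute)
  also have "\<dots> = cnj (\<Sum>\<alpha>\<in>?S. \<Sum>\<beta>\<in>?S. Poly_Mapping.lookup p \<alpha> * cnj (Poly_Mapping.lookup q \<beta>) * s (\<alpha> + \<beta>))"
    by (simp add: cs mult_ac)
  also have "(\<Sum>\<alpha>\<in>?S. \<Sum>\<beta>\<in>?S. Poly_Mapping.lookup p \<alpha> * cnj (Poly_Mapping.lookup q \<beta>) * s (\<alpha> + \<beta>)) = minner s p q"
    by (rule minner_expand[symmetric]) auto
  finally show ?thesis .
qed

sublocale H: hermitian_space "\<lambda>c p. mconst c * p" "minner s"
proof -
  interpret vector_space "\<lambda>c p :: 'd mpoly. mconst c * p"
    by (rule mpoly_vector_space)
  show "hermitian_space (\<lambda>c p. mconst c * p) (minner s)"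
  proof unfold_locales
    show "minner s (x + y) z = minner s x z + minner s y z" for x y z
      by (simp add: minner_def distrib_right Lfun_add)
    show "minner s (mconst c * x) z = c * minner s x z" for c x z
      by (simp add: minner_def Lfun_mconst_mult mult.assoc)
    show "minner s y x = cnj (minner s x y)" for x y
      by (rule minner_commute)
    show "0 \<le> Re (minner s x x)" for x
      using minner_self_nonneg[of x] by (simp add: less_eq_complex_def)
  qed
qed

lemma minner_pos: "p \<noteq> 0 \<Longrightarrow> 0 < Re (minner s p p)"
  using pd[of p] by (simp add: minner_def less_complex_def)

section \<open>Gram-Schmidt in graded lexicographic order\<close>

lemma grlex_less_total: "\<alpha> \<noteq> \<beta> \<Longrightarrow> grlex_less \<alpha> \<beta> \<or> grlex_less \<beta> (\<alpha> :: 'd mindex)"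
  unfolding grlex_less_def by (metis linorder_neqE_nat linorder_less_linear)

text \<open>One induction on the number of predecessors for all four statements: the residual is
  orthogonal because the earlier polynomials are orthonormal, and nonzero because they involve only
  earlier monomials.\<close>

lemma orthoP_props:
  "minner s (orthoP s \<alpha>) (orthoP s \<alpha>) = 1 \<and>
   (\<forall>\<beta>. grlex_less \<beta> \<alpha> \<longrightarrow> minner s (orthoP s \<alpha>) (orthoP s \<beta>) = 0) \<and>
   (\<forall>\<gamma>. Poly_Mapping.lookup (orthoP s \<alpha>) \<gamma> \<noteq> 0 \<longrightarrow> \<gamma> = \<alpha> \<or> grlex_less \<gamma> \<alpha>) \<and>
   mvar_power \<alpha> \<in> H.span (orthoP s ` {\<beta>. \<beta> = \<alpha> \<or> grlex_less \<beta> \<alpha>})"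
proof (induction \<alpha> rule: measure_induct_rule[of "\<lambda>\<alpha>. card {\<gamma>. grlex_less \<gamma> \<alpha>}"])
  case (less \<alpha>)
  define B where "B = {\<beta>. grlex_less \<beta> \<alpha>}"
  have finB: "finite B"
    unfolding B_def by (rule finite_grlex_less)
  define P where "P = orthoP s"
  have IH: "minner s (P \<beta>) (P \<beta>) = 1" "\<And>\<gamma>. grlex_less \<gamma> \<beta> \<Longrightarrow> minner s (P \<beta>) (P \<gamma>) = 0"
      "\<And>\<gamma>. Poly_Mapping.lookup (P \<beta>) \<gamma> \<noteq> 0 \<Longrightarrow> \<gamma> = \<beta> \<or> grlex_less \<gamma> \<beta>" if "\<beta> \<in> B" for \<beta>
    using less.IH[OF card_grlex_less, of \<beta>] that by (auto simp: B_def P_def)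
  have orth: "H.orthonormal P B"
    unfolding H.orthonormal_def
  proof safe
    fix \<beta> \<gamma> assume b: "\<beta> \<in> B" "\<gamma> \<in> B"
    show "minner s (P \<beta>) (P \<gamma>) = (if \<beta> = \<gamma> then 1 else 0)"
      using grlex_less_total[of \<beta> \<gamma>] IH[OF b(1)] IH[OF b(2)] minner_commute[of "P \<beta>" "P \<gamma>"] by auto
  qed
  define c where "c \<beta> = minner s (mvar_power \<alpha>) (P \<beta>)" for \<beta>
  define y where "y = (\<Sum>\<beta>\<in>B. mconst (c \<beta>) * P \<beta>)"
  define r where "r = mvar_power \<alpha> - y"
  define N where "N = sqrt (Re (minner s r r))"
  have Pa: "P \<alpha> = mconst (1 / complex_of_real N) * r"
    unfolding P_def by (subst orthoP.simps) (simp add: mnormalize_def N_def r_def y_def c_def B_def P_def)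
  have perp: "minner s r (P \<beta>) = 0" if "\<beta> \<in> B" for \<beta>
    using H.orthonormal_coeff[OF orth finB that, of c] by (simp add: r_def y_def H.ip_diff_left c_def)
  have ylook: "Poly_Mapping.lookup y \<gamma> = (\<Sum>\<beta>\<in>B. c \<beta> * Poly_Mapping.lookup (P \<beta>) \<gamma>)" for \<gamma>
    by (simp add: y_def lookup_sum lookup_mconst_mult)
  have ylow: "grlex_less \<gamma> \<alpha>" if nz: "Poly_Mapping.lookup y \<gamma> \<noteq> 0" for \<gamma>
  proof -
    obtain \<beta> where \<beta>: "\<beta> \<in> B" "Poly_Mapping.lookup (P \<beta>) \<gamma> \<noteq> 0"
      using nz unfolding ylook by (metis (no_types, lifting) mult_zero_right sum.neutral)
    then show ?thesis
      using IH(3)[OF \<beta>] grlex_less_trans[of \<gamma> \<beta> \<alpha>] by (auto simp: B_def)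
  qed
  \<comment> \<open>All monomials of \<open>y\<close> lie strictly below \<alpha>; so the residual
    is nonzero and the normalisation does not divide by 0.\<close>
  have "Poly_Mapping.lookup r \<alpha> = 1"
    using ylow[of \<alpha>] grlex_less_irrefl[of \<alpha>] by (auto simp: r_def lookup_minus mvar_power_def)
  then have "r \<noteq> 0" by auto
  then have Npos: "0 < N" and N2: "complex_of_real N * complex_of_real N = minner s r r"
    using minner_pos[of r] H.ip_self[of r] by (simp_all add: N_def flip: of_real_mult)
  have one: "minner s (P \<alpha>) (P \<alpha>) = 1"
    unfolding Pa H.ip_scale_left H.ip_scale_right using Npos by (simp flip: N2)
  have perp': "minner s (P \<alpha>) (P \<beta>) = 0" if "grlex_less \<beta> \<alpha>" for \<beta>
    unfolding Pa H.ip_scale_left using perp[of \<beta>] that by (simp add: B_def)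
  have low: "\<gamma> = \<alpha> \<or> grlex_less \<gamma> \<alpha>" if "Poly_Mapping.lookup (P \<alpha>) \<gamma> \<noteq> 0" for \<gamma>
  proof (rule ccontr)
    assume *: "\<not> (\<gamma> = \<alpha> \<or> grlex_less \<gamma> \<alpha>)"
    then have "Poly_Mapping.lookup r \<gamma> = 0"
      using ylow[of \<gamma>] by (auto simp: r_def lookup_minus mvar_power_def lookup_single when_def)
    with that show False
      by (simp add: Pa lookup_mconst_mult)
  qed
  have "mvar_power \<alpha> = mconst (complex_of_real N) * P \<alpha> + y"
  proof -
    have "mconst (complex_of_real N) * P \<alpha> = r"
      unfolding Pa H.scale_scale using Npos by simp
    then show ?thesis by (simp add: r_def)
  qed
  also have "\<dots> \<in> H.span (P ` {\<beta>. \<beta> = \<alpha> \<or> grlex_less \<beta> \<alpha>})"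
    unfolding y_def B_def by (intro H.span_add H.span_sum H.span_scale H.span_base) auto
  finally show ?case
    using one perp' low by (auto simp: P_def)
qed

lemma orthonormal_orthoP: "H.orthonormal (orthoP s) S"
  unfolding H.orthonormal_def
proof safe
  fix \<beta> \<gamma> :: "'d mindex"
  show "minner s (orthoP s \<beta>) (orthoP s \<gamma>) = (if \<beta> = \<gamma> then 1 else 0)"
    using grlex_less_total[of \<beta> \<gamma>] orthoP_props[of \<beta>] orthoP_props[of \<gamma>]
      minner_commute[of "orthoP s \<beta>" "orthoP s \<gamma>"] by auto
qed

lemma in_span_orthoP:
  assumes "\<And>\<alpha>. \<alpha> \<in> Poly_Mapping.keys p \<Longrightarrow> mdeg \<alpha> \<le> N"
  shows "p \<in> H.span (orthoP s ` {\<alpha>. mdeg \<alpha> \<le> N})"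
proof -
  have "p = (\<Sum>\<alpha>\<in>Poly_Mapping.keys p. mconst (Poly_Mapping.lookup p \<alpha>) * mvar_power \<alpha>)"
    by (subst mpoly_as_sum[of "Poly_Mapping.keys p" p]) (simp_all add: mconst_def mvar_power_def mult_single)
  moreover have "mvar_power \<alpha> \<in> H.span (orthoP s ` {\<alpha>. mdeg \<alpha> \<le> N})" if "\<alpha> \<in> Poly_Mapping.keys p" for \<alpha>
  proof -
    have "orthoP s ` {\<beta>. \<beta> = \<alpha> \<or> grlex_less \<beta> \<alpha>} \<subseteq> orthoP s ` {\<alpha>. mdeg \<alpha> \<le> N}"
      using assms[OF that] by (intro image_mono) (auto simp: grlex_less_def)
    then show ?thesis
      using orthoP_props[of \<alpha>] H.span_mono by blast
  qed
  ultimately show ?thesis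
    by (metis (no_types, lifting) H.span_scale H.span_sum)
qed

lemma psd_eval_iff:
  "psd (\<lambda>\<alpha> \<beta>. complex_of_real C * s (\<alpha> + \<beta>) - mpower z \<alpha> * cnj (mpower z \<beta>))
    \<longleftrightarrow> (\<forall>p. (cmod (meval p z))\<^sup>2 \<le> C * Re (minner s p p))"
proof -
  have *: "qform (\<lambda>\<alpha> \<beta>. complex_of_real C * s (\<alpha> + \<beta>) - mpower z \<alpha> * cnj (mpower z \<beta>))
      (Poly_Mapping.keys p) (Poly_Mapping.lookup p)
      = complex_of_real (C * Re (minner s p p) - (cmod (meval p z))\<^sup>2)" for p
    by (subst qform_diff, subst qform_cmult, subst qform_moment_kernel, simp, simp,
        subst qform_mpower, simp, simp, subst H.ip_self) simp
  have nn: "0 \<le> complex_of_real r \<longleftrightarrow> 0 \<le> r" for r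
    by (simp add: less_eq_complex_def)
  show ?thesis
    unfolding psd_mindex_iff * nn by simp
qed

text \<open>The series is the squared norm of evaluation at z, since every polynomial lies in the
  span of the P_\<alpha> up to some total degree. The same C on both sides lets uniform bounds pass
  through.\<close>

lemma Pseries_le_iff:
  assumes C: "0 \<le> C"
  shows "(\<lambda>\<alpha>. (cmod (meval (orthoP s \<alpha>) z))\<^sup>2) summable_on UNIV \<and>
      (\<Sum>\<^sub>\<infinity>\<alpha>. (cmod (meval (orthoP s \<alpha>) z))\<^sup>2) \<le> C
    \<longleftrightarrow> psd (\<lambda>\<alpha> \<beta>. complex_of_real C * s (\<alpha> + \<beta>) - mpower z \<alpha> * cnj (mpower z \<beta>))"
    (is "?summable \<and> ?sum \<le> C \<longleftrightarrow> ?psd")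
proof
  have lin: "meval (p + q) z = meval p z + meval q z" "meval (mconst c * p) z = c * meval p z" for p q :: "'d mpoly" and c
    by (rule meval_add meval_mconst_mult)+
  {
    assume *: "?summable \<and> ?sum \<le> C"
    have "(cmod (meval p z))\<^sup>2 \<le> C * Re (minner s p p)" for p
    proof -
      define N where "N = Max (insert 0 (mdeg ` Poly_Mapping.keys p))"
      have "p \<in> H.span (orthoP s ` {\<alpha>. mdeg \<alpha> \<le> N})"
        by (rule in_span_orthoP) (simp add: N_def)
      moreover have "(\<Sum>\<alpha> | mdeg \<alpha> \<le> N. (cmod (meval (orthoP s \<alpha>) z))\<^sup>2) \<le> ?sum"
        using * by (intro finite_sum_le_infsum finite_mdeg_le) auto
      then have "(\<Sum>\<alpha> | mdeg \<alpha> \<le> N. (cmod (meval (orthoP s \<alpha>) z))\<^sup>2) \<le> C"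
        using * by linarith
      ultimately show ?thesis
        by (intro H.sum_le_imp_bounded_functional[OF lin orthonormal_orthoP finite_mdeg_le])
    qed
    then show ?psd
      unfolding psd_eval_iff by blast
  next
    assume ?psd
    then have "(cmod (meval p z))\<^sup>2 \<le> C * Re (minner s p p)" for p
      unfolding psd_eval_iff by blast
    then have fin: "(\<Sum>\<alpha>\<in>F. (cmod (meval (orthoP s \<alpha>) z))\<^sup>2) \<le> C" if "finite F" for F
      by (intro H.bounded_functional_imp_sum_le[OF lin orthonormal_orthoP that C])
    then have ?summable
      by (intro nonneg_bdd_above_summable_on bdd_aboveI[of _ C]) auto
    then show "?summable \<and> ?sum \<le> C"
      using fin by (auto intro: infsum_le_finite_sums)
  }
qed

end

section \<open>The smallest eigenvalue of a Hermitian matrix\<close>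

definition sqnorm :: "'i set \<Rightarrow> ('i \<Rightarrow> complex) \<Rightarrow> real" where
  "sqnorm I v = (\<Sum>i\<in>I. (cmod (v i))\<^sup>2)"

lemma sqnorm_nonneg: "0 \<le> sqnorm I v"
  by (simp add: sqnorm_def sum_nonneg)

lemma sqnorm_eq_0_iff: "finite I \<Longrightarrow> sqnorm I v = 0 \<longleftrightarrow> (\<forall>i\<in>I. v i = 0)"
  by (simp add: sqnorm_def sum_nonneg_eq_0_iff)

lemma sqnorm_complex: "complex_of_real (sqnorm I v) = (\<Sum>i\<in>I. v i * cnj (v i))"
  by (simp add: sqnorm_def of_real_cmod_square)

lemma sqnorm_scale: "sqnorm I (\<lambda>i. c * v i) = (cmod c)\<^sup>2 * sqnorm I v"
  by (simp add: sqnorm_def norm_mult power_mult_distrib sum_distrib_left)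

lemma qform_scale: "qform A I (\<lambda>i. c * v i) = complex_of_real ((cmod c)\<^sup>2) * qform A I v"
  unfolding complex_norm_square by (simp add: qform_def sum_distrib_left mult_ac)

text \<open>Only values on I matter, but the functions live on the whole type; fixing them to 0
  elsewhere makes the sphere a closed subset of a product of discs and points, compact by
  Tychonoff.\<close>

lemma compact_unit_sphere:
  assumes "finite I"
  shows "compact {v :: 'i \<Rightarrow> complex. (\<forall>i. i \<notin> I \<longrightarrow> v i = 0) \<and> sqnorm I v = 1}" (is "compact ?S")
proof -
  let ?B = "\<lambda>i. if i \<in> I then cball (0::complex) 1 else {0}"
  have "compactin (product_topology (\<lambda>i. euclidean) UNIV) (PiE UNIV ?B)"
    by (subst compactin_PiE) auto
  then have "compact (PiE UNIV ?B)"
    by (simp add: euclidean_product_topology)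
  moreover have "closed {v :: 'i \<Rightarrow> complex. sqnorm I v = 1}"
    unfolding sqnorm_def
    by (intro closed_Collect_eq continuous_intros continuous_on_product_coordinates)
  ultimately have "compact (PiE UNIV ?B \<inter> {v. sqnorm I v = 1})"
    by (rule compact_Int_closed)
  moreover have "?S = PiE UNIV ?B \<inter> {v. sqnorm I v = 1}"
  proof -
    have "cmod (v i) \<le> 1" if "sqnorm I v = 1" "i \<in> I" for v :: "'i \<Rightarrow> complex" and i
    proof -
      have "(cmod (v i))\<^sup>2 \<le> sqnorm I v"
        unfolding sqnorm_def using assms that by (intro member_le_sum) auto
      with that show ?thesis
        by (simp add: power_le_one_iff abs_le_square_iff[of _ 1, simplified])
    qed
    then show ?thesis
      by (auto simp: PiE_UNIV_domain Pi_def split: if_splits)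
  qed
  ultimately show ?thesis by simp
qed

locale hermitian_matrix =
  fixes I :: "'i set" and A :: "'i \<Rightarrow> 'i \<Rightarrow> complex"
  assumes fin: "finite I" and ne: "I \<noteq> {}"
    and herm: "i \<in> I \<Longrightarrow> j \<in> I \<Longrightarrow> A j i = cnj (A i j)"
begin

text \<open>Conjugating v turns the convention of \<open>qform\<close> into the usual sum of
  cnj(v_i) A_ij v_j.\<close>

definition rayleigh :: "('i \<Rightarrow> complex) \<Rightarrow> real" where
  "rayleigh v = Re (qform A I (\<lambda>i. cnj (v i)))"

lemma rayleigh_eq: "rayleigh v = Re (\<Sum>i\<in>I. cnj (v i) * (\<Sum>j\<in>I. A i j * v j))"
  by (simp add: rayleigh_def qform_def sum_distrib_left mult_ac)

lemma rayleigh_scale: "rayleigh (\<lambda>i. c * v i) = (cmod c)\<^sup>2 * rayleigh v"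
  using qform_scale[of A I "cnj c" "\<lambda>i. cnj (v i)"] by (simp add: rayleigh_def)

lemma rayleigh_eigenvector:
  assumes "\<And>i. i \<in> I \<Longrightarrow> (\<Sum>j\<in>I. A i j * v j) = complex_of_real r * v i"
  shows "rayleigh v = r * sqnorm I v"
proof -
  have "(\<Sum>i\<in>I. cnj (v i) * (\<Sum>j\<in>I. A i j * v j)) = (\<Sum>i\<in>I. complex_of_real r * (v i * cnj (v i)))"
    using assms by (intro sum.cong) auto
  also have "\<dots> = complex_of_real r * complex_of_real (sqnorm I v)"
    by (simp only: sqnorm_complex sum_distrib_left)
  finally have "(\<Sum>i\<in>I. cnj (v i) * (\<Sum>j\<in>I. A i j * v j)) = complex_of_real r * complex_of_real (sqnorm I v)" .
  then show ?thesis
    by (simp add: rayleigh_eq)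
qed

lemma rayleigh_add_real:
  fixes \<tau> :: real
  shows "rayleigh (\<lambda>i. u i + complex_of_real \<tau> * w i)
    = rayleigh u + 2 * \<tau> * Re (\<Sum>i\<in>I. cnj (w i) * (\<Sum>j\<in>I. A i j * u j)) + \<tau>\<^sup>2 * rayleigh w"
proof -
  define X where "X = (\<Sum>i\<in>I. cnj (w i) * (\<Sum>j\<in>I. A i j * u j))"
  define Y where "Y = (\<Sum>i\<in>I. cnj (u i) * (\<Sum>j\<in>I. A i j * w j))"
  have "Y = (\<Sum>i\<in>I. \<Sum>j\<in>I. w j * cnj (A j i * u i))"
    unfolding Y_def sum_distrib_left
  proof (intro sum.cong refl)
    fix i j assume "i \<in> I" "j \<in> I"
    then show "cnj (u i) * (A i j * w j) = w j * cnj (A j i * u i)"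
      using herm[of j i] by simp
  qed
  also have "\<dots> = cnj X"
    unfolding X_def by (subst sum.swap) (simp add: sum_distrib_left)
  finally have "Re Y = Re X" by simp
  moreover have "rayleigh (\<lambda>i. u i + complex_of_real \<tau> * w i)
      = Re ((\<Sum>i\<in>I. cnj (u i) * (\<Sum>j\<in>I. A i j * u j)) + complex_of_real \<tau> * X + complex_of_real \<tau> * Y
        + complex_of_real (\<tau>\<^sup>2) * (\<Sum>i\<in>I. cnj (w i) * (\<Sum>j\<in>I. A i j * w j)))"
    unfolding rayleigh_eq X_def Y_def
    by (intro arg_cong[where f = Re])
       (simp add: sum.distrib sum_distrib_left algebra_simps power2_eq_square)
  ultimately show ?thesis
    by (simp add: rayleigh_eq X_def)
qed

lemma sqnorm_add_real:
  fixes \<tau> :: real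
  shows "sqnorm I (\<lambda>i. u i + complex_of_real \<tau> * w i)
    = sqnorm I u + 2 * \<tau> * Re (\<Sum>i\<in>I. cnj (w i) * u i) + \<tau>\<^sup>2 * sqnorm I w"
proof -
  have "(cmod (a + complex_of_real \<tau> * b))\<^sup>2 = (cmod a)\<^sup>2 + 2 * \<tau> * Re (cnj b * a) + \<tau>\<^sup>2 * (cmod b)\<^sup>2" for a b
    unfolding cmod_power2 by (simp add: power2_eq_square algebra_simps)
  then show ?thesis
    by (simp only: sqnorm_def sum.distrib sum_distrib_left Re_sum)
qed

lemma rayleigh_minimizer:
  obtains u m where "sqnorm I u = 1" "rayleigh u = m" "\<And>v. m * sqnorm I v \<le> rayleigh v"
proof -
  define S where "S = {v :: 'i \<Rightarrow> complex. (\<forall>i. i \<notin> I \<longrightarrow> v i = 0) \<and> sqnorm I v = 1}"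
  obtain k where k: "k \<in> I" using ne by auto
  have "(\<lambda>i. if i = k then 1 else 0) \<in> S"
    unfolding S_def
  proof (intro CollectI conjI allI impI)
    have "sqnorm I (\<lambda>i. if i = k then 1 else 0) = (\<Sum>i\<in>I. if i = k then 1 else 0)"
      unfolding sqnorm_def by (intro sum.cong) auto
    also have "\<dots> = 1"
      using k fin by simp
    finally show "sqnorm I (\<lambda>i. if i = k then 1 else 0) = 1" .
    show "(if i = k then 1 else 0) = (0 :: complex)" if "i \<notin> I" for i
      using k that by auto
  qed
  then have "S \<noteq> {}" by blast
  moreover have "continuous_on UNIV rayleigh"
    unfolding rayleigh_def[abs_def] qform_def
    by (intro continuous_intros continuous_on_product_coordinates)
  then have "continuous_on S rayleigh"
    by (rule continuous_on_subset) simp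
  ultimately obtain u where u: "u \<in> S" "\<And>v. v \<in> S \<Longrightarrow> rayleigh u \<le> rayleigh v"
    using continuous_attains_inf[of S rayleigh] compact_unit_sphere[OF fin] unfolding S_def[symmetric] by blast
  have "rayleigh u * sqnorm I v \<le> rayleigh v" for v
  proof (cases "sqnorm I v = 0")
    case True
    then have "rayleigh v = 0"
      using fin by (simp add: rayleigh_def qform_def sqnorm_eq_0_iff)
    with True show ?thesis by simp
  next
    case False
    then have pos: "sqnorm I v > 0"
      using sqnorm_nonneg[of I v] by simp
    define k where "k = complex_of_real (1 / sqrt (sqnorm I v))"
    have k2: "(cmod k)\<^sup>2 = 1 / sqnorm I v"
      using pos unfolding k_def norm_of_real by (simp add: power_divide)
    define w where "w = (\<lambda>i. k * v i)"
    define w' where "w' = (\<lambda>i. if i \<in> I then w i else 0)"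
    have eq: "sqnorm I w' = sqnorm I w" "rayleigh w' = rayleigh w"
      by (auto simp: sqnorm_def rayleigh_def w'_def intro!: sum.cong arg_cong[where f = Re] qform_cong)
    have "w' \<in> S"
      unfolding S_def mem_Collect_eq eq using pos by (simp add: w'_def) (simp add: w_def sqnorm_scale k2)
    from u(2)[OF this] have "rayleigh u \<le> rayleigh v / sqnorm I v"
      unfolding eq by (simp add: w_def rayleigh_scale k2)
    then show ?thesis
      using pos by (simp add: field_simps)
  qed
  moreover have "sqnorm I u = 1"
    using u(1) by (simp add: S_def)
  ultimately show ?thesis
    using that by blast
qed

text \<open>The perturbation is the residual w = A u - m u: in this direction the derivative of the
  Rayleigh form minus m times the squared norm is twice the squared norm of w, and it vanishes at a
  minimum.\<close>

lemma minimizer_is_eigenvector: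
  assumes u: "rayleigh u = m * sqnorm I u" and min: "\<And>v. m * sqnorm I v \<le> rayleigh v" and "i \<in> I"
  shows "(\<Sum>j\<in>I. A i j * u j) = complex_of_real m * u i"
proof -
  define w where "w i = (\<Sum>j\<in>I. A i j * u j) - complex_of_real m * u i" for i
  define b where "b = Re (\<Sum>i\<in>I. cnj (w i) * (\<Sum>j\<in>I. A i j * u j)) - m * Re (\<Sum>i\<in>I. cnj (w i) * u i)"
  have "b = Re (\<Sum>i\<in>I. cnj (w i) * ((\<Sum>j\<in>I. A i j * u j) - complex_of_real m * u i))"
  proof -
    have "(\<Sum>i\<in>I. cnj (w i) * ((\<Sum>j\<in>I. A i j * u j) - complex_of_real m * u i))
        = (\<Sum>i\<in>I. cnj (w i) * (\<Sum>j\<in>I. A i j * u j)) - complex_of_real m * (\<Sum>i\<in>I. cnj (w i) * u i)"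
      unfolding right_diff_distrib sum_subtractf by (simp add: sum_distrib_left mult_ac)
    then show ?thesis
      by (simp add: b_def)
  qed
  also have "(\<Sum>i\<in>I. cnj (w i) * ((\<Sum>j\<in>I. A i j * u j) - complex_of_real m * u i)) = complex_of_real (sqnorm I w)"
    unfolding sqnorm_complex w_def[symmetric] by (simp add: mult.commute)
  finally have b: "b = sqnorm I w" by simp
  have "0 \<le> 2 * \<tau> * b + \<tau>\<^sup>2 * (rayleigh w - m * sqnorm I w)" for \<tau> :: real
    using min[of "\<lambda>i. u i + complex_of_real \<tau> * w i"] u
    unfolding rayleigh_add_real sqnorm_add_real b_def by (simp add: algebra_simps)
  then have "b = 0"
    by (rule quadratic_nonneg_imp_linear_zero)
  then have "w i = 0"
    using b \<open>i \<in> I\<close> fin by (simp add: sqnorm_eq_0_iff)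
  then show ?thesis
    by (simp add: w_def)
qed

text \<open>
  Normalized eigenvectors of distinct eigenvalues are orthonormal, so by Bessel's inequality for the
  unit vectors there are at most \<open>card I\<close> of them.
\<close>

lemma finite_real_eigenvalues: "finite {r. is_eigenvalue I A (complex_of_real r)}" (is "finite ?E")
proof (rule finite_if_finite_subsets_card_bdd[of _ "card I", THEN conjunct1])
  fix F assume F: "F \<subseteq> ?E" "finite F"
  have "\<exists>v. sqnorm I v = 1 \<and> (\<forall>i\<in>I. (\<Sum>j\<in>I. A i j * v j) = complex_of_real r * v i)" if rF: "r \<in> F" for r
  proof -
    obtain v where v: "\<exists>i\<in>I. v i \<noteq> 0" "\<forall>i\<in>I. (\<Sum>j\<in>I. A i j * v j) = complex_of_real r * v i"
      using subsetD[OF F(1) rF] unfolding is_eigenvalue_def mem_Collect_eq by blast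
    have pos: "sqnorm I v > 0"
      using v(1) sqnorm_eq_0_iff[OF fin, of v] sqnorm_nonneg[of I v] by force
    define k where "k = complex_of_real (1 / sqrt (sqnorm I v))"
    have k2: "(cmod k)\<^sup>2 = 1 / sqnorm I v"
      using pos unfolding k_def norm_of_real by (simp add: power_divide)
    have "(\<Sum>j\<in>I. A i j * (k * v j)) = complex_of_real r * (k * v i)" if "i \<in> I" for i
    proof -
      have "(\<Sum>j\<in>I. A i j * (k * v j)) = k * (\<Sum>j\<in>I. A i j * v j)"
        by (simp add: sum_distrib_left mult_ac)
      with v(2) that show ?thesis by simp
    qed
    then show ?thesis
      using pos by (intro exI[of _ "\<lambda>i. k * v i"]) (auto simp: sqnorm_scale k2)
  qed
  then obtain v where v: "\<And>r. r \<in> F \<Longrightarrow> sqnorm I (v r) = 1"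
    "\<And>r i. r \<in> F \<Longrightarrow> i \<in> I \<Longrightarrow> (\<Sum>j\<in>I. A i j * v r j) = complex_of_real r * v r i"
    by metis
  have orth: "(\<Sum>i\<in>I. v r i * cnj (v q i)) = (if r = q then 1 else 0)" if rq: "r \<in> F" "q \<in> F" for r q
  proof (cases "r = q")
    case True
    then show ?thesis
      using v(1)[OF rq(1)] sqnorm_complex[of I "v r"] by simp
  next
    case False
    have "complex_of_real r * (\<Sum>i\<in>I. v r i * cnj (v q i)) = (\<Sum>i\<in>I. (\<Sum>j\<in>I. A i j * v r j) * cnj (v q i))"
      using v(2)[OF rq(1)] by (simp add: sum_distrib_left mult_ac)
    also have "\<dots> = (\<Sum>j\<in>I. \<Sum>i\<in>I. v r j * (A i j * cnj (v q i)))"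
      unfolding sum_distrib_right by (subst sum.swap) (simp only: mult_ac)
    also have "\<dots> = (\<Sum>j\<in>I. v r j * cnj (\<Sum>i\<in>I. A j i * v q i))"
      unfolding sum_distrib_left cnj_sum
    proof (intro sum.cong refl)
      fix i j assume "j \<in> I" "i \<in> I"
      then show "v r j * (A i j * cnj (v q i)) = v r j * cnj (A j i * v q i)"
        using herm[of j i] by simp
    qed
    also have "\<dots> = complex_of_real q * (\<Sum>i\<in>I. v r i * cnj (v q i))"
      using v(2)[OF rq(2)] by (simp add: sum_distrib_left mult_ac)
    finally show ?thesis
      using False by simp
  qed
  have bessel: "(\<Sum>r\<in>F. (cmod (v r i))\<^sup>2) \<le> 1" if i: "i \<in> I" for i
  proof -
    define T where "T = (\<Sum>r\<in>F. (cmod (v r i))\<^sup>2)"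
    have Tc: "complex_of_real T = (\<Sum>r\<in>F. cnj (v r i) * v r i)"
      by (simp add: T_def of_real_cmod_square mult.commute)
    \<comment> \<open>The projection of the i-th unit vector to the span of the family: its squared
      norm and its i-th entry are both T, so T^2 \<le> T.\<close>
    define y where "y j = (\<Sum>r\<in>F. cnj (v r i) * v r j)" for j
    have "complex_of_real (sqnorm I y) = (\<Sum>j\<in>I. \<Sum>r\<in>F. \<Sum>q\<in>F. cnj (v r i) * v q i * (v r j * cnj (v q j)))"
      unfolding sqnorm_complex y_def by (simp add: sum_product mult_ac)
    also have "\<dots> = (\<Sum>r\<in>F. \<Sum>q\<in>F. cnj (v r i) * v q i * (\<Sum>j\<in>I. v r j * cnj (v q j)))"
      by (subst sum.swap, rule sum.cong[OF refl], subst sum.swap) (simp add: sum_distrib_left)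
    also have "\<dots> = (\<Sum>r\<in>F. \<Sum>q\<in>F. if r = q then cnj (v r i) * v r i else 0)"
      by (intro sum.cong refl) (simp add: orth)
    also have "\<dots> = complex_of_real T"
      using F(2) by (simp add: Tc)
    finally have "sqnorm I y = T"
      by (simp only: of_real_eq_iff)
    moreover have "(cmod (y i))\<^sup>2 \<le> sqnorm I y"
      unfolding sqnorm_def using i fin by (intro member_le_sum) auto
    moreover have "y i = complex_of_real T"
      by (simp only: y_def Tc)
    moreover have "0 \<le> T"
      by (simp add: T_def sum_nonneg)
    ultimately have "T * T \<le> T * 1"
      by (simp add: power2_eq_square)
    then show ?thesis
      using \<open>0 \<le> T\<close> unfolding T_def[symmetric] by (cases "T = 0") (auto simp: mult_le_cancel_left)
  qed
  have "real (card F) = (\<Sum>r\<in>F. sqnorm I (v r))"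
    by (simp add: v(1))
  also have "\<dots> = (\<Sum>i\<in>I. \<Sum>r\<in>F. (cmod (v r i))\<^sup>2)"
    unfolding sqnorm_def by (rule sum.swap)
  also have "\<dots> \<le> (\<Sum>i\<in>I. 1)"
    by (intro sum_mono bessel)
  finally show "card F \<le> card I" by simp
qed

text \<open>The minimum of the Rayleigh quotient is attained at an eigenvector and bounds every real
  eigenvalue from below; finiteness of the set of eigenvalues makes \<open>Min\<close> return
  it.\<close>

lemma le_smallest_eigenvalue_iff:
  "c \<le> smallest_eigenvalue I A \<longleftrightarrow> (\<forall>v. c * sqnorm I v \<le> Re (qform A I v))"
proof -
  let ?E = "{r. is_eigenvalue I A (complex_of_real r)}"
  obtain u m where um: "sqnorm I u = 1" "rayleigh u = m" "\<And>v. m * sqnorm I v \<le> rayleigh v"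
    using rayleigh_minimizer by blast
  have "\<exists>i\<in>I. u i \<noteq> 0"
    using um(1) sqnorm_eq_0_iff[OF fin, of u] by auto
  then have "m \<in> ?E"
    using minimizer_is_eigenvector[OF _ um(3), of u] um(1,2) by (auto simp: is_eigenvalue_def)
  moreover have "m \<le> r" if "r \<in> ?E" for r
  proof -
    obtain v where v: "\<exists>i\<in>I. v i \<noteq> 0" "\<forall>i\<in>I. (\<Sum>j\<in>I. A i j * v j) = complex_of_real r * v i"
      using \<open>r \<in> ?E\<close> by (auto simp: is_eigenvalue_def)
    have "sqnorm I v > 0"
      using v(1) sqnorm_eq_0_iff[OF fin, of v] sqnorm_nonneg[of I v] by force
    moreover have "m * sqnorm I v \<le> r * sqnorm I v"
      using um(3)[of v] rayleigh_eigenvector[of v r] v(2) by simp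
    ultimately show ?thesis by simp
  qed
  ultimately have m: "smallest_eigenvalue I A = m"
    unfolding smallest_eigenvalue_def by (intro Min_eqI finite_real_eigenvalues) auto
  show ?thesis
  proof
    assume c: "c \<le> smallest_eigenvalue I A"
    show "\<forall>v. c * sqnorm I v \<le> Re (qform A I v)"
    proof
      fix v
      have "c * sqnorm I v \<le> m * sqnorm I v"
        using c m by (simp add: mult_right_mono sqnorm_nonneg)
      also have "\<dots> \<le> Re (qform A I v)"
        using um(3)[of "\<lambda>i. cnj (v i)"] by (simp add: rayleigh_def sqnorm_def)
      finally show "c * sqnorm I v \<le> Re (qform A I v)" .
    qed
  next
    assume *: "\<forall>v. c * sqnorm I v \<le> Re (qform A I v)"
    have "c * sqnorm I (\<lambda>i. cnj (u i)) \<le> rayleigh u"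
      using * unfolding rayleigh_def by blast
    then show "c \<le> smallest_eigenvalue I A"
      using um(1,2) m by (simp add: sqnorm_def)
  qed
qed

end

section \<open>The limit of the smallest eigenvalues\<close>

lemma mdeg_add: "mdeg (\<alpha> + \<beta>) = mdeg \<alpha> + mdeg \<beta>"
  by (simp add: mdeg_def lookup_add sum.distrib)

context pd_multisequence
begin

lemma psd_Hmat:
  assumes "R > 0"
  shows "psd (Hmat s R)"
proof -
  have "psd (\<lambda>\<alpha> \<beta>. (1 / complex_of_real (R ^ mdeg \<alpha>)) * cnj (1 / complex_of_real (R ^ mdeg \<beta>)) * s (\<alpha> + \<beta>))"
    by (rule psd_mult[OF psd_outer psd_moment_kernel])
  then show ?thesis
    by (simp add: Hmat_def[abs_def] mdeg_add power_add)
qed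

lemma hermitian_matrix_Hmat: "hermitian_matrix {\<alpha>. mdeg \<alpha> \<le> N} (Hmat s R)"
proof
  show "{\<alpha> :: 'd mindex. mdeg \<alpha> \<le> N} \<noteq> {}"
    by (auto intro!: exI[of _ 0] simp: mdeg_def)
  show "Hmat s R \<beta> \<alpha> = cnj (Hmat s R \<alpha> \<beta>)" for \<alpha> \<beta>
    unfolding Hmat_def by (subst (1 2) s_real) (simp add: add.commute)
qed (rule finite_mdeg_le)

text \<open>\<gamma>_R \<ge> c says that every truncation dominates c times the identity, a
  statement about finite sections without a limit; rescaling by the diagonal R^|\<alpha>| turns
  \<open>Hmat\<close> into the moment kernel.\<close>

lemma gamma_R_pos_iff:
  assumes R: "R > 0"
  shows "gamma_R s R > 0 \<longleftrightarrow>
    (\<exists>c>0. psd (\<lambda>\<alpha> \<beta>. s (\<alpha> + \<beta>) - (if \<alpha> = \<beta> then complex_of_real (c * R ^ (2 * mdeg \<alpha>)) else 0)))"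
proof -
  let ?I = "\<lambda>N. {\<alpha> :: 'd mindex. mdeg \<alpha> \<le> N}"
  have le_iff: "c \<le> lambda_RN s R N \<longleftrightarrow> (\<forall>v. c * sqnorm (?I N) v \<le> Re (qform (Hmat s R) (?I N) v))" for c N
    unfolding lambda_RN_def by (rule hermitian_matrix.le_smallest_eigenvalue_iff[OF hermitian_matrix_Hmat])
  \<comment> \<open>Extension by zero: a bound for a truncation holds on every smaller index set.
    This gives both the monotonicity in N and the passage to arbitrary finite sets.\<close>
  have ext: "c * sqnorm S v \<le> Re (qform (Hmat s R) S v)" if c: "c \<le> lambda_RN s R N" and S: "S \<subseteq> ?I N" for c N S v
  proof -
    define w where "w = (\<lambda>\<alpha>. if \<alpha> \<in> S then v \<alpha> else 0)"
    have "qform (Hmat s R) S v = qform (Hmat s R) S w"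
      by (rule qform_cong) (auto simp: w_def)
    also have "\<dots> = qform (Hmat s R) (?I N) w"
      by (rule qform_mono_support) (use S finite_mdeg_le in \<open>auto simp: w_def\<close>)
    finally have "qform (Hmat s R) S v = qform (Hmat s R) (?I N) w" .
    moreover have "sqnorm S v = sqnorm (?I N) w"
      unfolding sqnorm_def using S
      by (intro sum.mono_neutral_cong_left finite_mdeg_le) (auto simp: w_def)
    ultimately show ?thesis
      using c le_iff by simp
  qed
  have dec: "decseq (lambda_RN s R)"
  proof (rule decseq_SucI)
    fix N
    show "lambda_RN s R (Suc N) \<le> lambda_RN s R N"
      by (subst le_iff, intro allI ext[of _ "Suc N"]) auto
  qed
  have nonneg: "0 \<le> lambda_RN s R N" for N
    unfolding le_iff using psdD[OF psd_Hmat[OF R] finite_mdeg_le, of N]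
    by (simp add: less_eq_complex_def)
  obtain L where "lambda_RN s R \<longlonglongrightarrow> L"
    using decseq_convergent[OF dec, of 0] nonneg by blast
  then have lim: "lambda_RN s R \<longlonglongrightarrow> gamma_R s R"
    using limI[of "lambda_RN s R" L] by (simp add: gamma_R_def)
  have H: "gamma_R s R > 0 \<longleftrightarrow> (\<exists>c>0. psd (\<lambda>\<alpha> \<beta>. Hmat s R \<alpha> \<beta> - (if \<alpha> = \<beta> then complex_of_real c else 0)))"
  proof
    assume g: "gamma_R s R > 0"
    have "psd (\<lambda>\<alpha> \<beta>. Hmat s R \<alpha> \<beta> - (if \<alpha> = \<beta> then complex_of_real (gamma_R s R) else 0))"
    proof (rule psdI)
      fix S :: "'d mindex set" and v assume S: "finite S"
      define N where "N = Max (insert 0 (mdeg ` S))"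
      have "S \<subseteq> ?I N"
        using S by (auto simp: N_def)
      moreover have "gamma_R s R \<le> lambda_RN s R N"
        by (rule decseq_ge[OF dec lim])
      ultimately have "gamma_R s R * sqnorm S v \<le> Re (qform (Hmat s R) S v)"
        by (intro ext)
      moreover have "qform (\<lambda>\<alpha> \<beta>. if \<alpha> = \<beta> then complex_of_real (gamma_R s R) else 0) S v
          = complex_of_real (gamma_R s R * sqnorm S v)"
        by (subst qform_diag[OF S]) (simp add: sqnorm_def sum_distrib_left mult.commute)
      moreover have "Im (qform (Hmat s R) S v) = 0"
        using psdD[OF psd_Hmat[OF R] S, of v] by (simp add: less_eq_complex_def)
      ultimately show "0 \<le> qform (\<lambda>\<alpha> \<beta>. Hmat s R \<alpha> \<beta> - (if \<alpha> = \<beta> then complex_of_real (gamma_R s R) else 0)) S v"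
        by (simp add: qform_diff less_eq_complex_def)
    qed
    with g show "\<exists>c>0. psd (\<lambda>\<alpha> \<beta>. Hmat s R \<alpha> \<beta> - (if \<alpha> = \<beta> then complex_of_real c else 0))"
      by blast
  next
    assume "\<exists>c>0. psd (\<lambda>\<alpha> \<beta>. Hmat s R \<alpha> \<beta> - (if \<alpha> = \<beta> then complex_of_real c else 0))"
    then obtain c where c: "c > 0" "psd (\<lambda>\<alpha> \<beta>. Hmat s R \<alpha> \<beta> - (if \<alpha> = \<beta> then complex_of_real c else 0))"
      by blast
    have "c \<le> lambda_RN s R N" for N
      unfolding le_iff
    proof
      fix v
      have "qform (\<lambda>\<alpha> \<beta>. if \<alpha> = \<beta> then complex_of_real c else 0) (?I N) v
          = complex_of_real (c * sqnorm (?I N) v)"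
        by (subst qform_diag[OF finite_mdeg_le]) (simp add: sqnorm_def sum_distrib_left mult.commute)
      then show "c * sqnorm (?I N) v \<le> Re (qform (Hmat s R) (?I N) v)"
        using psdD[OF c(2) finite_mdeg_le, of N v] by (simp add: qform_diff less_eq_complex_def)
    qed
    then have "c \<le> gamma_R s R"
      by (intro LIMSEQ_le_const[OF lim]) auto
    with c(1) show "gamma_R s R > 0" by simp
  qed
  have "psd (\<lambda>\<alpha> \<beta>. Hmat s R \<alpha> \<beta> - (if \<alpha> = \<beta> then complex_of_real c else 0)) \<longleftrightarrow>
      psd (\<lambda>\<alpha> \<beta>. s (\<alpha> + \<beta>) - (if \<alpha> = \<beta> then complex_of_real (c * R ^ (2 * mdeg \<alpha>)) else 0))" (is "psd ?K \<longleftrightarrow> psd ?K'") for c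
  proof
    let ?f = "\<lambda>\<alpha>. complex_of_real (R ^ mdeg \<alpha>)"
    assume "psd ?K"
    then have "psd (\<lambda>\<alpha> \<beta>. ?f \<alpha> * cnj (?f \<beta>) * ?K \<alpha> \<beta>)"
      by (rule psd_mult[OF psd_outer])
    moreover have "?f \<alpha> * cnj (?f \<beta>) * ?K \<alpha> \<beta> = ?K' \<alpha> \<beta>" for \<alpha> \<beta>
      using R by (auto simp: Hmat_def mdeg_add power_add mult_2 right_diff_distrib)
    ultimately show "psd ?K'" by simp
  next
    let ?f = "\<lambda>\<alpha>. complex_of_real (1 / R ^ mdeg \<alpha>)"
    assume "psd ?K'"
    then have "psd (\<lambda>\<alpha> \<beta>. ?f \<alpha> * cnj (?f \<beta>) * ?K' \<alpha> \<beta>)"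
      by (rule psd_mult[OF psd_outer])
    moreover have "?f \<alpha> * cnj (?f \<beta>) * ?K' \<alpha> \<beta> = ?K \<alpha> \<beta>" for \<alpha> \<beta>
      using R by (auto simp: Hmat_def mdeg_add power_add mult_2 right_diff_distrib)
    ultimately show "psd ?K" by simp
  qed
  with H show ?thesis by simp
qed

end

section \<open>Product multisequences\<close>

lemma mpower_single: "mpower z (Poly_Mapping.single i n) = (z $ i) ^ n"
proof -
  have "mpower z (Poly_Mapping.single i n) = (\<Prod>j\<in>UNIV. if j = i then (z $ i) ^ n else 1)"
    unfolding mpower_def by (intro prod.cong) (auto simp: lookup_single when_def)
  then show ?thesis by simp
qed

lemma inj_single: "inj (Poly_Mapping.single i :: nat \<Rightarrow> _)"
  by (rule injI) (metis lookup_single_eq)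

lemma qform_reindex:
  assumes "inj_on f S"
  shows "qform K (f ` S) v = qform (\<lambda>a b. K (f a) (f b)) S (\<lambda>a. v (f a))"
  using assms by (simp add: qform_def sum.reindex)

text \<open>The real part loses nothing for a positive definite multisequence, by
  \<open>s_real\<close>.\<close>

definition marginal :: "('d mindex \<Rightarrow> complex) \<Rightarrow> 'd \<Rightarrow> nat \<Rightarrow> real" where
  "marginal s i n = Re (s (Poly_Mapping.single i n))"

definition marginal_evals_bounded :: "('d mindex \<Rightarrow> complex) \<Rightarrow> bool" where
  "marginal_evals_bounded s \<longleftrightarrow> (\<forall>i R. \<exists>M. \<forall>z. cmod z \<le> R \<longrightarrow> eval_bounded (marginal s i) z M)"

locale pd_product_multisequence = pd_multisequence s
  for s :: "'d::{finite,linorder} mindex \<Rightarrow> complex" +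
  assumes s_prod: "s \<alpha> = (\<Prod>i\<in>UNIV. s (Poly_Mapping.single i (Poly_Mapping.lookup \<alpha> i)))"
begin

lemma s_single: "s (Poly_Mapping.single i n) = complex_of_real (marginal s i n)"
  unfolding marginal_def by (rule s_real)

lemma s_marginals: "s \<alpha> = (\<Prod>i\<in>UNIV. complex_of_real (marginal s i (Poly_Mapping.lookup \<alpha> i)))"
  by (subst s_prod) (simp add: s_single)

lemma pd_moments_marginal: "pd_moments (marginal s i)"
proof
  fix p :: "complex poly" assume p: "p \<noteq> 0"
  let ?f = "Poly_Mapping.single i :: nat \<Rightarrow> _"
  define q where "q = (\<Sum>n\<le>degree p. Poly_Mapping.single (?f n) (poly.coeff p n))"
  have q: "Poly_Mapping.lookup q (?f n) = poly.coeff p n" if "n \<le> degree p" for n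
  proof -
    have "Poly_Mapping.lookup q (?f n) = (\<Sum>k\<le>degree p. if k = n then poly.coeff p k else 0)"
      unfolding q_def lookup_sum using inj_single[of i]
      by (intro sum.cong) (auto simp: lookup_single when_def inj_eq)
    with that show ?thesis by simp
  qed
  then have "Poly_Mapping.lookup q (?f (degree p)) \<noteq> 0"
    using p by simp
  then have "q \<noteq> 0" by auto
  have keys: "Poly_Mapping.keys q \<subseteq> ?f ` {..degree p}"
    unfolding q_def by (rule order.trans[OF keys_sum]) auto
  have "minner s q q = qform (moment_kernel s) (?f ` {..degree p}) (Poly_Mapping.lookup q)"
    by (rule qform_moment_kernel[symmetric]) (use keys in auto)
  also have "\<dots> = qform (\<lambda>a b. s (?f a + ?f b)) {..degree p} (\<lambda>a. Poly_Mapping.lookup q (?f a))"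
    by (rule qform_reindex) (rule inj_on_subset[OF inj_single], simp)
  also have "\<dots> = qform (\<lambda>a b. complex_of_real (marginal s i (a + b))) {..degree p} (poly.coeff p)"
    by (rule qform_cong) (simp_all add: q s_single flip: single_add)
  also have "\<dots> = uip (marginal s i) p p"
    by (rule qform_moments)
  finally show "0 < Re (uip (marginal s i) p p)"
    using minner_pos[OF \<open>q \<noteq> 0\<close>] by simp
next
  show "marginal s i 0 = 1"
    using s0 by (simp add: marginal_def)
qed

text \<open>Used with F i the evaluation kernel at z_i and with F i the diagonal kernel R^(2a)
  \<delta>; in both cases the bounds of the marginals multiply.\<close>

lemma psd_tensor:
  assumes "\<And>i. psd (F i)"
    and "\<And>i. psd (\<lambda>a b. complex_of_real (M i) * complex_of_real (marginal s i (a + b)) - F i a b)"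
  shows "psd (\<lambda>\<alpha> \<beta>. complex_of_real (\<Prod>i\<in>UNIV. M i) * s (\<alpha> + \<beta>)
    - (\<Prod>i\<in>UNIV. F i (Poly_Mapping.lookup \<alpha> i) (Poly_Mapping.lookup \<beta> i)))"
proof -
  let ?G = "\<lambda>i a b. complex_of_real (M i) * complex_of_real (marginal s i (a + b))"
  have "psd (\<lambda>\<alpha> \<beta>. (\<Prod>i\<in>UNIV. ?G i (Poly_Mapping.lookup \<alpha> i) (Poly_Mapping.lookup \<beta> i))
      - (\<Prod>i\<in>UNIV. F i (Poly_Mapping.lookup \<alpha> i) (Poly_Mapping.lookup \<beta> i)))"
    by (intro psd_prod_mono finite psd_pullback[OF assms(1)] psd_pullback[OF assms(2)])
  then show ?thesis
    by (subst s_marginals) (simp add: prod.distrib lookup_add)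
qed

section \<open>From the multisequence to its marginals\<close>

lemma marginal_evals_bounded_of_gamma:
  assumes "gamma_R s 1 > 0"
  shows "marginal_evals_bounded s"
  unfolding marginal_evals_bounded_def
proof (intro allI)
  fix i and R :: real
  interpret T: pd_moments "marginal s i" by (rule pd_moments_marginal)
  let ?f = "Poly_Mapping.single i :: nat \<Rightarrow> _"
  from assms obtain c where c: "c > 0" "psd (\<lambda>\<alpha> \<beta>. s (\<alpha> + \<beta>) - (if \<alpha> = \<beta> then complex_of_real c else 0))"
    unfolding gamma_R_pos_iff[OF zero_less_one] power_one mult_1_right by blast
  have "psd (\<lambda>a b. s (?f a + ?f b) - (if ?f a = ?f b then complex_of_real c else 0))"
    by (rule psd_pullback[OF c(2)])
  then have psd: "psd (\<lambda>a b. complex_of_real (marginal s i (a + b)) - (if a = b then complex_of_real c else 0))"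
    by (simp add: inj_eq[OF inj_single] s_single flip: single_add)
  have "c * (\<Sum>n\<le>degree q. (cmod (poly.coeff q n))\<^sup>2) \<le> Re (uip (marginal s i) q q)" for q
  proof -
    have "0 \<le> qform (\<lambda>a b. complex_of_real (marginal s i (a + b)) - (if a = b then complex_of_real c else 0))
        {..degree q} (poly.coeff q)"
      by (rule psdD[OF psd]) simp
    then have "0 \<le> uip (marginal s i) q q - (\<Sum>n\<le>degree q. complex_of_real ((cmod (poly.coeff q n))\<^sup>2) * complex_of_real c)"
      by (simp only: qform_diff qform_moments qform_diag[OF finite_atMost])
    then show ?thesis
      by (simp add: less_eq_complex_def sum_distrib_left mult.commute flip: of_real_mult of_real_power)
  qed
  \<comment> \<open>The point i/2 is nonreal and lies in the open unit disc.\<close>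
  then have "eval_bounded (marginal s i) (\<i> / 2) (1 / (c * (1 - (cmod (\<i> / 2))\<^sup>2)))"
    by (intro T.coeffs_bounded_imp_eval_bounded c) (simp_all add: norm_divide)
  then show "\<exists>M. \<forall>z. cmod z \<le> R \<longrightarrow> eval_bounded (marginal s i) z M"
    by (rule T.eval_bounded_locally_uniform) simp
qed

text \<open>On multi-indices supported at i, evaluation at z becomes evaluation at z_i. With every
  coordinate nonreal, each marginal receives a nonreal point.\<close>

lemma marginal_evals_bounded_of_Pseries_finite:
  assumes "Pseries_finite_at_some_nonreal s"
  shows "marginal_evals_bounded s"
  unfolding marginal_evals_bounded_def
proof (intro allI)
  fix i and R :: real
  interpret T: pd_moments "marginal s i" by (rule pd_moments_marginal)
  let ?f = "Poly_Mapping.single i :: nat \<Rightarrow> _"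
  obtain z where z: "\<And>i. z $ i \<notin> \<real>" "(\<lambda>\<alpha>. (cmod (meval (orthoP s \<alpha>) z))\<^sup>2) summable_on UNIV"
    using assms by (auto simp: Pseries_finite_at_some_nonreal_def)
  define C where "C = (\<Sum>\<^sub>\<infinity>\<alpha>. (cmod (meval (orthoP s \<alpha>) z))\<^sup>2)"
  have "0 \<le> C"
    unfolding C_def by (rule infsum_nonneg) simp
  then have "psd (\<lambda>\<alpha> \<beta>. complex_of_real C * s (\<alpha> + \<beta>) - mpower z \<alpha> * cnj (mpower z \<beta>))"
    using Pseries_le_iff[of C z] z(2) by (simp add: C_def)
  from psd_pullback[OF this, of ?f]
  have "psd (\<lambda>a b. complex_of_real C * complex_of_real (marginal s i (a + b)) - (z $ i) ^ a * cnj ((z $ i) ^ b))"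
    by (simp add: s_single mpower_single flip: single_add)
  then have "eval_bounded (marginal s i) (z $ i) C"
    by (simp add: T.eval_bounded_iff_psd)
  moreover have "Im (z $ i) \<noteq> 0"
    using z(1)[of i] complex_is_Real_iff by blast
  ultimately show "\<exists>M. \<forall>z. cmod z \<le> R \<longrightarrow> eval_bounded (marginal s i) z M"
    by (rule T.eval_bounded_locally_uniform)
qed

lemma marginal_evals_boundedE:
  assumes "marginal_evals_bounded s" "0 \<le> R"
  obtains M where "\<And>i z. cmod z \<le> R \<Longrightarrow> eval_bounded (marginal s i) z (M i)" "\<And>i. 1 \<le> M i"
proof -
  have "\<forall>i. \<exists>M. \<forall>z. cmod z \<le> R \<longrightarrow> eval_bounded (marginal s i) z M"
    using assms(1) unfolding marginal_evals_bounded_def by blast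
  from choice[OF this] obtain M where M: "\<And>i z. cmod z \<le> R \<Longrightarrow> eval_bounded (marginal s i) z (M i)"
    by blast
  moreover have "1 \<le> M i" for i
    using pd_moments.eval_bounded_ge_1[OF pd_moments_marginal M[of 0]] assms(2) by simp
  ultimately show ?thesis
    by (rule that)
qed

section \<open>From the marginals back to the multisequence\<close>

lemma Pseries_bounded_of_marginal_evals:
  assumes "marginal_evals_bounded s"
  shows "Pseries_bounded_on_compacts s"
  unfolding Pseries_bounded_on_compacts_def
proof (intro allI impI)
  fix K :: "(complex, 'd) vec set" assume "compact K"
  from compact_imp_bounded[OF this] obtain R where R: "\<And>z. z \<in> K \<Longrightarrow> norm z \<le> R"
    unfolding bounded_iff by blast
  \<comment> \<open>The maximum with 0 covers an empty K, for which R may be negative.\<close>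
  obtain M where M: "\<And>i z. cmod z \<le> max R 0 \<Longrightarrow> eval_bounded (marginal s i) z (M i)" "\<And>i. 1 \<le> M i"
    by (rule marginal_evals_boundedE[OF assms max.cobounded2[where a = R and b = 0]]) blast
  define C where "C = (\<Prod>i\<in>UNIV. M i)"
  have C: "0 \<le> C"
    unfolding C_def by (intro prod_nonneg order_trans[OF zero_le_one M(2)])
  have "psd (\<lambda>\<alpha> \<beta>. complex_of_real C * s (\<alpha> + \<beta>) - mpower z \<alpha> * cnj (mpower z \<beta>))" if "z \<in> K" for z
  proof -
    have "psd (\<lambda>\<alpha> \<beta>. complex_of_real C * s (\<alpha> + \<beta>)
        - (\<Prod>i\<in>UNIV. (z $ i) ^ Poly_Mapping.lookup \<alpha> i * cnj ((z $ i) ^ Poly_Mapping.lookup \<beta> i)))"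
      unfolding C_def
    proof (rule psd_tensor)
      fix i
      show "psd (\<lambda>a b. (z $ i) ^ a * cnj ((z $ i) ^ b))"
        by (rule psd_outer)
      have "cmod (z $ i) \<le> max R 0"
        using R[OF that] Finite_Cartesian_Product.norm_nth_le[of z i] by linarith
      then show "psd (\<lambda>a b. complex_of_real (M i) * complex_of_real (marginal s i (a + b)) - (z $ i) ^ a * cnj ((z $ i) ^ b))"
        using M(1) pd_moments.eval_bounded_iff_psd[OF pd_moments_marginal] by blast
    qed
    then show ?thesis
      by (simp add: mpower_def prod.distrib)
  qed
  then show "\<exists>M. \<forall>z\<in>K. (\<lambda>\<alpha>. (cmod (meval (orthoP s \<alpha>) z))\<^sup>2) summable_on UNIV \<and>
      (\<Sum>\<^sub>\<infinity>\<alpha>. (cmod (meval (orthoP s \<alpha>) z))\<^sup>2) \<le> M"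
    using Pseries_le_iff[OF C] by blast
qed

lemma gamma_pos_of_marginal_evals:
  assumes "marginal_evals_bounded s" "R > 0"
  shows "gamma_R s R > 0"
proof -
  obtain M where M: "\<And>i z. cmod z \<le> R \<Longrightarrow> eval_bounded (marginal s i) z (M i)" "\<And>i. 1 \<le> M i"
    by (rule marginal_evals_boundedE[OF assms(1) less_imp_le[OF assms(2)]]) blast
  define C where "C = (\<Prod>i\<in>UNIV. M i)"
  have C: "0 < C"
    unfolding C_def by (intro prod_pos less_le_trans[OF zero_less_one M(2)])
  \<comment> \<open>The diagonal kernel factors over the variables: \<alpha> = \<beta> holds
    coordinatewise, and R^(2|\<alpha>|) is the product of the R^(2 \<alpha>_i).\<close>
  let ?F = "\<lambda>a b. if a = b then complex_of_real (R ^ (2 * a)) else 0"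
  have "psd (\<lambda>\<alpha> \<beta>. complex_of_real C * s (\<alpha> + \<beta>)
      - (\<Prod>i\<in>UNIV. ?F (Poly_Mapping.lookup \<alpha> i) (Poly_Mapping.lookup \<beta> i)))"
    unfolding C_def
  proof (rule psd_tensor)
    fix i
    interpret T: pd_moments "marginal s i" by (rule pd_moments_marginal)
    show "psd ?F"
      using assms(2) by (intro psd_diag) (simp add: less_eq_complex_def)
    show "psd (\<lambda>a b. complex_of_real (M i) * complex_of_real (marginal s i (a + b)) - ?F a b)"
      unfolding psd_nat_iff
    proof
      fix p :: "complex poly"
      have "(\<Sum>n\<le>degree p. (cmod (poly.coeff p n))\<^sup>2 * R ^ (2 * n)) \<le> M i * Re (uip (marginal s i) p p)"
        by (rule T.eval_bounded_circle_imp_coeffs_bounded) (use M assms in auto)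
      moreover have "qform (\<lambda>a b. complex_of_real (M i) * complex_of_real (marginal s i (a + b)) - ?F a b)
          {..degree p} (poly.coeff p)
        = complex_of_real (M i) * uip (marginal s i) p p
          - (\<Sum>n\<le>degree p. complex_of_real ((cmod (poly.coeff p n))\<^sup>2) * complex_of_real (R ^ (2 * n)))"
        by (simp only: qform_diff qform_cmult qform_moments qform_diag[OF finite_atMost])
      moreover have "\<dots> = complex_of_real (M i * Re (uip (marginal s i) p p)
          - (\<Sum>n\<le>degree p. (cmod (poly.coeff p n))\<^sup>2 * R ^ (2 * n)))"
        by (subst T.H.ip_self) simp
      ultimately show "0 \<le> qform (\<lambda>a b. complex_of_real (M i) * complex_of_real (marginal s i (a + b)) - ?F a b)
          {..degree p} (poly.coeff p)"
        by (simp only: less_eq_complex_def) simp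
    qed
  qed
  moreover have "(\<Prod>i\<in>UNIV. ?F (Poly_Mapping.lookup \<alpha> i) (Poly_Mapping.lookup \<beta> i))
      = (if \<alpha> = \<beta> then complex_of_real (R ^ (2 * mdeg \<alpha>)) else 0)" for \<alpha> \<beta> :: "'d mindex"
  proof (cases "\<alpha> = \<beta>")
    case True
    then show ?thesis
      by (simp add: mdeg_def sum_distrib_left power_sum)
  next
    case False
    then obtain i where "Poly_Mapping.lookup \<alpha> i \<noteq> Poly_Mapping.lookup \<beta> i"
      by (metis poly_mapping_eqI)
    then have "(\<Prod>i\<in>UNIV. ?F (Poly_Mapping.lookup \<alpha> i) (Poly_Mapping.lookup \<beta> i)) = 0"
      by (intro prod_zero) auto
    with False show ?thesis by simp
  qed
  ultimately have "psd (\<lambda>\<alpha> \<beta>. complex_of_real C * s (\<alpha> + \<beta>)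
      - (if \<alpha> = \<beta> then complex_of_real (R ^ (2 * mdeg \<alpha>)) else 0))"
    by simp
  \<comment> \<open>Division by C gives the constant c = 1 / C asked for by
    \<open>gamma_R_pos_iff\<close>.\<close>
  then have "psd (\<lambda>\<alpha> \<beta>. complex_of_real (1 / C) * (complex_of_real C * s (\<alpha> + \<beta>)
      - (if \<alpha> = \<beta> then complex_of_real (R ^ (2 * mdeg \<alpha>)) else 0)))"
    using C by (intro psd_cmult) (auto simp: less_eq_complex_def)
  moreover have "complex_of_real (1 / C) * (complex_of_real C * s (\<alpha> + \<beta>)
      - (if \<alpha> = \<beta> then complex_of_real (R ^ (2 * mdeg \<alpha>)) else 0))
    = s (\<alpha> + \<beta>) - (if \<alpha> = \<beta> then complex_of_real (1 / C * R ^ (2 * mdeg \<alpha>)) else 0)" for \<alpha> \<beta>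
    using C by (auto simp: right_diff_distrib)
  ultimately have "psd (\<lambda>\<alpha> \<beta>. s (\<alpha> + \<beta>) - (if \<alpha> = \<beta> then complex_of_real (1 / C * R ^ (2 * mdeg \<alpha>)) else 0))"
    by simp
  with C show ?thesis
    unfolding gamma_R_pos_iff[OF assms(2)] by (intro exI[of _ "1 / C"]) auto
qed

lemma Pseries_finite_of_bounded:
  assumes "Pseries_bounded_on_compacts s"
  shows "Pseries_finite_at_some_nonreal s"
proof -
  have "(\<lambda>\<alpha>. (cmod (meval (orthoP s \<alpha>) (\<chi> i. \<i>)))\<^sup>2) summable_on UNIV"
    using assms unfolding Pseries_bounded_on_compacts_def by (metis compact_sing singletonI)
  then show ?thesis
    unfolding Pseries_finite_at_some_nonreal_def
    by (intro exI[of _ "\<chi> i. \<i>"]) (auto simp: complex_is_Real_iff)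
qed

text \<open>The one-dimensional marginals of the measure are recorded as well, because indeterminacy
  is read off from their atoms.\<close>

lemma product_measure_represents:
  assumes \<nu>: "\<And>i. real_distribution (\<nu> i)" "\<And>i k. integrable (\<nu> i) (\<lambda>x. x ^ k)"
    "\<And>i k. (\<integral>x. x ^ k \<partial>\<nu> i) = marginal s i k"
  obtains \<mu> where "prob_space \<mu>" "represents \<mu> s" "\<And>i. distr \<mu> borel (\<lambda>y. y $ i) = \<nu> i"
proof -
  interpret \<nu>: real_distribution "\<nu> i" for i by (rule \<nu>)
  interpret P: product_prob_space \<nu> UNIV
    by unfold_locales
  define N where "N = PiM UNIV \<nu>"
  interpret N: prob_space N
    unfolding N_def by (rule prob_space_PiM) (rule \<nu>.prob_space_axioms)
  define T where "T = (\<lambda>f :: 'd \<Rightarrow> real. \<chi> i. f i)"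
  have comp: "(\<lambda>f. f i) \<in> borel_measurable N" for i
  proof -
    have "(\<lambda>f. f i) \<in> measurable N (\<nu> i)"
      unfolding N_def by (rule measurable_component_singleton) simp
    then show ?thesis
      by (simp cong: measurable_cong_sets)
  qed
  have T: "T \<in> borel_measurable N"
    unfolding borel_measurable_euclidean_space[of T]
    using comp by (auto simp: Basis_vec_def T_def inner_axis)
  have mp: "(\<lambda>y :: (real, 'd) vec. mpower y \<alpha>) \<in> borel_measurable borel" for \<alpha>
    unfolding mpower_def by (intro borel_measurable_continuous_onI continuous_intros)
  have mT: "mpower (T f) \<alpha> = (\<Prod>i\<in>UNIV. (f i) ^ Poly_Mapping.lookup \<alpha> i)" for f \<alpha>
    by (simp add: mpower_def T_def)
  show ?thesis
  proof (rule that[of "distr N borel T"])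
    show "prob_space (distr N borel T)"
      by (rule N.prob_space_distr) (rule T)
    have "integrable N (\<lambda>f. mpower (T f) \<alpha>)" for \<alpha>
      unfolding mT N_def by (rule P.product_integrable_prod) (use \<nu> in auto)
    then have int: "integrable (distr N borel T) (\<lambda>y. mpower y \<alpha>)" for \<alpha>
      by (subst integrable_distr_eq[OF T mp])
    have "(\<integral>y. mpower y \<alpha> \<partial>distr N borel T) = (\<Prod>i\<in>UNIV. marginal s i (Poly_Mapping.lookup \<alpha> i))" for \<alpha>
    proof -
      have "(\<integral>y. mpower y \<alpha> \<partial>distr N borel T) = (\<integral>f. mpower (T f) \<alpha> \<partial>N)"
        by (rule integral_distr[OF T mp])
      also have "\<dots> = (\<Prod>i\<in>UNIV. (\<integral>x. x ^ Poly_Mapping.lookup \<alpha> i \<partial>\<nu> i))"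
        unfolding mT N_def by (rule P.product_integral_prod) (use \<nu> in auto)
      finally show ?thesis by (simp add: \<nu>(3))
    qed
    then have "complex_of_real (\<integral>y. mpower y \<alpha> \<partial>distr N borel T) = s \<alpha>" for \<alpha>
      by (subst s_marginals) simp
    with int show "represents (distr N borel T) s"
      by (simp add: represents_def finite_moments_def)
    show "distr (distr N borel T) borel (\<lambda>y. y $ i) = \<nu> i" for i
    proof -
      have "(\<lambda>y :: (real, 'd) vec. y $ i) \<in> borel_measurable borel"
        by (intro borel_measurable_continuous_onI continuous_intros)
      then have "distr (distr N borel T) borel (\<lambda>y. y $ i) = distr N borel (\<lambda>f. f i)"
        by (subst distr_distr[OF _ T]) (auto simp: T_def comp_def)
      also have "\<dots> = distr N (\<nu> i) (\<lambda>f. f i)"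
        by (rule distr_cong) simp_all
      also have "\<dots> = \<nu> i"
        unfolding N_def by (rule P.PiM_component) simp
      finally show ?thesis .
    qed
  qed
qed

section \<open>Existence and indeterminacy of representing measures\<close>

lemma representing_measure_exists: "\<exists>\<mu>. represents \<mu> s"
proof -
  have "\<exists>\<nu>. real_distribution \<nu> \<and> (\<forall>k. integrable \<nu> (\<lambda>x. x ^ k)) \<and> (\<forall>k. (\<integral>x. x ^ k \<partial>\<nu>) = marginal s i k)" for i
    by (rule pd_moments.hamburger[OF pd_moments_marginal[of i]]) blast
  then obtain \<nu> where "\<And>i. real_distribution (\<nu> i)" "\<And>i k. integrable (\<nu> i) (\<lambda>x. x ^ k)"
    "\<And>i k. (\<integral>x. x ^ k \<partial>\<nu> i) = marginal s i k"
    by metis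
  then show ?thesis
    by (rule product_measure_represents) blast
qed

lemma indeterminate_of_marginal_evals:
  assumes bd: "marginal_evals_bounded s" and \<mu>: "represents \<mu> s"
  shows "indeterminate \<mu>"
proof
  assume det: "determinate \<mu>"
  fix i0 :: 'd
  \<comment> \<open>Determinacy identifies \<mu> with a product measure that depends on x, so one
    fixed marginal of \<mu> charges every real number. That \<mu> is a probability measure comes
    from the same identification and limits its marginal to countably many atoms.\<close>
  have atom: "prob_space \<mu> \<and> measure (distr \<mu> borel (\<lambda>y. y $ i0)) {x} > 0" for x :: real
  proof -
    have "\<exists>\<nu>. real_distribution \<nu> \<and> (\<forall>k. integrable \<nu> (\<lambda>x. x ^ k)) \<and>
        (\<forall>k. (\<integral>x. x ^ k \<partial>\<nu>) = marginal s i k) \<and> 0 < measure \<nu> {x}" for i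
    proof -
      obtain M where "\<And>z. cmod z \<le> \<bar>x\<bar> \<Longrightarrow> eval_bounded (marginal s i) z M"
        using bd unfolding marginal_evals_bounded_def by metis
      then have "eval_bounded (marginal s i) (complex_of_real x) M"
        by simp
      then show ?thesis
        by (rule pd_moments.hamburger_with_atom[OF pd_moments_marginal]) blast
    qed
    then obtain \<nu> where \<nu>: "\<And>i. real_distribution (\<nu> i)" "\<And>i k. integrable (\<nu> i) (\<lambda>x. x ^ k)"
      "\<And>i k. (\<integral>x. x ^ k \<partial>\<nu> i) = marginal s i k" and pos: "\<And>i. 0 < measure (\<nu> i) {x}"
      by metis
    obtain \<kappa> where \<kappa>: "prob_space \<kappa>" "represents \<kappa> s" "\<And>i. distr \<kappa> borel (\<lambda>y. y $ i) = \<nu> i"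
      using product_measure_represents[OF \<nu>] by blast
    have "complex_of_real (\<integral>y. mpower y \<alpha> \<partial>\<kappa>) = complex_of_real (\<integral>y. mpower y \<alpha> \<partial>\<mu>)" for \<alpha>
      using \<kappa>(2) \<mu> by (simp add: represents_def)
    then have "\<kappa> = \<mu>"
      using det \<kappa>(2) by (auto simp: determinate_def represents_def)
    with \<kappa> pos[of i0] show ?thesis by auto
  qed
  interpret \<mu>: prob_space \<mu>
    using atom by blast
  have "(\<lambda>y :: (real, 'd) vec. y $ i0) \<in> borel_measurable borel"
    by (intro borel_measurable_continuous_onI continuous_intros)
  then have "(\<lambda>y. y $ i0) \<in> borel_measurable \<mu>"
    using \<mu> by (simp add: represents_def finite_moments_def cong: measurable_cong_sets)
  then interpret D: prob_space "distr \<mu> borel (\<lambda>y. y $ i0)"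
    by (rule \<mu>.prob_space_distr)
  have "{x. measure (distr \<mu> borel (\<lambda>y. y $ i0)) {x} \<noteq> 0} = UNIV"
    using atom by (auto simp: less_imp_neq[symmetric] dest: less_imp_neq)
  with D.countable_support uncountable_UNIV_real show False
    by simp
qed

end

theorem theorem3p1:
  fixes s :: "'d::{finite,linorder} mindex \<Rightarrow> complex"
  assumes "positive_multisequence s"
    and "s 0 = 1"
    and "\<forall>p. p \<noteq> 0 \<longrightarrow> 0 < Lfun s (p * mcnj p)"
    and "\<forall>\<alpha>. s \<alpha> = (\<Prod>i\<in>UNIV. s (Poly_Mapping.single i (Poly_Mapping.lookup \<alpha> i)))"
  shows "(\<exists>\<mu>. represents \<mu> s)
    \<and> (gamma_R s 1 > 0 \<longleftrightarrow> (\<forall>R>0. gamma_R s R > 0))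
    \<and> ((\<forall>R>0. gamma_R s R > 0) \<longleftrightarrow> Pseries_bounded_on_compacts s)
    \<and> (Pseries_bounded_on_compacts s \<longleftrightarrow> Pseries_finite_at_some_nonreal s)
    \<and> (\<forall>\<mu>. represents \<mu> s \<longrightarrow>
          (gamma_R s 1 > 0 \<longrightarrow> indeterminate \<mu>) \<and>
          ((\<forall>R>0. gamma_R s R > 0) \<longrightarrow> indeterminate \<mu>) \<and>
          (Pseries_bounded_on_compacts s \<longrightarrow> indeterminate \<mu>) \<and>
          (Pseries_finite_at_some_nonreal s \<longrightarrow> indeterminate \<mu>))"
proof -
  interpret pd_product_multisequence s
    by unfold_locales (use assms in blast)+
  have 1: "gamma_R s 1 > 0 \<longleftrightarrow> marginal_evals_bounded s"
    using marginal_evals_bounded_of_gamma gamma_pos_of_marginal_evals[of 1] by auto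
  have 2: "(\<forall>R>0. gamma_R s R > 0) \<longleftrightarrow> marginal_evals_bounded s"
    using 1 gamma_pos_of_marginal_evals by (metis zero_less_one)
  have 3: "Pseries_bounded_on_compacts s \<longleftrightarrow> marginal_evals_bounded s"
    using Pseries_bounded_of_marginal_evals Pseries_finite_of_bounded
      marginal_evals_bounded_of_Pseries_finite by blast
  have 4: "Pseries_finite_at_some_nonreal s \<longleftrightarrow> marginal_evals_bounded s"
    using 3 Pseries_finite_of_bounded marginal_evals_bounded_of_Pseries_finite by blast
  show ?thesis
    unfolding 1 2 3 4 using representing_measure_exists indeterminate_of_marginal_evals by blast
qed

end
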